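(* Let $\mathbf{K}_1$ be the class of countable simple planes and $\mathbf{K}_2$ the class of countable non-Desarguesian projective planes, and let $\mathbf{K}$ be either $\mathbf{K}_1$ or $\mathbf{K}_2$. Then: (1) $\mathbf{K}$ is Borel complete (i.e. the isomorphism relation on $\mathbf{K}$ is $\mathrm{Sym}(\omega)$-complete); (2) $\mathbf{K}$ does not admit an Ulm type classification.
   Context: A plane is a system of points and lines (lines being regarded as sets of points) such that: (A) every pair of distinct points determines a unique line (i.e. lies on exactly one common line); (B) every pair of distinct lines intersects in at most one point; (C) every line contains at least two points; (D) there exist at least three non-collinear points. A plane is projective if in addition (B') every pair of distinct lines intersects in exactly one point. A point and a line are incident if the point is contained in the line. A line is trivial if it is incident with exactly two points, and non-trivial otherwise. A plane is simple (or $17$-simple) if, except for $17$ points, every point is incident with at most two non-trivial lines. For distinct points $a,b$, $a\vee b$ is the unique line they determine; for distinct lines $\ell,\ell'$ of a projective plane, $\ell\wedge\ell'$ is their unique common point. A projective plane is Desarguesian if for any two triples of distinct points $p,q,r$ and $p',q',r'$, if the lines $p\vee p'$, $q\vee q'$ and $r\vee r'$ are incident with a common point, then the points $(p\vee q)\wedge(p'\vee q')$, $(p\vee r)\wedge(p'\vee r')$ and $(q\vee r)\wedge(q'\vee r')$ are collinear, i.e. lie on a common line (this is required whenever all the lines and points mentioned are defined). A projective plane is non-Desarguesian if it is not Desarguesian. Planes are regarded as structures in a relational language specifying points, lines (e.g. two unary predicates partitioning the domain) and the point-line incidence relation; countable members of the classes are regarded as structures with domain $\omega$. The space of structures with domain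 $\omega$ in a countable relational language $L$ is $\prod_{R\in L}2^{\omega^{n_R}}$ ($n_R$ the arity of $R$) with the product topology. A class $\mathbf{K}$ of countable structures is identified with the (Borel) set of its members with domain $\omega$, with $\cong$ the isomorphism relation on it. An equivalence relation $E$ on a standard Borel space $X$ is Borel reducible to $F$ on $Y$ if there is a Borel $f:X\to Y$ with $x\,E\,x'\iff f(x)\,F\,f(x')$. $\mathbf{K}$ is Borel complete if $\cong$ on $\mathbf{K}$ is $\mathrm{Sym}(\omega)$-complete, i.e. every orbit equivalence relation of a Borel action of $\mathrm{Sym}(\omega)$ on a standard Borel space is Borel reducible to it (equivalently, the isomorphism relation on the countable models of any $\mathfrak{L}_{\omega_1,\omega}$-sentence is). Ulm type classification is in the sense of Hjorth and Kechris: $\mathbf{K}$ admits an Ulm type classification if there is a map $U:\mathbf{K}\to 2^{<\omega_1}$ (the set of countable transfinite sequences of $0$'s and $1$'s) with $M\cong N\iff U(M)=U(N)$ which is $C$-measurable in the codes. The latter means that there is a map $U^*$ from $\mathbf{K}$ to the Polish space of reals, measurable with respect to the smallest $\sigma$-algebra containing the Borel sets and closed under the Souslin operation $\mathcal{A}$, such that $U^*(M)$ is a code for $U(M)$, where elements of $2^{<\omega_1}$ are coded by reals in the standard way (a well-ordering of a subset of $\omega$ together with a subset of its field). *)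

theory Defs
  imports "HOL-Analysis.Analysis"
begin

section \<open>Planes with domain \<open>\<omega>\<close>\<close>

text \<open>
  A structure with domain \<open>\<omega>\<close> is a triple: the set of points, the set of lines, and the incidence
  relation. The type carries the product topology of \<open>2\<^sup>\<omega> \<times> 2\<^sup>\<omega> \<times> 2\<^sup>\<omega>\<^sup>\<times>\<^sup>\<omega>\<close>,
  and \<^term>\<open>borel\<close> is its Borel \<open>\<sigma>\<close>-algebra. Extensionality of lines, as sets of points,
  follows from (B) and (C) below.
\<close>

type_synonym struct = "(nat \<Rightarrow> bool) \<times> (nat \<Rightarrow> bool) \<times> (nat \<times> nat \<Rightarrow> bool)"

definition pt :: "struct \<Rightarrow> nat \<Rightarrow> bool" where
  "pt M = fst M"

definition ln :: "struct \<Rightarrow> nat \<Rightarrow> bool" where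
  "ln M = fst (snd M)"

definition inc :: "struct \<Rightarrow> nat \<Rightarrow> nat \<Rightarrow> bool" where
  "inc M p l \<longleftrightarrow> snd (snd M) (p, l)"

definition collinear_pts :: "struct \<Rightarrow> nat \<Rightarrow> nat \<Rightarrow> nat \<Rightarrow> bool" where
  "collinear_pts M p q r \<longleftrightarrow> (\<exists>l. ln M l \<and> inc M p l \<and> inc M q l \<and> inc M r l)"

definition plane :: "struct \<Rightarrow> bool" where
  "plane M \<longleftrightarrow>
     (\<forall>x. pt M x \<longleftrightarrow> \<not> ln M x) \<and>
     (\<forall>p l. inc M p l \<longrightarrow> pt M p \<and> ln M l) \<and>
     (\<comment> \<open>(A)\<close> \<forall>p q. pt M p \<and> pt M q \<and> p \<noteq> q \<longrightarrow> (\<exists>!l. ln M l \<and> inc M p l \<and> inc M q l)) \<and>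
     (\<comment> \<open>(B)\<close> \<forall>l l'. ln M l \<and> ln M l' \<and> l \<noteq> l' \<longrightarrow>
        (\<forall>p q. inc M p l \<and> inc M p l' \<and> inc M q l \<and> inc M q l' \<longrightarrow> p = q)) \<and>
     (\<comment> \<open>(C)\<close> \<forall>l. ln M l \<longrightarrow> (\<exists>p q. p \<noteq> q \<and> inc M p l \<and> inc M q l)) \<and>
     (\<comment> \<open>(D)\<close> \<exists>p q r. pt M p \<and> pt M q \<and> pt M r \<and> distinct [p, q, r] \<and> \<not> collinear_pts M p q r)"

definition projective :: "struct \<Rightarrow> bool" where
  "projective M \<longleftrightarrow> plane M \<and>
     (\<forall>l l'. ln M l \<and> ln M l' \<and> l \<noteq> l' \<longrightarrow> (\<exists>!p. pt M p \<and> inc M p l \<and> inc M p l'))"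

definition trivial_line :: "struct \<Rightarrow> nat \<Rightarrow> bool" where
  "trivial_line M l \<longleftrightarrow> ln M l \<and> card {p. inc M p l} = 2"

definition nontrivial_line :: "struct \<Rightarrow> nat \<Rightarrow> bool" where
  "nontrivial_line M l \<longleftrightarrow> ln M l \<and> \<not> trivial_line M l"

text \<open>
  The conjunct \<^const>\<open>finite\<close> is needed because \<^const>\<open>card\<close> of an infinite set is zero.
\<close>

definition simple_plane :: "struct \<Rightarrow> bool" where
  "simple_plane M \<longleftrightarrow> plane M \<and>
     (\<exists>S. card S = 17 \<and> (\<forall>p\<in>S. pt M p) \<and>
        (\<forall>p. pt M p \<and> p \<notin> S \<longrightarrow>
           finite {l. nontrivial_line M l \<and> inc M p l} \<and>
           card {l. nontrivial_line M l \<and> inc M p l} \<le> 2))"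

definition join :: "struct \<Rightarrow> nat \<Rightarrow> nat \<Rightarrow> nat" where
  "join M a b = (THE l. ln M l \<and> inc M a l \<and> inc M b l)"

definition meet :: "struct \<Rightarrow> nat \<Rightarrow> nat \<Rightarrow> nat" where
  "meet M l l' = (THE p. pt M p \<and> inc M p l \<and> inc M p l')"

text \<open>
  In the following definition the six disequations between corresponding points and between
  corresponding lines say that all the joins and meets involved are defined.
\<close>

definition desarguesian :: "struct \<Rightarrow> bool" where
  "desarguesian M \<longleftrightarrow>
     (\<forall>p q r p' q' r'.
        (\<forall>x \<in> {p, q, r, p', q', r'}. pt M x) \<and>
        distinct [p, q, r] \<and> distinct [p', q', r'] \<and>
        p \<noteq> p' \<and> q \<noteq> q' \<and> r \<noteq> r' \<and>
        join M p q \<noteq> join M p' q' \<and> join M p r \<noteq> join M p' r' \<and> join M q r \<noteq> join M q' r' \<and>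
        (\<exists>c. pt M c \<and> inc M c (join M p p') \<and> inc M c (join M q q') \<and> inc M c (join M r r'))
        \<longrightarrow> collinear_pts M
              (meet M (join M p q) (join M p' q'))
              (meet M (join M p r) (join M p' r'))
              (meet M (join M q r) (join M q' r')))"

definition simple_planes :: "struct set" where
  "simple_planes = {M. simple_plane M}"

definition nondesarguesian_planes :: "struct set" where
  "nondesarguesian_planes = {M. projective M \<and> \<not> desarguesian M}"

definition struct_iso :: "struct \<Rightarrow> struct \<Rightarrow> bool" where
  "struct_iso M N \<longleftrightarrow>
     (\<exists>g. bij g \<and> (\<forall>x. pt M x \<longleftrightarrow> pt N (g x)) \<and> (\<forall>x. ln M x \<longleftrightarrow> ln N (g x)) \<and>
          (\<forall>x y. inc M x y \<longleftrightarrow> inc N (g x) (g y)))"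


section \<open>Borel completeness\<close>

definition standard_borel :: "'x measure \<Rightarrow> bool" where
  "standard_borel X \<longleftrightarrow>
     (\<exists>T. topspace T = space X \<and> completely_metrizable_space T \<and> separable_space T \<and>
          sets X = sigma_sets (space X) {U. openin T U})"

text \<open>\<open>Sym(\<omega>)\<close> with the Borel structure inherited from \<open>\<omega>\<^sup>\<omega>\<close>.\<close>

definition Sym_omega :: "(nat \<Rightarrow> nat) measure" where
  "Sym_omega = restrict_space borel {g. bij g}"

definition borel_action :: "'x measure \<Rightarrow> ((nat \<Rightarrow> nat) \<Rightarrow> 'x \<Rightarrow> 'x) \<Rightarrow> bool" where
  "borel_action X a \<longleftrightarrow>
     (\<lambda>(g, x). a g x) \<in> measurable (Sym_omega \<Otimes>\<^sub>M X) X \<and>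
     (\<forall>x\<in>space X. a id x = x) \<and>
     (\<forall>g h. bij g \<longrightarrow> bij h \<longrightarrow> (\<forall>x\<in>space X. a (g \<circ> h) x = a g (a h x)))"

definition orbit_rel :: "((nat \<Rightarrow> nat) \<Rightarrow> 'x \<Rightarrow> 'x) \<Rightarrow> 'x \<Rightarrow> 'x \<Rightarrow> bool" where
  "orbit_rel a x y \<longleftrightarrow> (\<exists>g. bij g \<and> a g x = y)"

definition borel_reducible ::
  "'x measure \<Rightarrow> ('x \<Rightarrow> 'x \<Rightarrow> bool) \<Rightarrow> 'y measure \<Rightarrow> ('y \<Rightarrow> 'y \<Rightarrow> bool) \<Rightarrow> bool" where
  "borel_reducible X E Y F \<longleftrightarrow>
     (\<exists>f \<in> measurable X Y. \<forall>x\<in>space X. \<forall>x'\<in>space X. E x x' \<longleftrightarrow> F (f x) (f x'))"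

text \<open>
  The type \<open>'x\<close> holds the carriers of the standard Borel spaces quantified over. HOL cannot quantify
  over types inside a definition, so a theorem about \<open>borel_complete\<close> should leave \<open>'x\<close> a type
  variable; it then covers standard Borel spaces on every type. Membership in \<^term>\<open>sets borel\<close>
  makes \<open>K\<close> itself a standard Borel space, as Borel reducibility to \<open>\<cong>\<close> on \<open>K\<close> presupposes.
\<close>

definition borel_complete :: "'x itself \<Rightarrow> struct set \<Rightarrow> bool" where
  "borel_complete (_ :: 'x itself) K \<longleftrightarrow>
     K \<in> sets borel \<and>
     (\<forall>(X :: 'x measure) a. standard_borel X \<and> borel_action X a \<longrightarrow>
        borel_reducible X (orbit_rel a) (restrict_space borel K) struct_iso)"


section \<open>Ulm type classification\<close>

definition souslin_op :: "(nat list \<Rightarrow> 'x set) \<Rightarrow> 'x set" where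
  "souslin_op P = (\<Union>x :: nat \<Rightarrow> nat. \<Inter>n. P (map x [0..<n]))"

definition C_sets :: "'x measure \<Rightarrow> 'x set set" where
  "C_sets X = \<Inter>{S. sigma_algebra (space X) S \<and> sets X \<subseteq> S \<and>
                     (\<forall>P. range P \<subseteq> S \<longrightarrow> souslin_op P \<in> S)}"

definition C_algebra :: "'x measure \<Rightarrow> 'x measure" where
  "C_algebra X = sigma (space X) (C_sets X)"

text \<open>
  The first uncountable ordinal, as a (reflexive) well-order; its elements stand for the countable
  ordinals, and the ordinals below \<open>\<alpha>\<close> are the members of \<open>underS omega1 \<alpha>\<close>.
\<close>

definition omega1 :: "nat set rel" where
  "omega1 = cardSuc natLeq"

text \<open>\<open>2\<^sup><\<^sup>\<omega>\<^sup>1\<close>: the functions into \<open>{0,1}\<close> whose domain is a countable ordinal.\<close>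

definition countable_bin_seqs :: "(nat set \<rightharpoonup> bool) set" where
  "countable_bin_seqs = {s. \<exists>\<alpha>\<in>Field omega1. dom s = underS omega1 \<alpha>}"

text \<open>
  The reals used as codes are the points of the Polish space \<open>2\<^sup>\<omega>\<^sup>\<times>\<^sup>\<omega> \<times> 2\<^sup>\<omega>\<close>: a binary relation
  on \<open>\<omega>\<close>, which has to be a well-ordering of its field \<open>F\<close>, and a subset of \<open>F\<close>. The code is for
  \<open>s\<close> if the order isomorphism of \<open>F\<close> onto the domain of \<open>s\<close> maps that subset to the positions
  where \<open>s\<close> takes the value \<open>1\<close>.
\<close>

type_synonym real_code = "(nat \<times> nat \<Rightarrow> bool) \<times> (nat \<Rightarrow> bool)"

definition codes :: "real_code \<Rightarrow> (nat set \<rightharpoonup> bool) \<Rightarrow> bool" where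
  "codes c s \<longleftrightarrow>
     (let R = Collect (fst c); A = Collect (snd c) in
        Well_order R \<and> A \<subseteq> Field R \<and>
        (\<exists>f. iso R (Restr omega1 (dom s)) f \<and> A = {n \<in> Field R. s (f n) = Some True}))"

definition admits_Ulm_classification :: "struct set \<Rightarrow> bool" where
  "admits_Ulm_classification K \<longleftrightarrow>
     (\<exists>U \<in> K \<rightarrow> countable_bin_seqs.
        (\<forall>M\<in>K. \<forall>N\<in>K. struct_iso M N \<longleftrightarrow> U M = U N) \<and>
        (\<exists>U' \<in> measurable (C_algebra (restrict_space borel K)) (borel :: real_code measure).
           \<forall>M\<in>K. codes (U' M) (U M)))"

end

theory Submission
  imports Defs "HOL-Library.FSet"
begin

text \<open>
  Both classes are compared with structures \<open>R\<close> consisting of a set of finite sequences of natural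
  numbers, up to permutations of \<open>\<omega>\<close>. A Borel action of \<open>Sym(\<omega>)\<close> reduces to these by
  the Becker-Kechris argument: record for each basic open set and each member \<open>A\<close> of a countable
  separating family whether \<open>{g. g\<^sup>-\<^sup>1 x \<in> A}\<close> is nonmeager in it.

  From \<open>R\<close> one builds a configuration: a line for each number and for each finite sequence,
  two points tying a sequence to its tail and to its head, and private points whose number tells
  the length of a sequence and whether it is in \<open>R\<close>. Joining the remaining pairs of points by
  trivial lines gives a simple plane. For projective planes a Fano plane is attached to every point
  and line, a disjoint failing Desargues configuration is added, and the result is freely completed.
  The finite confined subconfigurations of a free completion lie in the configuration that
  one started from, and in their union the original points and lines are those of degree at least four.

  An Ulm type classification would order the classes of \<open>E\<^sub>0\<close> linearly, by the lexicographic order of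
  the invariants. This order is analytic in the codes, so as a subset of \<open>2\<^sup>\<omega> \<times> 2\<^sup>\<omega>\<close> it has the
  Baire property. By the zero-one law it is meager or comeager, and so is its
  converse, to which it is homeomorphic by exchanging coordinates. Then it and its converse are both
  meager, so \<open>E\<^sub>0\<close> would be comeager, which it is not.
\<close>

section \<open>Baire category\<close>

text \<open>Whatever is added to a configuration has to be recognizable from incidence alone, and
  this fixes the numbers. A trivial line has two points, so original lines get at least three. A
  freely added cell is adjacent, when it appears, only to the two cells it was made from, so it
  cannot come last in a finite set whose members all have three neighbours inside. In a Fano plane
  every cell has exactly three neighbours: attached to a cell it makes this cell confined, and a
  neighbour in the original configuration is then a fourth. The cells of the Desargues configuration
  have at most three neighbours there, and so are not mistaken for original ones; the completion
  adds no incidence between cells already present, so the missing incidence stays missing. Of a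
  C-measurable map only the Baire property of preimages is used, which survives the Souslin
  operation. An isomorphism between initial segments of two codes is a sequence of numbers subject
  to countably many conditions on pairs of its values, hence in the scope of that operation.\<close>

locale countable_base =
  fixes B :: "'i::countable \<Rightarrow> 'a set"
  assumes base_Int: "x \<in> B i \<Longrightarrow> x \<in> B j \<Longrightarrow> \<exists>k. x \<in> B k \<and> B k \<subseteq> B i \<inter> B j"
begin

text \<open>The base sets may be empty and need not cover the type; a set that avoids all of them is
  nowhere dense. This allows the permutations of \<omega> to be handled inside the type of all
  functions.\<close>

definition nowhere_dense :: "'a set \<Rightarrow> bool" where
  "nowhere_dense A \<longleftrightarrow> (\<forall>i. B i \<noteq> {} \<longrightarrow> (\<exists>j. B j \<noteq> {} \<and> B j \<subseteq> B i \<and> B j \<inter> A = {}))"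

definition meager :: "'a set \<Rightarrow> bool" where
  "meager A \<longleftrightarrow> (\<exists>N :: nat \<Rightarrow> 'a set. (\<forall>n. nowhere_dense (N n)) \<and> A \<subseteq> (\<Union>n. N n))"

definition baire_property :: "'a set \<Rightarrow> bool" where
  "baire_property A \<longleftrightarrow> (\<exists>J. meager (sym_diff A (\<Union>i\<in>J. B i)))"

lemma nowhere_dense_imp_meager: "nowhere_dense A \<Longrightarrow> meager A"
  unfolding meager_def by (rule exI[of _ "\<lambda>_. A"]) auto

lemma meager_subset: "meager A \<Longrightarrow> A' \<subseteq> A \<Longrightarrow> meager A'"
  unfolding meager_def by blast

lemma meager_empty [simp]: "meager {}"
  by (rule nowhere_dense_imp_meager) (auto simp: nowhere_dense_def)

lemma meager_UN_nat:
  assumes "\<And>n :: nat. meager (A n)"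
  shows "meager (\<Union>n. A n)"
proof -
  have "\<forall>n. \<exists>N :: nat \<Rightarrow> 'a set. (\<forall>k. nowhere_dense (N k)) \<and> A n \<subseteq> (\<Union>k. N k)"
    using assms unfolding meager_def by blast
  then obtain N :: "nat \<Rightarrow> nat \<Rightarrow> 'a set"
    where N: "\<And>n k. nowhere_dense (N n k)" "\<And>n. A n \<subseteq> (\<Union>k. N n k)" by metis
  have "(\<Union>n. A n) \<subseteq> (\<Union>m. N (fst (prod_decode m)) (snd (prod_decode m)))"
  proof
    fix x assume "x \<in> (\<Union>n. A n)"
    then obtain n k where "x \<in> N n k" using N(2) by blast
    then have "x \<in> N (fst (prod_decode (prod_encode (n, k)))) (snd (prod_decode (prod_encode (n, k))))"
      by simp
    then show "x \<in> (\<Union>m. N (fst (prod_decode m)) (snd (prod_decode m)))" by blast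
  qed
  with N(1) show ?thesis unfolding meager_def
    by (intro exI[of _ "\<lambda>m. N (fst (prod_decode m)) (snd (prod_decode m))"]) simp
qed

lemma meager_UN:
  assumes "countable I" "\<And>i. i \<in> I \<Longrightarrow> meager (A i)"
  shows "meager (\<Union>i\<in>I. A i)"
proof (cases "I = {}")
  case False
  then have "(\<Union>i\<in>I. A i) = (\<Union>n. A (from_nat_into I n))"
    using assms(1) by (metis image_image range_from_nat_into)
  moreover have "meager (\<Union>n. A (from_nat_into I n))"
    by (intro meager_UN_nat assms(2) from_nat_into False)
  ultimately show ?thesis by simp
qed simp

lemma meager_Un:
  assumes "meager A" "meager A'"
  shows "meager (A \<union> A')"
proof -
  have "meager (\<Union>C\<in>{A, A'}. C)" by (rule meager_UN) (use assms in auto)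
  then show ?thesis by simp
qed

lemma baire_property_meager: "meager A \<Longrightarrow> baire_property A"
  unfolding baire_property_def by (rule exI[of _ "{}"]) simp

lemma baire_property_base: "baire_property (B i)"
  unfolding baire_property_def by (rule exI[of _ "{i}"]) simp

lemma baire_property_cong:
  assumes "baire_property A" "meager (sym_diff A A')"
  shows "baire_property A'"
proof -
  obtain J where J: "meager (sym_diff A (\<Union>i\<in>J. B i))"
    using assms(1) by (auto simp: baire_property_def)
  have "meager (sym_diff A' (\<Union>i\<in>J. B i))"
    by (rule meager_subset[OF meager_Un[OF J assms(2)]]) blast
  then show ?thesis by (auto simp: baire_property_def)
qed

lemma baire_property_UN:
  assumes "countable I" "\<And>i. i \<in> I \<Longrightarrow> baire_property (A i)"
  shows "baire_property (\<Union>i\<in>I. A i)"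
proof -
  obtain J where J: "\<And>i. i \<in> I \<Longrightarrow> meager (sym_diff (A i) (\<Union>j\<in>J i. B j))"
    using assms(2) unfolding baire_property_def by metis
  have "meager (sym_diff (\<Union>i\<in>I. A i) (\<Union>j\<in>(\<Union>i\<in>I. J i). B j))"
    by (rule meager_subset[OF meager_UN[OF assms(1) J]]) auto
  then show ?thesis unfolding baire_property_def by blast
qed

text \<open>The exterior \<open>V\<close> of the approximating open set \<open>U\<close>
  approximates the complement: every nonempty base set either is part of \<open>V\<close> or
  contains a nonempty base set inside \<open>U\<close>, so \<open>- U - V\<close> is nowhere
  dense.\<close>

lemma baire_property_Compl:
  assumes "baire_property A"
  shows "baire_property (- A)"
proof -
  obtain J where J: "meager (sym_diff A (\<Union>i\<in>J. B i))"
    using assms(1) by (auto simp: baire_property_def)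
  define U where "U = (\<Union>i\<in>J. B i)"
  define V where "V = (\<Union>i\<in>{i. B i \<inter> U = {}}. B i)"
  have "nowhere_dense (- U - V)"
    unfolding nowhere_dense_def
  proof (intro allI impI)
    fix i assume i: "B i \<noteq> {}"
    show "\<exists>j. B j \<noteq> {} \<and> B j \<subseteq> B i \<and> B j \<inter> (- U - V) = {}"
    proof (cases "B i \<inter> U = {}")
      case True
      then show ?thesis using i by (intro exI[of _ i]) (auto simp: V_def)
    next
      case False
      then obtain x j where "x \<in> B i" "x \<in> B j" "j \<in> J" by (auto simp: U_def)
      then obtain k where "x \<in> B k" "B k \<subseteq> B i \<inter> B j" using base_Int by blast
      then show ?thesis using \<open>j \<in> J\<close> by (intro exI[of _ k]) (auto simp: U_def)
    qed
  qed
  then have "meager (sym_diff A U \<union> (- U - V))"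
    using meager_Un[OF J[folded U_def] nowhere_dense_imp_meager] by blast
  then have "meager (sym_diff (- A) V)"
    by (rule meager_subset) (auto simp: V_def)
  then show ?thesis unfolding baire_property_def V_def by blast
qed

lemma sigma_algebra_baire_property: "sigma_algebra UNIV {A. baire_property A}"
  unfolding sigma_algebra_iff2
proof (intro conjI ballI allI impI)
  fix A :: "nat \<Rightarrow> 'a set" assume "range A \<subseteq> {A. baire_property A}"
  then have "baire_property (\<Union>n\<in>UNIV. A n)" by (intro baire_property_UN) auto
  then show "(\<Union>n. A n) \<in> {A. baire_property A}" by simp
next
  fix A assume "A \<in> {A. baire_property A}"
  then show "UNIV - A \<in> {A. baire_property A}"
    using baire_property_Compl[of A] by (simp only: Compl_eq_Diff_UNIV mem_Collect_eq)
qed (simp_all add: baire_property_meager)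

lemma baire_property_Int:
  assumes "baire_property A" "baire_property A'"
  shows "baire_property (A \<inter> A')"
proof -
  interpret sigma_algebra UNIV "{A. baire_property A}" by (rule sigma_algebra_baire_property)
  show ?thesis using Int[of A A'] assms by simp
qed

lemma baire_property_Diff:
  assumes "baire_property A" "baire_property A'"
  shows "baire_property (A - A')"
  unfolding Diff_eq by (intro baire_property_Int baire_property_Compl assms)

text \<open>If \<open>A\<close> were meager in every base set of the approximating open set, these
  countably many pieces together with the symmetric difference would cover \<open>A\<close>.\<close>

lemma nonmeager_localize:
  assumes "baire_property A" "\<not> meager A"
  obtains i where "meager (B i - A)" "\<not> meager (B i \<inter> A)"
proof -
  obtain J where J: "meager (sym_diff A (\<Union>i\<in>J. B i))"
    using assms(1) unfolding baire_property_def by blast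
  have "\<exists>i\<in>J. \<not> meager (B i \<inter> A)"
  proof (rule ccontr)
    assume "\<not> ?thesis"
    then have "meager (\<Union>i\<in>J. B i \<inter> A)" by (intro meager_UN) auto
    from meager_Un[OF this J] have "meager A" by (rule meager_subset) auto
    with assms(2) show False by simp
  qed
  moreover have "meager (B i - A)" if "i \<in> J" for i
    by (rule meager_subset[OF J]) (use that in auto)
  ultimately show ?thesis using that by blast
qed

text \<open>The envelope adds to \<open>A\<close> the complement of the union \<open>U\<close> of
  all base sets in which \<open>A\<close> is meager; it has the Baire property because
  \<open>A \<inter> U\<close> is meager. A nonmeager \<open>C\<close> in the envelope and disjoint
  from \<open>A\<close> would be comeager in some base set, which then belongs to \<open>U\<close>,
  although \<open>C\<close> lies outside \<open>U\<close>.\<close>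

lemma baire_envelope:
  obtains E where "A \<subseteq> E" "baire_property E"
    "\<And>C. baire_property C \<Longrightarrow> C \<subseteq> E \<Longrightarrow> C \<inter> A = {} \<Longrightarrow> meager C"
proof -
  define U where "U = (\<Union>i\<in>{i. meager (B i \<inter> A)}. B i)"
  have "baire_property U" unfolding U_def by (intro baire_property_UN baire_property_base) auto
  moreover have "meager (A \<inter> U)"
  proof -
    have "meager (\<Union>i\<in>{i. meager (B i \<inter> A)}. B i \<inter> A)" by (rule meager_UN) auto
    then show ?thesis by (rule meager_subset) (auto simp: U_def)
  qed
  moreover have "sym_diff (- U) (A \<union> - U) = A \<inter> U" by blast
  ultimately have "baire_property (A \<union> - U)"
    using baire_property_cong[OF baire_property_Compl[of U], of "A \<union> - U"] by simp
  moreover have "meager C" if C: "baire_property C" "C \<subseteq> A \<union> - U" "C \<inter> A = {}" for C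
  proof (rule ccontr)
    assume "\<not> meager C"
    then obtain i where i: "meager (B i - C)" "\<not> meager (B i \<inter> C)"
      using nonmeager_localize C(1) by blast
    have "meager (B i \<inter> A)" by (rule meager_subset[OF i(1)]) (use C(3) in auto)
    then have "B i \<subseteq> U" by (auto simp: U_def)
    then have "B i \<inter> C = {}" using C by blast
    with i(2) show False by simp
  qed
  ultimately show ?thesis using that[of "A \<union> - U"] by auto
qed

text \<open>
  Nikodym's argument: cut the branch set above each finite sequence by its envelope; the points of
  an envelope that leave all envelopes of the immediate successors form a meager set.
\<close>

lemma baire_property_souslin_op:
  assumes P: "\<And>s. baire_property (P s)"
  shows "baire_property (souslin_op P)"
proof -
  define br where "br s = {z. \<exists>x :: nat \<Rightarrow> nat. map x [0..<length s] = s \<and>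
      (\<forall>n. z \<in> P (map x [0..<n]))}" for s
  have "\<exists>E. br s \<subseteq> E \<and> baire_property E \<and>
      (\<forall>C. baire_property C \<longrightarrow> C \<subseteq> E \<longrightarrow> C \<inter> br s = {} \<longrightarrow> meager C)" for s
    by (rule baire_envelope[of "br s"]) blast
  then obtain E where E: "\<And>s. br s \<subseteq> E s" "\<And>s. baire_property (E s)"
    "\<And>s C. baire_property C \<Longrightarrow> C \<subseteq> E s \<Longrightarrow> C \<inter> br s = {} \<Longrightarrow> meager C"
    by metis
  define F where "F s = E s \<inter> P s" for s
  have F_BP: "baire_property (F s)" for s
    unfolding F_def by (intro baire_property_Int E P)
  have br_P: "br s \<subseteq> P s" for s
  proof
    fix z assume "z \<in> br s"
    then obtain x where x: "map x [0..<length s] = s" "\<forall>n. z \<in> P (map x [0..<n])"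
      by (auto simp: br_def)
    from x(2) have "z \<in> P (map x [0..<length s])" by blast
    then show "z \<in> P s" by (simp only: x(1))
  qed
  have br_F: "br s \<subseteq> F s" for s using E(1) br_P by (auto simp: F_def)
  have br_step: "br s = (\<Union>k. br (s @ [k]))" for s
  proof (intro subset_antisym subsetI)
    fix z assume "z \<in> br s"
    then obtain x where "map x [0..<length s] = s" "\<forall>n. z \<in> P (map x [0..<n])"
      by (auto simp: br_def)
    then have "z \<in> br (s @ [x (length s)])" by (auto simp: br_def intro!: exI[of _ x])
    then show "z \<in> (\<Union>k. br (s @ [k]))" by blast
  qed (auto simp: br_def)
  define C where "C s = F s - (\<Union>k. F (s @ [k]))" for s
  have "meager (C s)" for s
  proof (rule E(3)[of _ s])
    show "baire_property (C s)"
      unfolding C_def by (intro baire_property_Diff baire_property_UN F_BP) auto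
    show "C s \<subseteq> E s" by (auto simp: C_def F_def)
    show "C s \<inter> br s = {}" using br_step[of s] br_F by (auto simp: C_def)
  qed
  then have meagC: "meager (\<Union>s. C s)" by (intro meager_UN) auto
  have "F [] - (\<Union>s. C s) \<subseteq> souslin_op P"
  proof
    fix z assume z: "z \<in> F [] - (\<Union>s. C s)"
    then have step: "\<exists>k. z \<in> F (s @ [k])" if "z \<in> F s" for s
      using that by (auto simp: C_def)
    have "\<exists>t. \<forall>n. (z \<in> F (t n) \<and> (n = 0 \<longrightarrow> t n = [])) \<and> (\<exists>k. t (Suc n) = t n @ [k])"
    proof (rule dependent_nat_choice)
      show "\<exists>s. z \<in> F s \<and> ((0 :: nat) = 0 \<longrightarrow> s = [])" using z by blast
    next
      fix s and n :: nat assume "z \<in> F s \<and> (n = 0 \<longrightarrow> s = [])"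
      then show "\<exists>s'. (z \<in> F s' \<and> (Suc n = 0 \<longrightarrow> s' = [])) \<and> (\<exists>k. s' = s @ [k])"
        using step by blast
    qed
    then obtain t where t: "t 0 = []" "\<And>n. z \<in> F (t n)" "\<And>n. \<exists>k. t (Suc n) = t n @ [k]"
      by auto
    then obtain x where x: "\<And>n. t (Suc n) = t n @ [x n]" by metis
    have "t n = map x [0..<n]" for n by (induction n) (auto simp: t(1) x)
    then have "z \<in> P (map x [0..<n])" for n using t(2)[of n] by (auto simp: F_def)
    then show "z \<in> souslin_op P" by (auto simp: souslin_op_def)
  qed
  moreover have "souslin_op P = br []" by (auto simp: souslin_op_def br_def)
  ultimately have "sym_diff (F []) (souslin_op P) \<subseteq> (\<Union>s. C s)"
    using br_F[of "[]"] by blast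
  then show ?thesis using baire_property_cong[OF F_BP] meager_subset[OF meagC] by blast
qed

text \<open>\<open>contract\<close> brings a given base set to the other side, where the nowhere
  dense set is avoided, and \<open>expand\<close> brings the smaller base set back. For the
  bijections used below both are checked on cylinders.\<close>

lemma meager_vimage:
  assumes "meager A"
    and contract: "\<And>i. B i \<noteq> {} \<Longrightarrow> \<exists>j. B j \<noteq> {} \<and> f -` B j \<subseteq> B i"
    and expand: "\<And>i. B i \<noteq> {} \<Longrightarrow> \<exists>j. B j \<noteq> {} \<and> B j \<subseteq> f -` B i"
  shows "meager (f -` A)"
proof -
  have nd: "nowhere_dense (f -` N)" if N: "nowhere_dense N" for N
    unfolding nowhere_dense_def
  proof (intro allI impI)
    fix i assume "B i \<noteq> {}"
    then obtain j where j: "B j \<noteq> {}" "f -` B j \<subseteq> B i" using contract by blast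
    then obtain k where k: "B k \<noteq> {}" "B k \<subseteq> B j" "B k \<inter> N = {}"
      using N[unfolded nowhere_dense_def, rule_format, OF j(1)] by blast
    then obtain l where "B l \<noteq> {}" "B l \<subseteq> f -` B k" using expand by blast
    then show "\<exists>j. B j \<noteq> {} \<and> B j \<subseteq> B i \<and> B j \<inter> f -` N = {}"
      using j k by (intro exI[of _ l]) blast
  qed
  obtain N where N: "\<And>n :: nat. nowhere_dense (N n)" "A \<subseteq> (\<Union>n. N n)"
    using assms(1) by (auto simp: meager_def)
  then have "f -` A \<subseteq> (\<Union>n. f -` N n)" by blast
  with nd N(1) show ?thesis
    unfolding meager_def by (intro exI[of _ "\<lambda>n. f -` N n"]) simp
qed

end

section \<open>Category in spaces of sequences\<close>

locale seq_space =
  fixes \<Omega> :: "(nat \<Rightarrow> 'b::countable) set"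
begin

definition cyl :: "'b list \<Rightarrow> (nat \<Rightarrow> 'b) set" where
  "cyl s = {x \<in> \<Omega>. map x [0..<length s] = s}"

lemma cyl_prefix:
  assumes "x \<in> \<Omega>" "m \<le> n"
  shows "cyl (map x [0..<n]) \<subseteq> cyl (map x [0..<m])"
  using assms by (auto simp: cyl_def map_eq_conv)

sublocale countable_base cyl
proof
  fix x s t assume "x \<in> cyl s" "x \<in> cyl t"
  then have x: "x \<in> \<Omega>" "map x [0..<length s] = s" "map x [0..<length t] = t" by (auto simp: cyl_def)
  define u where "u = map x [0..<max (length s) (length t)]"
  have "x \<in> cyl u" using x by (simp add: cyl_def u_def)
  moreover have "cyl u \<subseteq> cyl s" "cyl u \<subseteq> cyl t"
    using cyl_prefix[OF x(1), of "length s" "max (length s) (length t)"]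
      cyl_prefix[OF x(1), of "length t" "max (length s) (length t)"] x by (auto simp: u_def)
  ultimately show "\<exists>k. x \<in> cyl k \<and> cyl k \<subseteq> cyl s \<inter> cyl t" by blast
qed

text \<open>\<open>\<Omega>\<close> need not be closed, so the limit of a decreasing sequence of
  cylinders may fall outside it. The requirements \<open>Q n\<close>, each decided by an initial
  segment, are met one after another along the construction and bring the limit back into
  \<open>\<Omega>\<close>.\<close>

lemma baire_category:
  fixes Q :: "nat \<Rightarrow> 'b list \<Rightarrow> bool"
  assumes "cyl s \<noteq> {}"
    and limit: "\<And>x. (\<And>n. cyl (map x [0..<n]) \<noteq> {}) \<Longrightarrow>
        (\<And>n. \<exists>m. Q n (map x [0..<m])) \<Longrightarrow> x \<in> \<Omega>"
    and dense: "\<And>n x. x \<in> \<Omega> \<Longrightarrow> \<exists>m. Q n (map x [0..<m])"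
  shows "\<not> meager (cyl s)"
proof
  assume "meager (cyl s)"
  then obtain N where N: "\<And>n :: nat. nowhere_dense (N n)" "cyl s \<subseteq> (\<Union>n. N n)"
    by (auto simp: meager_def)
  define ok where "ok n u v \<longleftrightarrow> (\<exists>w. v = u @ w) \<and> n < length v \<and> (\<exists>m. Q n (take m v)) \<and>
      cyl v \<inter> N n = {}" for n and u v :: "'b list"
  have step: "\<exists>v. cyl v \<noteq> {} \<and> ok n u v" if u: "cyl u \<noteq> {}" for n u
  proof -
    obtain t where t: "cyl t \<noteq> {}" "cyl t \<subseteq> cyl u" "cyl t \<inter> N n = {}"
      using N(1)[of n, unfolded nowhere_dense_def, rule_format, OF u] by blast
    then obtain x where x: "x \<in> cyl t" by blast
    then have xs: "x \<in> \<Omega>" "map x [0..<length u] = u" "map x [0..<length t] = t"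
      using t(2) by (auto simp: cyl_def)
    obtain m where m: "Q n (map x [0..<m])" using dense xs(1) by blast
    \<comment> \<open>Long enough to extend \<open>u\<close>, to stay inside \<open>cyl t\<close>,
      to show the witness of \<open>Q n\<close>, and to exceed \<open>n\<close>.\<close>
    define l where "l = length u + length t + m + Suc n"
    define v where "v = map x [0..<l]"
    have "v = u @ map x [length u..<l]"
      using upt_add_eq_append[of 0 "length u" "length t + m + Suc n"] xs(2)
      by (simp add: v_def l_def add.assoc)
    moreover have "take m v = map x [0..<m]" by (simp add: v_def l_def take_map min_def)
    moreover have "cyl v \<subseteq> cyl t"
      using cyl_prefix[OF xs(1), of "length t" l] xs(3) by (simp add: v_def l_def)
    moreover have "x \<in> cyl v" using xs(1) by (simp add: cyl_def v_def)
    moreover have "n < length v" by (simp add: v_def l_def)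
    ultimately have "ok n u v" using m t(3) unfolding ok_def by (metis disjoint_iff subset_iff)
    then show ?thesis using \<open>x \<in> cyl v\<close> by blast
  qed
  have "\<exists>u. \<forall>n. (cyl (u n) \<noteq> {} \<and> (n = 0 \<longrightarrow> u n = s)) \<and> ok n (u n) (u (Suc n))"
    by (rule dependent_nat_choice) (use step assms(1) in auto)
  then obtain u where u0: "u 0 = s" and u: "\<And>n. cyl (u n) \<noteq> {}" "\<And>n. ok n (u n) (u (Suc n))"
    by auto
  have ext: "\<exists>w. u (n + k) = u n @ w" for n k
  proof (induction k)
    case (Suc k)
    then show ?case using u(2)[of "n + k"] by (auto simp: ok_def)
  qed simp
  have len: "n < length (u (Suc n))" for n using u(2)[of n] by (simp add: ok_def)
  define x where "x n = u (Suc n) ! n" for n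
  have x_eq: "map x [0..<length (u n)] = u n" for n
  proof (rule nth_equalityI)
    fix i assume "i < length (map x [0..<length (u n)])"
    then have i: "i < length (u n)" by simp
    obtain w w' where w: "u (Suc i + n) = u (Suc i) @ w" "u (n + Suc i) = u n @ w'" using ext by metis
    have "u (Suc i) ! i = (u (Suc i) @ w) ! i" using len[of i] by (simp add: nth_append)
    also have "\<dots> = (u n @ w') ! i" using w by (simp add: add.commute)
    also have "\<dots> = u n ! i" using i by (simp add: nth_append)
    finally have "u (Suc i) ! i = u n ! i" .
    then show "map x [0..<length (u n)] ! i = u n ! i" using i by (simp add: x_def)
  qed simp
  have x_take: "map x [0..<m] = take m (u n)" if "m \<le> length (u n)" for m n
    using that by (subst x_eq[symmetric]) (simp add: take_map)
  have "x \<in> \<Omega>"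
  proof (rule limit)
    fix n
    have m: "n \<le> length (u (Suc n))" using len[of n] by simp
    obtain y where y: "y \<in> cyl (u (Suc n))" using u(1) by blast
    have "map y [0..<n] = take n (map y [0..<length (u (Suc n))])" using m by (simp add: take_map)
    also have "\<dots> = map x [0..<n]" using y x_take[OF m] by (simp add: cyl_def)
    finally show "cyl (map x [0..<n]) \<noteq> {}" using y by (auto simp: cyl_def)
  next
    fix n
    obtain m where m: "Q n (take m (u (Suc n)))" using u(2)[of n] by (auto simp: ok_def)
    show "\<exists>m. Q n (map x [0..<m])"
    proof (cases "m \<le> length (u (Suc n))")
      case True then show ?thesis using m x_take[OF True] by metis
    next
      case False
      then have "take m (u (Suc n)) = u (Suc n)" by simp
      then show ?thesis using m x_eq[of "Suc n"] by metis
    qed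
  qed
  then have x_cyl: "x \<in> cyl (u n)" for n using x_eq by (simp add: cyl_def)
  then have "x \<in> cyl s" using u0 by metis
  moreover have "x \<notin> N n" for n using x_cyl[of "Suc n"] u(2)[of n] by (auto simp: ok_def)
  ultimately show False using N(2) by blast
qed

end

section \<open>The zero-one law and eventual equality\<close>

interpretation cantor: seq_space "UNIV :: (nat \<Rightarrow> bool) set" .

lemma cantor_cyl_iff: "x \<in> cantor.cyl s \<longleftrightarrow> (\<forall>n<length s. x n = s ! n)"
  unfolding cantor.cyl_def list_eq_iff_nth_eq by simp

lemma cantor_cyl_nonempty: "cantor.cyl s \<noteq> {}"
proof -
  have "(\<lambda>n. n < length s \<and> s ! n) \<in> cantor.cyl s" by (simp add: cantor_cyl_iff)
  then show ?thesis by blast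
qed

lemma cantor_nonmeager: "\<not> cantor.meager (cantor.cyl s)"
  by (rule cantor.baire_category[of s "\<lambda>_ _. True"]) (auto simp: cantor_cyl_nonempty)

lemma cantor_UNIV_nonmeager: "\<not> cantor.meager UNIV"
  using cantor_nonmeager[of "[]"] cantor.meager_subset[of UNIV "cantor.cyl []"] by auto

lemma cantor_meager_flip:
  fixes d :: "nat \<Rightarrow> bool"
  assumes "cantor.meager A"
  shows "cantor.meager ((\<lambda>x n. x n \<noteq> d n) -` A)"
proof (rule cantor.meager_vimage[OF assms])
  fix s
  define t where "t = map (\<lambda>n. s ! n \<noteq> d n) [0..<length s]"
  have "(\<lambda>x n. x n \<noteq> d n) -` cantor.cyl t \<subseteq> cantor.cyl s"
    by (auto simp: cantor_cyl_iff t_def)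
  then show "\<exists>t. cantor.cyl t \<noteq> {} \<and> (\<lambda>x n. x n \<noteq> d n) -` cantor.cyl t \<subseteq> cantor.cyl s"
    using cantor_cyl_nonempty by blast
  have "cantor.cyl t \<subseteq> (\<lambda>x n. x n \<noteq> d n) -` cantor.cyl s"
    by (auto simp: cantor_cyl_iff t_def)
  then show "\<exists>t. cantor.cyl t \<noteq> {} \<and> cantor.cyl t \<subseteq> (\<lambda>x n. x n \<noteq> d n) -` cantor.cyl s"
    using cantor_cyl_nonempty by blast
qed

text \<open>If the complement is nonmeager, \<open>A\<close> is meager in some cylinder
  \<open>cyl s\<close>. Changing the first \<open>length s\<close> digits carries any point into
  this cylinder and preserves \<open>A\<close>, so countably many preimages of
  \<open>cyl s \<inter> A\<close> cover \<open>A\<close>.\<close>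

lemma cantor_zero_one:
  assumes "cantor.baire_property A"
    and inv: "\<And>x y. finite {n. x n \<noteq> y n} \<Longrightarrow> x \<in> A \<Longrightarrow> y \<in> A"
  shows "cantor.meager A \<or> cantor.meager (- A)"
proof (rule disjCI)
  assume "\<not> cantor.meager (- A)"
  moreover have "cantor.baire_property (- A)" by (rule cantor.baire_property_Compl[OF assms(1)])
  ultimately obtain s where "cantor.meager (cantor.cyl s - - A)"
    using cantor.nonmeager_localize by blast
  then have s: "cantor.meager (cantor.cyl s \<inter> A)" by (simp add: Diff_Compl)
  define f where "f t x n \<longleftrightarrow> x n \<noteq> (n < length s \<and> s ! n \<noteq> t ! n)"
    for t :: "bool list" and x :: "nat \<Rightarrow> bool" and n
  have "cantor.meager (f t -` (cantor.cyl s \<inter> A))" for t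
    unfolding f_def[abs_def] by (rule cantor_meager_flip[OF s])
  then have "cantor.meager (\<Union>t. f t -` (cantor.cyl s \<inter> A))" by (intro cantor.meager_UN) auto
  moreover have "A \<subseteq> (\<Union>t. f t -` (cantor.cyl s \<inter> A))"
  proof
    fix x assume x: "x \<in> A"
    define t where "t = map x [0..<length s]"
    have "{n. x n \<noteq> f t x n} \<subseteq> {..<length s}" by (auto simp: f_def)
    then have "f t x \<in> A" using inv x finite_subset finite_lessThan by blast
    moreover have "f t x \<in> cantor.cyl s" by (auto simp: cantor_cyl_iff f_def t_def)
    ultimately show "x \<in> (\<Union>t. f t -` (cantor.cyl s \<inter> A))" by blast
  qed
  ultimately show "cantor.meager A" using cantor.meager_subset by blast
qed

text \<open>A point of Cantor space stands for the pair of its even and its odd part; exchanging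
  \<open>2 * k\<close> with \<open>2 * k + 1\<close> exchanges the two components.\<close>

definition swap_pairs :: "nat \<Rightarrow> nat" where
  "swap_pairs n = (if even n then Suc n else n - 1)"

lemma swap_pairs_invol [simp]: "swap_pairs (swap_pairs n) = n"
  by (auto simp: swap_pairs_def)

lemma swap_pairs_less: "n < 2 * k \<Longrightarrow> swap_pairs n < 2 * k"
  unfolding swap_pairs_def by (cases "even n") (auto elim!: evenE oddE)

lemma cantor_meager_swap:
  assumes "cantor.meager A"
  shows "cantor.meager ((\<lambda>x. x \<circ> swap_pairs) -` A)"
proof (rule cantor.meager_vimage[OF assms])
  fix s assume "cantor.cyl s \<noteq> {}"
  then obtain y where y: "y \<in> cantor.cyl s" by blast
  \<comment> \<open>An initial block of even length is closed under \<open>swap_pairs\<close>; twice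
    the length of \<open>s\<close> gives one that covers \<open>s\<close>.\<close>
  define t where "t = map (y \<circ> swap_pairs) [0..<2 * length s]"
  have *: "x (swap_pairs n) = y n" if "\<forall>n<2 * length s. x n = y (swap_pairs n)" "n < length s" for x n
    using that(1)[rule_format, OF swap_pairs_less[of n "length s"]] that(2) by simp
  have "cantor.cyl t \<subseteq> (\<lambda>x. x \<circ> swap_pairs) -` cantor.cyl s"
  proof
    fix x assume "x \<in> cantor.cyl t"
    then have "\<forall>n<2 * length s. x n = y (swap_pairs n)"
      by (simp add: cantor_cyl_iff t_def)
    from *[OF this] y show "x \<in> (\<lambda>x. x \<circ> swap_pairs) -` cantor.cyl s"
      by (simp add: cantor_cyl_iff)
  qed
  then show "\<exists>t. cantor.cyl t \<noteq> {} \<and> cantor.cyl t \<subseteq> (\<lambda>x. x \<circ> swap_pairs) -` cantor.cyl s"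
    using cantor_cyl_nonempty by blast
  have **: "x n = y n" if "\<forall>n<2 * length s. x (swap_pairs n) = y (swap_pairs n)" "n < length s" for x n
    using that(1)[rule_format, OF swap_pairs_less[of n "length s"]] that(2) by simp
  have "(\<lambda>x. x \<circ> swap_pairs) -` cantor.cyl t \<subseteq> cantor.cyl s"
  proof
    fix x assume "x \<in> (\<lambda>x. x \<circ> swap_pairs) -` cantor.cyl t"
    then have "\<forall>n<2 * length s. x (swap_pairs n) = y (swap_pairs n)"
      by (simp add: cantor_cyl_iff t_def)
    from **[OF this] y show "x \<in> cantor.cyl s" by (simp add: cantor_cyl_iff)
  qed
  then show "\<exists>t. cantor.cyl t \<noteq> {} \<and> (\<lambda>x. x \<circ> swap_pairs) -` cantor.cyl t \<subseteq> cantor.cyl s"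
    using cantor_cyl_nonempty by blast
qed

definition E0 :: "(nat \<Rightarrow> bool) \<Rightarrow> (nat \<Rightarrow> bool) \<Rightarrow> bool" where
  "E0 x y \<longleftrightarrow> finite {n. x n \<noteq> y n}"

definition evens :: "(nat \<Rightarrow> 'a) \<Rightarrow> nat \<Rightarrow> 'a" where "evens z k = z (2 * k)"
definition odds :: "(nat \<Rightarrow> 'a) \<Rightarrow> nat \<Rightarrow> 'a" where "odds z k = z (2 * k + 1)"

lemma evens_swap: "evens (z \<circ> swap_pairs) = odds z"
  and odds_swap: "odds (z \<circ> swap_pairs) = evens z"
  by (auto simp: evens_def odds_def swap_pairs_def)

lemma E0_meager: "cantor.meager {z. E0 (evens z) (odds z)}"
proof -
  define N where "N m = {z :: nat \<Rightarrow> bool. \<forall>k\<ge>m. z (2 * k) = z (2 * k + 1)}" for m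
  have "cantor.nowhere_dense (N m)" for m
    unfolding cantor.nowhere_dense_def
  proof (intro allI impI)
    fix s :: "bool list"
    \<comment> \<open>\<open>l\<close> is even and lies beyond \<open>s\<close>. The digits at
      \<open>l\<close> and \<open>l + 1\<close> are made different, so the two parts differ at
      \<open>m + length s\<close>, past the bound \<open>m\<close>.\<close>
    define l where "l = 2 * (m + length s)"
    define t where "t = map (\<lambda>n. if n < length s then s ! n else n = l) [0..<l + 2]"
    have "cantor.cyl t \<subseteq> cantor.cyl s" by (auto simp: cantor_cyl_iff t_def l_def simp del: upt_Suc)
    moreover have "z \<notin> N m" if "z \<in> cantor.cyl t" for z
    proof -
      have "z l" "\<not> z (l + 1)"
        using that[unfolded cantor_cyl_iff, rule_format, of l]
          that[unfolded cantor_cyl_iff, rule_format, of "l + 1"]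
        by (auto simp: t_def l_def simp del: upt_Suc)
      then show ?thesis by (auto simp: N_def l_def intro!: exI[of _ "m + length s"])
    qed
    ultimately show "\<exists>t. cantor.cyl t \<noteq> {} \<and> cantor.cyl t \<subseteq> cantor.cyl s \<and> cantor.cyl t \<inter> N m = {}"
      using cantor_cyl_nonempty by blast
  qed
  then have "cantor.meager (\<Union>m. N m)"
    by (intro cantor.meager_UN cantor.nowhere_dense_imp_meager) auto
  moreover have "{z. E0 (evens z) (odds z)} \<subseteq> (\<Union>m. N m)"
  proof
    fix z :: "nat \<Rightarrow> bool" assume "z \<in> {z. E0 (evens z) (odds z)}"
    then obtain m where m: "\<forall>k\<in>{n. evens z n \<noteq> odds z n}. k < m"
      by (auto simp: E0_def finite_nat_set_iff_bounded)
    have "evens z k = odds z k" if "m \<le> k" for k using that m by force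
    then have "z \<in> N m" by (simp add: N_def evens_def odds_def)
    then show "z \<in> (\<Union>m. N m)" by blast
  qed
  ultimately show ?thesis using cantor.meager_subset by blast
qed

lemma E0_not_linearly_orderable:
  assumes inv: "\<And>x y. s x = s y \<longleftrightarrow> E0 x y"
    and asym: "\<And>x y. lt (s x) (s y) \<Longrightarrow> \<not> lt (s y) (s x)"
    and total: "\<And>x y. s x \<noteq> s y \<Longrightarrow> lt (s x) (s y) \<or> lt (s y) (s x)"
    and BP: "cantor.baire_property {z. lt (s (evens z)) (s (odds z))}"
  shows False
proof -
  define L where "L = {z. lt (s (evens z)) (s (odds z))}"
  define L' where "L' = {z. lt (s (odds z)) (s (evens z))}"
  have L': "L' = (\<lambda>x. x \<circ> swap_pairs) -` L"
    by (simp add: L_def L'_def evens_swap odds_swap set_eq_iff)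
  have "y \<in> L" if fin: "finite {n. x n \<noteq> y n}" and x: "x \<in> L" for x y
  proof -
    have "finite ((\<lambda>k. 2 * k) -` {n. x n \<noteq> y n})" "finite ((\<lambda>k. 2 * k + 1) -` {n. x n \<noteq> y n})"
      by (intro finite_vimageI fin injI; simp)+
    then have "E0 (evens x) (evens y)" "E0 (odds x) (odds y)"
      by (simp_all add: E0_def evens_def odds_def)
    then have "s (evens x) = s (evens y)" "s (odds x) = s (odds y)" by (simp_all only: inv)
    then show ?thesis using x by (simp add: L_def)
  qed
  then have "cantor.meager L \<or> cantor.meager (- L)"
    using cantor_zero_one[of L] BP by (auto simp: L_def)
  then show False
  proof
    assume L: "cantor.meager L"
    have "UNIV \<subseteq> (L \<union> L') \<union> {z. E0 (evens z) (odds z)}"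
      using total inv by (auto simp: L_def L'_def)
    moreover have "cantor.meager ((L \<union> L') \<union> {z. E0 (evens z) (odds z)})"
      unfolding L' by (intro cantor.meager_Un L cantor_meager_swap E0_meager)
    ultimately show False using cantor_UNIV_nonmeager cantor.meager_subset[of _ UNIV] by blast
  next
    assume L: "cantor.meager (- L)"
    have "UNIV \<subseteq> - L \<union> - L'" using asym by (auto simp: L_def L'_def)
    moreover have "cantor.meager (- L \<union> (\<lambda>x. x \<circ> swap_pairs) -` (- L))"
      by (intro cantor.meager_Un L cantor_meager_swap)
    ultimately show False
      using cantor_UNIV_nonmeager cantor.meager_subset[of _ UNIV] by (simp only: L' vimage_Compl) blast
  qed
qed

section \<open>The lexicographic order in the codes\<close>

lemma Well_order_omega1: "Well_order omega1"
  using cardSuc_Card_order[OF natLeq_Card_order] by (simp add: omega1_def card_order_on_def)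

lemma omega1_total:
  "a \<in> Field omega1 \<Longrightarrow> b \<in> Field omega1 \<Longrightarrow> a = b \<or> a \<in> underS omega1 b \<or> b \<in> underS omega1 a"
  using Well_order_omega1
  by (auto simp: order_on_defs total_on_def underS_def)

lemma omega1_trans: "(a, b) \<in> omega1 \<Longrightarrow> (b, c) \<in> omega1 \<Longrightarrow> (a, c) \<in> omega1"
  using Well_order_omega1 by (auto simp: order_on_defs dest: transD)

lemma omega1_antisym: "(a, b) \<in> omega1 \<Longrightarrow> (b, a) \<in> omega1 \<Longrightarrow> a = b"
  using Well_order_omega1 by (auto simp: order_on_defs dest: antisymD)

lemma omega1_refl: "a \<in> Field omega1 \<Longrightarrow> (a, a) \<in> omega1"
  using Well_order_omega1 by (auto simp: order_on_defs dest: refl_onD)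

lemma omega1_wf: "wf (omega1 - Id)"
  using Well_order_omega1 by (auto simp: well_order_on_def)

text \<open>The end of a sequence counts as the least digit, so a proper initial segment precedes
  its extensions.\<close>

fun digit_rank :: "bool option \<Rightarrow> nat" where
  "digit_rank None = 0"
| "digit_rank (Some False) = 1"
| "digit_rank (Some True) = 2"

lemma digit_rank_inj: "digit_rank a = digit_rank b \<Longrightarrow> a = b"
  by (cases a rule: digit_rank.cases; cases b rule: digit_rank.cases) auto

definition lex_less :: "(nat set \<rightharpoonup> bool) \<Rightarrow> (nat set \<rightharpoonup> bool) \<Rightarrow> bool" where
  "lex_less s s' \<longleftrightarrow> (\<exists>\<beta>\<in>Field omega1. (\<forall>\<gamma>\<in>underS omega1 \<beta>. s \<gamma> = s' \<gamma>) \<and>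
     digit_rank (s \<beta>) < digit_rank (s' \<beta>))"

lemma countable_bin_seqs_dom:
  assumes "s \<in> countable_bin_seqs"
  shows "dom s \<subseteq> Field omega1" "a \<in> dom s \<Longrightarrow> (b, a) \<in> omega1 \<Longrightarrow> b \<in> dom s"
proof -
  obtain \<alpha> where \<alpha>: "dom s = underS omega1 \<alpha>" using assms by (auto simp: countable_bin_seqs_def)
  then show "dom s \<subseteq> Field omega1" by (auto simp: underS_def Field_def)
  assume "a \<in> dom s" "(b, a) \<in> omega1"
  then have "a \<noteq> \<alpha>" "(a, \<alpha>) \<in> omega1" by (simp_all add: \<alpha> underS_def)
  then have "(b, \<alpha>) \<in> omega1" "b \<noteq> \<alpha>"
    using omega1_trans[OF \<open>(b, a) \<in> omega1\<close>] omega1_antisym \<open>(b, a) \<in> omega1\<close> by metis+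
  then show "b \<in> dom s" by (simp add: \<alpha> underS_def)
qed

lemma lex_less_total:
  assumes "s \<in> countable_bin_seqs" "s' \<in> countable_bin_seqs" "s \<noteq> s'"
  shows "lex_less s s' \<or> lex_less s' s"
proof -
  obtain x where x: "x \<in> {x. s x \<noteq> s' x}" using assms(3) by fastforce
  obtain \<beta> where "\<beta> \<in> {x. s x \<noteq> s' x}" "\<And>y. (y, \<beta>) \<in> omega1 - Id \<Longrightarrow> y \<notin> {x. s x \<noteq> s' x}"
    by (rule wfE_min[OF omega1_wf x]) blast
  then have \<beta>: "s \<beta> \<noteq> s' \<beta>" "\<And>y. (y, \<beta>) \<in> omega1 - Id \<Longrightarrow> s y = s' y" by auto
  then have "\<beta> \<in> dom s \<union> dom s'" by (metis UnCI domIff)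
  then have "\<beta> \<in> Field omega1" using countable_bin_seqs_dom(1) assms by blast
  moreover have "\<forall>\<gamma>\<in>underS omega1 \<beta>. s \<gamma> = s' \<gamma>" using \<beta>(2) by (auto simp: underS_def)
  moreover have "digit_rank (s \<beta>) \<noteq> digit_rank (s' \<beta>)" using \<beta>(1) digit_rank_inj by blast
  ultimately show ?thesis unfolding lex_less_def by (metis nat_neq_iff)
qed

lemma lex_less_asym: "lex_less s s' \<Longrightarrow> \<not> lex_less s' s"
  unfolding lex_less_def using omega1_total by (metis less_irrefl order_less_imp_not_less)

text \<open>The inverse \<open>G\<close> is carried along so that surjectivity becomes a condition
  on values, without an inner existential quantifier: only the outer one over functions
  remains.\<close>

definition partial_iso :: "real_code \<Rightarrow> real_code \<Rightarrow> nat set \<Rightarrow> nat set \<Rightarrow> bool" where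
  "partial_iso c c' S S' \<longleftrightarrow> (\<exists>F G. (\<forall>i\<in>S. F i \<in> S' \<and> G (F i) = i) \<and> (\<forall>j\<in>S'. G j \<in> S \<and> F (G j) = j) \<and>
     (\<forall>i\<in>S. \<forall>j\<in>S. fst c (i, j) = fst c' (F i, F j)) \<and> (\<forall>i\<in>S. snd c i = snd c' (F i)))"

text \<open>For a code this is the field of its well-order, which is reflexive; this form needs no
  quantifier.\<close>

definition code_field :: "real_code \<Rightarrow> nat set" where
  "code_field c = {i. fst c (i, i)}"

definition code_below :: "real_code \<Rightarrow> nat \<Rightarrow> nat set" where
  "code_below c n = {i. i \<noteq> n \<and> fst c (i, n)}"

text \<open>The two ways in which one sequence can precede another: it ends where the other still
  has the digit at \<open>m\<close>, or both agree below a common position that carries the digits 0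
  and 1. Positions are matched by an isomorphism of the segments, since a code does not name the
  ordinals.\<close>

definition code_less :: "real_code \<Rightarrow> real_code \<Rightarrow> bool" where
  "code_less c c' \<longleftrightarrow> (\<exists>m\<in>code_field c'. partial_iso c c' (code_field c) (code_below c' m) \<or>
     (\<exists>n\<in>code_field c. \<not> snd c n \<and> snd c' m \<and> partial_iso c c' (code_below c n) (code_below c' m)))"

definition code_map :: "real_code \<Rightarrow> (nat set \<rightharpoonup> bool) \<Rightarrow> (nat \<Rightarrow> nat set) \<Rightarrow> bool" where
  "code_map c s f \<longleftrightarrow> bij_betw f (code_field c) (dom s) \<and>
     (\<forall>i j. fst c (i, j) \<longrightarrow> i \<in> code_field c \<and> j \<in> code_field c) \<and>
     (\<forall>i\<in>code_field c. \<forall>j\<in>code_field c. fst c (i, j) \<longleftrightarrow> (f i, f j) \<in> omega1) \<and>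
     (\<forall>i\<in>code_field c. s (f i) = Some (snd c i))"

lemma codes_imp_code_map:
  assumes "s \<in> countable_bin_seqs" "codes c s"
  shows "\<exists>f. code_map c s f"
proof -
  define R where "R = Collect (fst c)"
  obtain f where R: "Well_order R" and f: "iso R (Restr omega1 (dom s)) f"
    and A: "Collect (snd c) = {n \<in> Field R. s (f n) = Some True}"
    using assms(2) by (auto simp: codes_def Let_def R_def)
  have field: "Field R = code_field c"
    using R by (auto simp: order_on_defs code_field_def R_def Field_def dest: refl_onD)
  have "Field (Restr omega1 (dom s)) = dom s"
  proof
    show "dom s \<subseteq> Field (Restr omega1 (dom s))"
      using countable_bin_seqs_dom(1)[OF assms(1)] omega1_refl by (intro subsetI FieldI1) blast
  qed (auto simp: Field_def)
  then have bij: "bij_betw f (code_field c) (dom s)"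
    and ord: "\<And>i j. i \<in> code_field c \<Longrightarrow> j \<in> code_field c \<Longrightarrow>
      (i, j) \<in> R \<longleftrightarrow> (f i, f j) \<in> Restr omega1 (dom s)"
    using f field by (auto simp: iso_iff2)
  have "code_map c s f"
    unfolding code_map_def
  proof (intro conjI bij allI impI ballI)
    fix i j assume "fst c (i, j)"
    then have "(i, j) \<in> R" by (simp add: R_def)
    then show "i \<in> code_field c" "j \<in> code_field c" using field by (auto intro: FieldI1 FieldI2)
  next
    fix i j assume ij: "i \<in> code_field c" "j \<in> code_field c"
    then have "f i \<in> dom s" "f j \<in> dom s" using bij by (auto simp: bij_betw_def)
    then show "fst c (i, j) \<longleftrightarrow> (f i, f j) \<in> omega1" using ord[OF ij] by (simp add: R_def)
  next
    fix i assume i: "i \<in> code_field c"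
    then have "f i \<in> dom s" using bij by (auto simp: bij_betw_def)
    then obtain b where b: "s (f i) = Some b" by blast
    have "snd c i \<longleftrightarrow> i \<in> {n \<in> Field R. s (f n) = Some True}" using A by blast
    then show "s (f i) = Some (snd c i)" using i field b by simp
  qed
  then show ?thesis by blast
qed

lemma code_mapD:
  assumes "code_map c s f"
  shows code_map_field: "fst c (i, j) \<Longrightarrow> i \<in> code_field c" "fst c (i, j) \<Longrightarrow> j \<in> code_field c"
    and code_map_ord: "i \<in> code_field c \<Longrightarrow> j \<in> code_field c \<Longrightarrow> fst c (i, j) \<longleftrightarrow> (f i, f j) \<in> omega1"
    and code_map_val: "i \<in> code_field c \<Longrightarrow> s (f i) = Some (snd c i)"
    and code_map_inj: "i \<in> code_field c \<Longrightarrow> j \<in> code_field c \<Longrightarrow> f i = f j \<Longrightarrow> i = j"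
    and code_map_mem: "i \<in> code_field c \<Longrightarrow> f i \<in> dom s"
    and code_map_surj: "a \<in> dom s \<Longrightarrow> \<exists>i\<in>code_field c. f i = a"
    and code_map_image: "f ` code_field c = dom s"
proof -
  have bij: "inj_on f (code_field c)" "f ` code_field c = dom s"
    and fld: "\<forall>i j. fst c (i, j) \<longrightarrow> i \<in> code_field c \<and> j \<in> code_field c"
    and ord: "\<forall>i\<in>code_field c. \<forall>j\<in>code_field c. fst c (i, j) \<longleftrightarrow> (f i, f j) \<in> omega1"
    and val: "\<forall>i\<in>code_field c. s (f i) = Some (snd c i)"
    using assms unfolding code_map_def bij_betw_def by blast+
  show "fst c (i, j) \<Longrightarrow> i \<in> code_field c" "fst c (i, j) \<Longrightarrow> j \<in> code_field c" using fld by blast+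
  show "i \<in> code_field c \<Longrightarrow> j \<in> code_field c \<Longrightarrow> fst c (i, j) \<longleftrightarrow> (f i, f j) \<in> omega1"
    by (rule ord[rule_format])
  show "i \<in> code_field c \<Longrightarrow> s (f i) = Some (snd c i)" using val by (rule bspec)
  show "i \<in> code_field c \<Longrightarrow> j \<in> code_field c \<Longrightarrow> f i = f j \<Longrightarrow> i = j"
    using bij(1) by (rule inj_onD)
  show "i \<in> code_field c \<Longrightarrow> f i \<in> dom s" using bij(2) imageI by metis
  show "a \<in> dom s \<Longrightarrow> \<exists>i\<in>code_field c. f i = a" using bij(2) by (metis imageE)
  show "f ` code_field c = dom s" by (rule bij(2))
qed

text \<open>Initial segments of well-orders are rigid: carried to the ordinals by \<open>f\<close>
  and \<open>f'\<close>, a partial isomorphism is the identity, by induction along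
  \<open>omega1\<close>. So it exists exactly if both segments stand for the same set of ordinals
  with the same digits.\<close>

lemma partial_iso_iff:
  assumes s: "s \<in> countable_bin_seqs" "s' \<in> countable_bin_seqs"
    and f: "code_map c s f" "code_map c' s' f'"
    and S: "S \<subseteq> code_field c" "\<And>i j. j \<in> S \<Longrightarrow> fst c (i, j) \<Longrightarrow> i \<in> S"
    and S': "S' \<subseteq> code_field c'" "\<And>i j. j \<in> S' \<Longrightarrow> fst c' (i, j) \<Longrightarrow> i \<in> S'"
  shows "partial_iso c c' S S' \<longleftrightarrow> f ` S = f' ` S' \<and> (\<forall>\<gamma>\<in>f ` S. s \<gamma> = s' \<gamma>)"
proof
  note ord = code_map_ord[OF f(1)] code_map_ord[OF f(2)]
  note val = code_map_val[OF f(1)] code_map_val[OF f(2)]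
  note inj = code_map_inj[OF f(1)] code_map_inj[OF f(2)]
  note mem = code_map_mem[OF f(1)] code_map_mem[OF f(2)]
  note surj = code_map_surj[OF f(1)] code_map_surj[OF f(2)]
  {
    assume "partial_iso c c' S S'"
    then obtain F G where F: "\<And>i. i \<in> S \<Longrightarrow> F i \<in> S'" "\<And>i. i \<in> S \<Longrightarrow> G (F i) = i"
      and G: "\<And>j. j \<in> S' \<Longrightarrow> G j \<in> S" "\<And>j. j \<in> S' \<Longrightarrow> F (G j) = j"
      and FR: "\<And>i j. i \<in> S \<Longrightarrow> j \<in> S \<Longrightarrow> fst c (i, j) = fst c' (F i, F j)"
      and FA: "\<And>i. i \<in> S \<Longrightarrow> snd c i = snd c' (F i)"
      unfolding partial_iso_def by blast
    have eq: "\<forall>i\<in>S. f i = a \<longrightarrow> f' (F i) = a" for a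
    proof (induction a rule: wf_induct_rule[OF omega1_wf])
      case (1 a)
      show ?case
      proof (intro ballI impI)
        fix i assume i: "i \<in> S" "f i = a"
        have iF: "i \<in> code_field c" "F i \<in> code_field c'" using i F(1) S(1) S'(1) by blast+
        have flds: "a \<in> Field omega1" "f' (F i) \<in> Field omega1"
          using mem iF i(2) countable_bin_seqs_dom(1)[OF s(1)] countable_bin_seqs_dom(1)[OF s(2)] by blast+
        have IH: "f' (F k) = f k" if "k \<in> S" "f k \<in> underS omega1 a" for k
          using 1[of "f k"] that by (auto simp: underS_def)
        show "f' (F i) = a"
        proof (rule ccontr)
          assume "f' (F i) \<noteq> a"
          then consider "f' (F i) \<in> underS omega1 a" | "a \<in> underS omega1 (f' (F i))"
            using omega1_total[OF flds] by blast
          then show False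
          proof cases
            \<comment> \<open>The image is too low: its ordinal belongs to some earlier
              \<open>k\<close>, which by induction has the same image as \<open>i\<close>.\<close>
            assume less: "f' (F i) \<in> underS omega1 a"
            then have "f' (F i) \<in> dom s"
              using countable_bin_seqs_dom(2)[OF s(1) mem(1)[OF iF(1)]] i(2) by (auto simp: underS_def)
            then obtain k where k: "k \<in> code_field c" "f k = f' (F i)" using surj by blast
            have "k \<in> S" using S(2)[OF i(1), of k] ord(1)[OF k(1) iF(1)] less k(2) i(2)
              by (auto simp: underS_def)
            then have "f' (F k) = f' (F i)" using IH less k(2) by simp
            then have "F k = F i" using inj(2) F(1) S'(1) \<open>k \<in> S\<close> i(1) by blast
            then have "k = i" using F(2) \<open>k \<in> S\<close> i(1) by metis
            then show False using less k(2) i(2) by (auto simp: underS_def)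
          next
            \<comment> \<open>The image is too high: position \<open>a\<close> on the other side is
              then the image of some \<open>k\<close> before \<open>i\<close>, but by induction that
              image stands for the smaller ordinal \<open>f k\<close>.\<close>
            assume less: "a \<in> underS omega1 (f' (F i))"
            then have "a \<in> dom s'"
              using countable_bin_seqs_dom(2)[OF s(2) mem(2)[OF iF(2)]] by (auto simp: underS_def)
            then obtain m where m: "m \<in> code_field c'" "f' m = a" using surj by blast
            have m': "fst c' (m, F i)" using ord(2)[OF m(1) iF(2)] less m(2) by (auto simp: underS_def)
            have "m \<in> S'" using S'(2)[OF F(1)[OF i(1)] m'] .
            then obtain k where k: "k \<in> S" "F k = m" using G by blast
            have "fst c (k, i)" using FR[OF k(1) i(1)] m' k(2) by simp
            then have "(f k, a) \<in> omega1" using ord(1) k(1) S(1) iF(1) i(2) by blast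
            moreover have "f k \<noteq> a"
            proof
              assume "f k = a"
              then have "k = i" using inj(1) k(1) S(1) iF(1) i(2) by blast
              then show False using less m(2) k(2) by (auto simp: underS_def)
            qed
            ultimately have "f' (F k) = f k" using IH[OF k(1)] by (auto simp: underS_def)
            then show False using \<open>f k \<noteq> a\<close> k(2) m(2) by simp
          qed
        qed
      qed
    qed
    have "f ` S = f' ` S'"
    proof
      show "f ` S \<subseteq> f' ` S'" using eq F(1) by (metis image_subsetI imageI)
      show "f' ` S' \<subseteq> f ` S" using eq G by (metis image_subsetI imageI)
    qed
    moreover have "s (f i) = s' (f i)" if "i \<in> S" for i
    proof -
      have "s (f i) = Some (snd c i)" "s' (f' (F i)) = Some (snd c' (F i))"
        using val F(1)[OF that] S(1) S'(1) that by blast+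
      moreover have "f' (F i) = f i" using eq that by blast
      ultimately show ?thesis using FA[OF that] by simp
    qed
    ultimately show "f ` S = f' ` S' \<and> (\<forall>\<gamma>\<in>f ` S. s \<gamma> = s' \<gamma>)" by blast
  next
    assume eq: "f ` S = f' ` S' \<and> (\<forall>\<gamma>\<in>f ` S. s \<gamma> = s' \<gamma>)"
    define F where "F i = (SOME j. j \<in> S' \<and> f' j = f i)" for i
    define G where "G j = (SOME i. i \<in> S \<and> f i = f' j)" for j
    have F: "F i \<in> S' \<and> f' (F i) = f i" if "i \<in> S" for i
      unfolding F_def by (rule someI_ex) (use eq that in \<open>metis imageE imageI\<close>)
    have G: "G j \<in> S \<and> f (G j) = f' j" if "j \<in> S'" for j
      unfolding G_def by (rule someI_ex) (use eq that in \<open>metis imageE imageI\<close>)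
    show "partial_iso c c' S S'"
      unfolding partial_iso_def
    proof (rule exI[of _ F], rule exI[of _ G], intro conjI ballI)
      fix i assume i: "i \<in> S"
      show "F i \<in> S'" using F i by blast
      show "G (F i) = i" using G[of "F i"] F[OF i] inj(1) S(1) i by blast
      have "Some (snd c i) = Some (snd c' (F i))"
        using val(1)[of i] val(2)[of "F i"] F[OF i] S(1) S'(1) i eq by (metis imageI subsetD)
      then show "snd c i = snd c' (F i)" by simp
      fix j assume j: "j \<in> S"
      show "fst c (i, j) = fst c' (F i, F j)"
        using ord(1)[of i j] ord(2)[of "F i" "F j"] F[OF i] F[OF j] S(1) S'(1) i j
        by (metis subsetD)
    next
      fix j assume j: "j \<in> S'"
      show "G j \<in> S" using G j by blast
      show "F (G j) = j" using F[of "G j"] G[OF j] inj(2) S'(1) j by blast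
    qed
  }
qed

text \<open>The numbers below \<open>n\<close> in a code stand for the ordinals below
  \<open>f n\<close>. So \<open>partial_iso_iff\<close> turns the matching of segments in
  \<open>code_less\<close> into agreement of the two sequences below a common ordinal.\<close>

lemma code_less_iff_lex_less:
  assumes s: "s \<in> countable_bin_seqs" "s' \<in> countable_bin_seqs"
    and codes: "codes c s" "codes c' s'"
  shows "code_less c c' \<longleftrightarrow> lex_less s s'"
proof -
  obtain f f' where f: "code_map c s f" "code_map c' s' f'"
    using codes_imp_code_map s codes by metis
  have below: "f ` code_below c n = underS omega1 (f n)" "code_below c n \<subseteq> code_field c"
    "\<And>i j. j \<in> code_below c n \<Longrightarrow> fst c (i, j) \<Longrightarrow> i \<in> code_below c n"
    if f: "code_map c s f" and s: "s \<in> countable_bin_seqs" and n: "n \<in> code_field c" for c s f n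
  proof -
    note fld = code_map_field[OF f] and ord = code_map_ord[OF f] and inj = code_map_inj[OF f]
    show sub: "code_below c n \<subseteq> code_field c" using fld by (auto simp: code_below_def)
    show "i \<in> code_below c n" if j: "j \<in> code_below c n" and i: "fst c (i, j)" for i j
    proof -
      have ij: "i \<in> code_field c" "j \<in> code_field c" using fld[OF i] by blast+
      have jn: "j \<noteq> n" "fst c (j, n)" using j by (simp_all add: code_below_def)
      have ijn: "(f i, f j) \<in> omega1" "(f j, f n) \<in> omega1"
        using ord[OF ij] i ord[OF ij(2) n] jn by simp_all
      have "f j \<noteq> f n" using inj[OF ij(2) n] jn(1) by blast
      then have "(f i, f n) \<in> omega1" "f i \<noteq> f n"
        using omega1_trans[OF ijn] omega1_antisym[OF ijn(2)] ijn(1) by metis+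
      then show ?thesis using ord[OF ij(1) n] by (auto simp: code_below_def)
    qed
    show "f ` code_below c n = underS omega1 (f n)"
    proof (intro subset_antisym subsetI)
      fix a assume "a \<in> f ` code_below c n"
      then obtain i where i: "a = f i" "i \<in> code_below c n" by blast
      then have "i \<in> code_field c" "i \<noteq> n" "fst c (i, n)"
        using sub by (auto simp: code_below_def)
      then show "a \<in> underS omega1 (f n)"
        using ord[of i n] inj[of i n] n i(1) by (auto simp: underS_def)
    next
      fix a assume a: "a \<in> underS omega1 (f n)"
      have "f n \<in> dom s" by (rule code_map_mem[OF f n])
      then have "a \<in> dom s" using countable_bin_seqs_dom(2)[OF s] a by (auto simp: underS_def)
      then obtain i where i: "i \<in> code_field c" "f i = a" using code_map_surj[OF f] by blast
      then have "i \<in> code_below c n" using ord[OF i(1) n] a by (auto simp: code_below_def underS_def)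
      then show "a \<in> f ` code_below c n" using i(2) by blast
    qed
  qed
  note img = code_map_image[OF f(1)] code_map_image[OF f(2)]
  note fld = code_map_field[OF f(1)]
  note val = code_map_val[OF f(1)] code_map_val[OF f(2)]
  note dom = countable_bin_seqs_dom[OF s(1)] countable_bin_seqs_dom[OF s(2)]
  have P1: "partial_iso c c' (code_field c) (code_below c' m) \<longleftrightarrow>
      dom s = underS omega1 (f' m) \<and> (\<forall>\<gamma>\<in>dom s. s \<gamma> = s' \<gamma>)" if "m \<in> code_field c'" for m
    using partial_iso_iff[OF s f, of "code_field c" "code_below c' m"] fld
      below[OF f(2) s(2) that] img by simp
  have P2: "partial_iso c c' (code_below c n) (code_below c' m) \<longleftrightarrow>
      underS omega1 (f n) = underS omega1 (f' m) \<and> (\<forall>\<gamma>\<in>underS omega1 (f n). s \<gamma> = s' \<gamma>)"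
    if "m \<in> code_field c'" "n \<in> code_field c" for m n
    using partial_iso_iff[OF s f, of "code_below c n" "code_below c' m"]
      below[OF f(2) s(2) that(1)] below[OF f(1) s(1) that(2)] by simp
  show ?thesis
  proof
    assume "code_less c c'"
    then obtain m where m: "m \<in> code_field c'" and
      cs: "partial_iso c c' (code_field c) (code_below c' m) \<or>
        (\<exists>n\<in>code_field c. \<not> snd c n \<and> snd c' m \<and> partial_iso c c' (code_below c n) (code_below c' m))"
      by (auto simp: code_less_def)
    have fm: "f' m \<in> Field omega1" using code_map_mem[OF f(2) m] dom(3) by blast
    from cs show "lex_less s s'"
    proof
      assume "partial_iso c c' (code_field c) (code_below c' m)"
      then have eq: "dom s = underS omega1 (f' m)" "\<forall>\<gamma>\<in>dom s. s \<gamma> = s' \<gamma>" using P1[OF m] by auto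
      then have "f' m \<notin> dom s" by (simp add: underS_def)
      then have "s (f' m) = None" by blast
      then have "digit_rank (s (f' m)) < digit_rank (s' (f' m))"
        using val(2)[OF m] by (cases "snd c' m") auto
      then show ?thesis using fm eq unfolding lex_less_def by auto
    next
      assume "\<exists>n\<in>code_field c. \<not> snd c n \<and> snd c' m \<and> partial_iso c c' (code_below c n) (code_below c' m)"
      then obtain n where n: "n \<in> code_field c" "\<not> snd c n" "snd c' m"
        "partial_iso c c' (code_below c n) (code_below c' m)" by blast
      then have eq: "underS omega1 (f n) = underS omega1 (f' m)" "\<forall>\<gamma>\<in>underS omega1 (f n). s \<gamma> = s' \<gamma>"
        using P2[OF m n(1)] by auto
      have "f n \<in> Field omega1" using code_map_mem[OF f(1) n(1)] dom(1) by blast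
      then have "f n = f' m" using omega1_total[OF _ fm] eq(1) by (metis underS_notIn)
      then have "digit_rank (s (f' m)) < digit_rank (s' (f' m))"
        using val(1)[OF n(1)] val(2)[OF m] n by simp
      then show ?thesis using fm eq unfolding lex_less_def by auto
    qed
  next
    assume "lex_less s s'"
    then obtain \<beta> where \<beta>: "\<beta> \<in> Field omega1" "\<forall>\<gamma>\<in>underS omega1 \<beta>. s \<gamma> = s' \<gamma>"
      "digit_rank (s \<beta>) < digit_rank (s' \<beta>)" by (auto simp: lex_less_def)
    have "s' \<beta> \<noteq> None"
    proof
      assume "s' \<beta> = None"
      with \<beta>(3) show False by simp
    qed
    then have \<beta>': "\<beta> \<in> dom s'" by blast
    then obtain m where m: "m \<in> code_field c'" "f' m = \<beta>" using code_map_surj[OF f(2)] by blast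
    have sub: "underS omega1 \<beta> \<subseteq> dom s"
    proof
      fix \<gamma> assume \<gamma>: "\<gamma> \<in> underS omega1 \<beta>"
      then have "\<gamma> \<in> dom s'" using dom(4)[OF \<beta>'] by (auto simp: underS_def)
      then show "\<gamma> \<in> dom s" using \<beta>(2) \<gamma> by (metis domIff)
    qed
    show "code_less c c'"
    proof (cases "s \<beta>")
      case None
      \<comment> \<open>\<open>s\<close> has ended at \<beta> and its domain is an initial segment,
        so the domain is exactly what lies below \<beta>.\<close>
      have "dom s \<subseteq> underS omega1 \<beta>"
      proof
        fix \<gamma> assume \<gamma>: "\<gamma> \<in> dom s"
        have "\<gamma> \<noteq> \<beta>" using None \<gamma> by auto
        moreover have "\<beta> \<notin> underS omega1 \<gamma>" using dom(2)[OF \<gamma>] None by (auto simp: underS_def)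
        ultimately show "\<gamma> \<in> underS omega1 \<beta>" using omega1_total[OF _ \<beta>(1)] dom(1) \<gamma> by blast
      qed
      then have "dom s = underS omega1 (f' m)" using sub m(2) by blast
      then have "partial_iso c c' (code_field c) (code_below c' m)"
        using P1[OF m(1)] \<beta>(2) m(2) by simp
      then show ?thesis using m(1) unfolding code_less_def by blast
    next
      case (Some b)
      then have b: "s \<beta> = Some False" "s' \<beta> = Some True"
        using \<beta>(3) by (cases "s' \<beta>" rule: digit_rank.cases; cases b; simp)+
      then obtain n where n: "n \<in> code_field c" "f n = \<beta>" using code_map_surj[OF f(1)] by blast
      then have "\<not> snd c n" "snd c' m" using b val(1)[OF n(1)] val(2)[OF m(1)] m(2) by auto
      moreover have "partial_iso c c' (code_below c n) (code_below c' m)"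
        using P2[OF m(1) n(1)] m(2) n(2) \<beta>(2) by simp
      ultimately show ?thesis using m(1) n(1) unfolding code_less_def by blast
    qed
  qed
qed

section \<open>Borel sets of planes\<close>

text \<open>With this instance the Borel sets of a countable power of \<open>bool\<close> are
  generated by the coordinates.\<close>

instance bool :: second_countable_topology
proof
  have "open = generate_topology (UNIV :: bool set set)"
    by (intro ext) (simp add: open_discrete generate_topology.Basis)
  then show "\<exists>B :: bool set set. countable B \<and> open = generate_topology B" by blast
qed

lemma measurable_into_bool_borel_iff:
  fixes f :: "'a \<Rightarrow> bool"
  shows "f \<in> borel_measurable M \<longleftrightarrow> Measurable.pred M f"
proof -
  have "sets (borel :: bool measure) = sets (count_space UNIV)" by (simp add: sets_borel_eq_count_space)
  then show ?thesis using measurable_cong_sets by blast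
qed

lemma measurable_into_pred_borel:
  fixes f :: "'a \<Rightarrow> 'i::countable \<Rightarrow> bool"
  assumes "\<And>i. Measurable.pred M (\<lambda>x. f x i)"
  shows "f \<in> borel_measurable M"
  by (rule measurable_coordinatewise_then_product)
    (simp add: measurable_into_bool_borel_iff assms)

lemma pred_coordinate:
  fixes f :: "'a \<Rightarrow> 'i::countable \<Rightarrow> bool"
  assumes "f \<in> borel_measurable M"
  shows "Measurable.pred M (\<lambda>x. f x i)"
  using measurable_product_then_coordinatewise[OF assms] by (simp only: measurable_into_bool_borel_iff)

lemma borel_measurable_fst_snd:
  fixes f :: "'a \<Rightarrow> 'b::second_countable_topology \<times> 'c::second_countable_topology"
  assumes "f \<in> borel_measurable M"
  shows "(\<lambda>x. fst (f x)) \<in> borel_measurable M" "(\<lambda>x. snd (f x)) \<in> borel_measurable M"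
  using assms unfolding borel_prod[symmetric] by (simp_all add: measurable_fst'' measurable_snd'')

lemma borel_measurable_struct_iff:
  "M \<in> borel_measurable X \<longleftrightarrow> (\<forall>n. Measurable.pred X (\<lambda>x. pt (M x) n)) \<and>
     (\<forall>n. Measurable.pred X (\<lambda>x. ln (M x) n)) \<and> (\<forall>p l. Measurable.pred X (\<lambda>x. inc (M x) p l))"
proof (intro iffI conjI allI)
  assume M: "M \<in> borel_measurable X"
  note 1 = borel_measurable_fst_snd[OF M]
  note 2 = borel_measurable_fst_snd[OF 1(2)]
  show "Measurable.pred X (\<lambda>x. pt (M x) n)" for n
    unfolding pt_def by (rule pred_coordinate[OF 1(1)])
  show "Measurable.pred X (\<lambda>x. ln (M x) n)" for n
    unfolding ln_def by (rule pred_coordinate[OF 2(1)])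
  show "Measurable.pred X (\<lambda>x. inc (M x) p l)" for p l
    unfolding inc_def by (rule pred_coordinate[OF 2(2)])
next
  assume *: "(\<forall>n. Measurable.pred X (\<lambda>x. pt (M x) n)) \<and>
     (\<forall>n. Measurable.pred X (\<lambda>x. ln (M x) n)) \<and> (\<forall>p l. Measurable.pred X (\<lambda>x. inc (M x) p l))"
  have "(\<lambda>x. (fst (M x), fst (snd (M x)), snd (snd (M x)))) \<in> borel_measurable X"
  proof (intro borel_measurable_Pair measurable_into_pred_borel)
    show "Measurable.pred X (\<lambda>x. fst (M x) n)" for n using * by (simp add: pt_def)
    show "Measurable.pred X (\<lambda>x. fst (snd (M x)) n)" for n using * by (simp add: ln_def)
    show "Measurable.pred X (\<lambda>x. snd (snd (M x)) i)" for i using * by (cases i) (simp add: inc_def)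
  qed
  then show "M \<in> borel_measurable X" by simp
qed

lemma pred_struct [measurable]:
  "Measurable.pred borel (\<lambda>M. pt M n)" "Measurable.pred borel (\<lambda>M. ln M n)"
  "Measurable.pred borel (\<lambda>M. inc M p l)"
  using borel_measurable_struct_iff[of "\<lambda>M. M" borel] by simp_all

lemma plane_pred [measurable]: "Measurable.pred borel plane"
  unfolding plane_def Ex1_def collinear_pts_def by measurable

lemma projective_pred [measurable]: "Measurable.pred borel projective"
  unfolding projective_def Ex1_def by measurable

lemma nontrivial_line_iff:
  "nontrivial_line M l \<longleftrightarrow> ln M l \<and> \<not> (\<exists>p q. p \<noteq> q \<and> (\<forall>r. inc M r l \<longleftrightarrow> r = p \<or> r = q))"
  by (auto simp: nontrivial_line_def trivial_line_def card_2_iff set_eq_iff)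

lemma nontrivial_line_pred [measurable]: "Measurable.pred borel (\<lambda>M. nontrivial_line M l)"
  unfolding nontrivial_line_iff by measurable

lemma card_le_2_iff: "finite A \<and> card A \<le> 2 \<longleftrightarrow> (\<exists>a b. A \<subseteq> {a, b})"
proof
  assume A: "finite A \<and> card A \<le> 2"
  then consider "card A = 0" | "card A = 1" | "card A = 2" by linarith
  then show "\<exists>a b. A \<subseteq> {a, b}"
    by cases (use A in \<open>auto simp: card_1_singleton_iff card_2_iff\<close>)
next
  assume "\<exists>a b. A \<subseteq> {a, b}"
  then obtain a b where "A \<subseteq> {a, b}" by blast
  then show "finite A \<and> card A \<le> 2"
    using card_mono[of "{a, b}" A] card_insert_le_m1[of 2 "{b}" a] by (auto dest: finite_subset)
qed

text \<open>Sets of points are replaced by lists, and the bound on the number of lines by two named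
  numbers, so that all quantifiers range over countable types and \<open>measurable\<close>
  applies.\<close>

lemma simple_plane_iff:
  "simple_plane M \<longleftrightarrow> plane M \<and> (\<exists>xs. card (set xs) = 17 \<and> (\<forall>p. p \<in> set xs \<longrightarrow> pt M p) \<and>
     (\<forall>p. pt M p \<and> p \<notin> set xs \<longrightarrow>
        (\<exists>a b. \<forall>l. nontrivial_line M l \<and> inc M p l \<longrightarrow> l = a \<or> l = b)))"
proof -
  define \<Phi> where "\<Phi> S \<longleftrightarrow> (\<forall>p. p \<in> S \<longrightarrow> pt M p) \<and> (\<forall>p. pt M p \<and> p \<notin> S \<longrightarrow>
    (\<exists>a b. \<forall>l. nontrivial_line M l \<and> inc M p l \<longrightarrow> l = a \<or> l = b))" for S
  have "(\<exists>a b. {l. nontrivial_line M l \<and> inc M p l} \<subseteq> {a, b}) \<longleftrightarrow>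
      (\<exists>a b. \<forall>l. nontrivial_line M l \<and> inc M p l \<longrightarrow> l = a \<or> l = b)" for p
    by (intro ex_cong1) blast
  then have "simple_plane M \<longleftrightarrow> plane M \<and> (\<exists>S. card S = 17 \<and> \<Phi> S)"
    unfolding simple_plane_def card_le_2_iff \<Phi>_def Ball_def by simp
  also have "(\<exists>S. card S = 17 \<and> \<Phi> S) \<longleftrightarrow> (\<exists>xs. card (set xs) = 17 \<and> \<Phi> (set xs))"
  proof
    assume "\<exists>S. card S = 17 \<and> \<Phi> S"
    then obtain S where S: "card S = 17" "\<Phi> S" by blast
    then have "finite S" by (intro card_ge_0_finite) simp
    then show "\<exists>xs. card (set xs) = 17 \<and> \<Phi> (set xs)" using S finite_list by metis
  qed blast
  finally show ?thesis by (simp only: \<Phi>_def)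
qed

lemma simple_planes_borel: "simple_planes \<in> sets borel"
proof -
  have "Measurable.pred borel simple_plane"
    unfolding simple_plane_iff[abs_def] by measurable
  then show ?thesis by (simp add: simple_planes_def pred_def)
qed

text \<open>
  Unlike \<^const>\<open>The\<close>, which is arbitrary when the object is not unique, \<^const>\<open>Least\<close> gives
  measurable functions on all structures.
\<close>

definition least_join :: "struct \<Rightarrow> nat \<Rightarrow> nat \<Rightarrow> nat" where
  "least_join M a b = (LEAST l. ln M l \<and> inc M a l \<and> inc M b l)"

definition least_meet :: "struct \<Rightarrow> nat \<Rightarrow> nat \<Rightarrow> nat" where
  "least_meet M l l' = (LEAST p. pt M p \<and> inc M p l \<and> inc M p l')"

lemma The_eq_Least:
  fixes P :: "nat \<Rightarrow> bool"
  assumes "\<exists>!x. P x"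
  shows "(THE x. P x) = (LEAST x. P x)"
  using assms by (metis LeastI the1_equality)

lemma join_eq_least_join:
  assumes "plane M" "pt M a" "pt M b" "a \<noteq> b"
  shows "join M a b = least_join M a b"
  unfolding join_def least_join_def
  by (rule The_eq_Least) (use assms in \<open>auto simp: plane_def\<close>)

lemma meet_eq_least_meet:
  assumes "projective M" "ln M l" "ln M l'" "l \<noteq> l'"
  shows "meet M l l' = least_meet M l l'"
  unfolding meet_def least_meet_def
  by (rule The_eq_Least) (use assms in \<open>auto simp: projective_def\<close>)

lemma join_line:
  assumes "plane M" "pt M a" "pt M b" "a \<noteq> b"
  shows "ln M (join M a b)" "inc M a (join M a b)" "inc M b (join M a b)"
proof -
  have "\<exists>!l. ln M l \<and> inc M a l \<and> inc M b l" using assms by (auto simp: plane_def)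
  from theI'[OF this] show "ln M (join M a b)" "inc M a (join M a b)" "inc M b (join M a b)"
    unfolding join_def by blast+
qed

lemma pred_least [measurable]:
  "(\<lambda>M. least_join M a b) \<in> measurable borel (count_space UNIV)"
  "(\<lambda>M. least_meet M a b) \<in> measurable borel (count_space UNIV)"
  unfolding least_join_def least_meet_def by measurable

text \<open>Every join and meet is named by a quantified number, which reduces the condition to
  countably many atomic ones with fixed numbers as arguments.\<close>

definition desarguesian_least :: "struct \<Rightarrow> bool" where
  "desarguesian_least M \<longleftrightarrow>
     (\<forall>p q r p' q' r' pq pq' pr pr' qr qr' pp qq rr.
        (\<forall>x \<in> {p, q, r, p', q', r'}. pt M x) \<and>
        distinct [p, q, r] \<and> distinct [p', q', r'] \<and>
        p \<noteq> p' \<and> q \<noteq> q' \<and> r \<noteq> r' \<and>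
        least_join M p q = pq \<and> least_join M p' q' = pq' \<and>
        least_join M p r = pr \<and> least_join M p' r' = pr' \<and>
        least_join M q r = qr \<and> least_join M q' r' = qr' \<and>
        least_join M p p' = pp \<and> least_join M q q' = qq \<and> least_join M r r' = rr \<and>
        pq \<noteq> pq' \<and> pr \<noteq> pr' \<and> qr \<noteq> qr' \<and>
        (\<exists>c. pt M c \<and> inc M c pp \<and> inc M c qq \<and> inc M c rr)
        \<longrightarrow> (\<exists>a b d l. least_meet M pq pq' = a \<and> least_meet M pr pr' = b \<and> least_meet M qr qr' = d \<and>
            ln M l \<and> inc M a l \<and> inc M b l \<and> inc M d l))"

lemma desarguesian_iff_least:
  assumes M: "projective M"
  shows "desarguesian M \<longleftrightarrow> desarguesian_least M"
proof -
  have P: "plane M" using M by (simp add: projective_def)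
  show ?thesis
    unfolding desarguesian_def desarguesian_least_def
  proof (intro all_cong1 iffI allI impI, goal_cases)
    case (1 p q r p' q' r' pq pq' pr pr' qr qr' pp qq rr)
    then have pts: "pt M p" "pt M q" "pt M r" "pt M p'" "pt M q'" "pt M r'"
      and ne: "p \<noteq> q" "p \<noteq> r" "q \<noteq> r" "p' \<noteq> q'" "p' \<noteq> r'" "q' \<noteq> r'" "p \<noteq> p'" "q \<noteq> q'" "r \<noteq> r'"
      by auto
    note J = join_eq_least_join[OF P pts(1,2) ne(1)] join_eq_least_join[OF P pts(1,3) ne(2)]
      join_eq_least_join[OF P pts(2,3) ne(3)] join_eq_least_join[OF P pts(4,5) ne(4)]
      join_eq_least_join[OF P pts(4,6) ne(5)] join_eq_least_join[OF P pts(5,6) ne(6)]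
      join_eq_least_join[OF P pts(1,4) ne(7)] join_eq_least_join[OF P pts(2,5) ne(8)]
      join_eq_least_join[OF P pts(3,6) ne(9)]
    note L = join_line(1)[OF P pts(1,2) ne(1)] join_line(1)[OF P pts(1,3) ne(2)]
      join_line(1)[OF P pts(2,3) ne(3)] join_line(1)[OF P pts(4,5) ne(4)]
      join_line(1)[OF P pts(4,6) ne(5)] join_line(1)[OF P pts(5,6) ne(6)]
    have "collinear_pts M (meet M (join M p q) (join M p' q'))
        (meet M (join M p r) (join M p' r')) (meet M (join M q r) (join M q' r'))"
      using 1 J by (intro 1(1)[rule_format]) auto
    moreover have "join M p q \<noteq> join M p' q'" "join M p r \<noteq> join M p' r'" "join M q r \<noteq> join M q' r'"
      using 1(2) J by auto
    ultimately show ?case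
      using meet_eq_least_meet[OF M L(1,4)] meet_eq_least_meet[OF M L(2,5)]
        meet_eq_least_meet[OF M L(3,6)] J 1(2)
      by (auto simp: collinear_pts_def)
  next
    case (2 p q r p' q' r')
    then have pts: "pt M p" "pt M q" "pt M r" "pt M p'" "pt M q'" "pt M r'"
      and ne: "p \<noteq> q" "p \<noteq> r" "q \<noteq> r" "p' \<noteq> q'" "p' \<noteq> r'" "q' \<noteq> r'" "p \<noteq> p'" "q \<noteq> q'" "r \<noteq> r'"
      by auto
    note J = join_eq_least_join[OF P pts(1,2) ne(1)] join_eq_least_join[OF P pts(1,3) ne(2)]
      join_eq_least_join[OF P pts(2,3) ne(3)] join_eq_least_join[OF P pts(4,5) ne(4)]
      join_eq_least_join[OF P pts(4,6) ne(5)] join_eq_least_join[OF P pts(5,6) ne(6)]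
      join_eq_least_join[OF P pts(1,4) ne(7)] join_eq_least_join[OF P pts(2,5) ne(8)]
      join_eq_least_join[OF P pts(3,6) ne(9)]
    note L = join_line(1)[OF P pts(1,2) ne(1)] join_line(1)[OF P pts(1,3) ne(2)]
      join_line(1)[OF P pts(2,3) ne(3)] join_line(1)[OF P pts(4,5) ne(4)]
      join_line(1)[OF P pts(4,6) ne(5)] join_line(1)[OF P pts(5,6) ne(6)]
    have "\<exists>a b d l. least_meet M (join M p q) (join M p' q') = a \<and>
        least_meet M (join M p r) (join M p' r') = b \<and> least_meet M (join M q r) (join M q' r') = d \<and>
        ln M l \<and> inc M a l \<and> inc M b l \<and> inc M d l"
      using 2 J by (intro 2(1)[rule_format, of _ _ _ _ _ _ "join M p p'" "join M q q'" "join M r r'"]) auto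
    moreover have "join M p q \<noteq> join M p' q'" "join M p r \<noteq> join M p' r'" "join M q r \<noteq> join M q' r'"
      using 2(2) by auto
    ultimately show ?case
      using meet_eq_least_meet[OF M L(1,4)] meet_eq_least_meet[OF M L(2,5)]
        meet_eq_least_meet[OF M L(3,6)]
      by (auto simp: collinear_pts_def)
  qed
qed

lemma nondesarguesian_planes_borel: "nondesarguesian_planes \<in> sets borel"
proof -
  have [measurable]: "Measurable.pred borel desarguesian_least"
    unfolding desarguesian_least_def ball_simps by measurable
  have "nondesarguesian_planes = {M \<in> space borel. projective M \<and> \<not> desarguesian_least M}"
    by (auto simp: nondesarguesian_planes_def desarguesian_iff_least)
  also have "\<dots> \<in> sets borel" by measurable
  finally show ?thesis .
qed

section \<open>An obstruction to Ulm type classifications\<close>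

text \<open>The sets with the Baire property are made a measurable space, so that their closure
  under countable operations is available through \<open>measurable\<close>.\<close>

definition baire_measure :: "(nat \<Rightarrow> bool) measure" where
  "baire_measure = sigma UNIV {A. cantor.baire_property A}"

lemma sets_baire_measure: "sets baire_measure = {A. cantor.baire_property A}"
  unfolding baire_measure_def
  using sigma_algebra.sets_measure_of_eq[OF cantor.sigma_algebra_baire_property] by simp

lemma space_baire_measure [simp]: "space baire_measure = UNIV"
  unfolding baire_measure_def by (simp add: space_measure_of_conv)

lemma pred_baire_measure_iff: "Measurable.pred baire_measure P \<longleftrightarrow> cantor.baire_property {z. P z}"
  by (simp add: pred_def sets_baire_measure)

lemma borel_measurable_imp_baire:
  assumes "f \<in> borel_measurable (borel :: (nat \<Rightarrow> bool) measure)"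
  shows "f \<in> borel_measurable baire_measure"
proof -
  have "Measurable.pred baire_measure (\<lambda>x. x i)" for i
  proof -
    have "{x :: nat \<Rightarrow> bool. x i} = (\<Union>s\<in>{s. i < length s \<and> s ! i}. cantor.cyl s)"
    proof (intro subset_antisym subsetI)
      fix x :: "nat \<Rightarrow> bool" assume "x \<in> {x. x i}"
      then have "x \<in> cantor.cyl (map x [0..<Suc i])" "map x [0..<Suc i] ! i" 
        by (simp_all add: cantor_cyl_iff del: upt_Suc)
      then show "x \<in> (\<Union>s\<in>{s. i < length s \<and> s ! i}. cantor.cyl s)"
        by (intro UN_I[of "map x [0..<Suc i]"]) (simp_all del: upt_Suc)
    qed (auto simp: cantor_cyl_iff)
    then show ?thesis
      unfolding pred_baire_measure_iff
      by (simp add: cantor.baire_property_UN cantor.baire_property_base)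
  qed
  then have "(\<lambda>x. x) \<in> borel_measurable baire_measure" by (rule measurable_into_pred_borel)
  from measurable_compose[OF this assms] show ?thesis by simp
qed

text \<open>The subsets of \<open>K\<close> whose preimage has the Baire property form a
  sigma-algebra that contains the Borel sets and is closed under the Souslin operation, and
  \<open>C_sets\<close> is contained in every such family.\<close>

lemma C_algebra_vimage_baire:
  fixes \<phi> :: "(nat \<Rightarrow> bool) \<Rightarrow> struct"
  assumes \<phi>: "\<phi> \<in> borel_measurable borel" "\<And>x. \<phi> x \<in> K"
    and A: "A \<in> sets (C_algebra (restrict_space borel K))"
  shows "cantor.baire_property (\<phi> -` A)"
proof -
  interpret BP: sigma_algebra "UNIV :: (nat \<Rightarrow> bool) set" "{A. cantor.baire_property A}"
    by (rule cantor.sigma_algebra_baire_property)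
  define X where "X = restrict_space borel K"
  define S where "S = {A. A \<subseteq> K \<and> cantor.baire_property (\<phi> -` A)}"
  have space: "space X = K" by (simp add: X_def space_restrict_space)
  have sigma: "sigma_algebra K S"
    unfolding sigma_algebra_iff2
  proof (intro conjI ballI allI impI)
    show "{} \<in> S" using BP.empty_sets by (simp add: S_def)
  next
    fix B assume B: "B \<in> S"
    have "\<phi> -` (K - B) = - (\<phi> -` B)" using \<phi>(2) by auto
    then show "K - B \<in> S" using B cantor.baire_property_Compl by (simp add: S_def)
  next
    fix B :: "nat \<Rightarrow> struct set" assume "range B \<subseteq> S"
    then have B: "\<And>n. B n \<in> S" by blast
    have "\<phi> -` (\<Union>n. B n) = (\<Union>n. \<phi> -` B n)" by blast
    moreover have "cantor.baire_property (\<Union>n. \<phi> -` B n)"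
      using B by (intro cantor.baire_property_UN) (auto simp: S_def)
    moreover have "(\<Union>n. B n) \<subseteq> K" using B unfolding S_def by blast
    ultimately show "(\<Union>n. B n) \<in> S" by (simp add: S_def)
  qed (auto simp: S_def)
  have sets_S: "sets X \<subseteq> S"
  proof
    fix B assume "B \<in> sets X"
    then obtain C where C: "C \<in> sets borel" "B = C \<inter> K"
      by (auto simp: X_def sets_restrict_space)
    have "\<phi> -` C \<inter> space baire_measure \<in> sets baire_measure"
      by (rule measurable_sets[OF borel_measurable_imp_baire[OF \<phi>(1)] C(1)])
    moreover have "\<phi> -` B = \<phi> -` C" using \<phi>(2) C(2) by auto
    ultimately show "B \<in> S" using C(2) by (simp add: S_def sets_baire_measure)
  qed
  have souslin: "souslin_op P \<in> S" if "range P \<subseteq> S" for P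
  proof -
    have P: "\<And>s. P s \<in> S" using that by blast
    have "\<phi> -` souslin_op P = souslin_op (\<lambda>s. \<phi> -` P s)" by (auto simp: souslin_op_def)
    moreover have "cantor.baire_property (souslin_op (\<lambda>s. \<phi> -` P s))"
      using P by (intro cantor.baire_property_souslin_op) (simp add: S_def)
    \<comment> \<open>At \<open>n = 0\<close> every branch passes through the empty list; this keeps
      the result inside \<open>K\<close>.\<close>
    moreover have "souslin_op P \<subseteq> P []"
    proof
      fix M assume "M \<in> souslin_op P"
      then obtain x :: "nat \<Rightarrow> nat" where "\<forall>n. M \<in> P (map x [0..<n])" by (auto simp: souslin_op_def)
      from this[rule_format, of 0] show "M \<in> P []" by simp
    qed
    ultimately show ?thesis using P[of "[]"] by (auto simp: S_def)
  qed
  have C: "C_sets X \<subseteq> S"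
    unfolding C_sets_def space using sigma sets_S souslin by (intro Inter_lower) blast
  then have "C_sets X \<subseteq> Pow K" by (auto simp: S_def)
  then have "sets (C_algebra X) = sigma_sets K (C_sets X)"
    by (simp add: C_algebra_def space)
  also have "\<dots> \<subseteq> S" by (rule sigma_algebra.sigma_sets_subset[OF sigma C])
  finally show ?thesis using A by (auto simp: X_def S_def)
qed

text \<open>A condition on \<open>x i\<close> and \<open>x j\<close> is decided by any initial
  segment of \<open>x\<close> that contains both positions. So the set arises by the Souslin
  operation from the sets \<open>P s\<close> of points that satisfy all conditions within
  \<open>s\<close>.\<close>

lemma pred_baire_souslin:
  fixes T :: "nat \<Rightarrow> nat \<Rightarrow> nat \<Rightarrow> nat \<Rightarrow> (nat \<Rightarrow> bool) \<Rightarrow> bool"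
  assumes T: "\<And>i j a b. Measurable.pred baire_measure (T i j a b)"
  shows "Measurable.pred baire_measure (\<lambda>z. \<exists>x. \<forall>i j. T i j (x i) (x j) z)"
proof -
  define P where "P s = {z. \<forall>i<length s. \<forall>j<length s. T i j (s ! i) (s ! j) z}" for s
  have "cantor.baire_property (P s)" for s
  proof -
    note [measurable] = T
    have "Measurable.pred baire_measure (\<lambda>z. \<forall>i<length s. \<forall>j<length s. T i j (s ! i) (s ! j) z)"
      by measurable
    then show ?thesis by (simp add: pred_baire_measure_iff P_def)
  qed
  then have "cantor.baire_property (souslin_op P)" by (rule cantor.baire_property_souslin_op)
  moreover have "souslin_op P = {z. \<exists>x. \<forall>i j. T i j (x i) (x j) z}"
  proof -
    have "(\<forall>n. z \<in> P (map x [0..<n])) \<longleftrightarrow> (\<forall>i j. T i j (x i) (x j) z)" for x z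
    proof
      assume *: "\<forall>n. z \<in> P (map x [0..<n])"
      show "\<forall>i j. T i j (x i) (x j) z"
      proof (intro allI)
        fix i j
        have "z \<in> P (map x [0..<Suc (max i j)])" using * by blast
        then show "T i j (x i) (x j) z"
          unfolding P_def by (auto simp del: upt_Suc dest: spec[of _ i] spec[of _ j])
      qed
    qed (simp add: P_def)
    then show ?thesis unfolding souslin_op_def set_eq_iff UN_iff INT_iff mem_Collect_eq by blast
  qed
  ultimately show ?thesis by (simp add: pred_baire_measure_iff)
qed

text \<open>
  One function codes an isomorphism together with its inverse, so that every condition involves
  only two of its values; this is the form needed for the Souslin operation.
\<close>

lemma partial_iso_iff_ex:
  "partial_iso c c' S S' \<longleftrightarrow> (\<exists>x :: nat \<Rightarrow> nat. \<forall>i j.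
     (i \<in> S \<longrightarrow> fst (prod_decode (x i)) \<in> S' \<and> (fst (prod_decode (x i)) = j \<longrightarrow> snd (prod_decode (x j)) = i)) \<and>
     (j \<in> S' \<longrightarrow> snd (prod_decode (x j)) \<in> S \<and> (snd (prod_decode (x j)) = i \<longrightarrow> fst (prod_decode (x i)) = j)) \<and>
     (i \<in> S \<longrightarrow> j \<in> S \<longrightarrow> fst c (i, j) = fst c' (fst (prod_decode (x i)), fst (prod_decode (x j)))) \<and>
     (i \<in> S \<longrightarrow> snd c i = snd c' (fst (prod_decode (x i)))))" (is "_ \<longleftrightarrow> (\<exists>x. ?Q x)")
proof
  assume "partial_iso c c' S S'"
  then obtain F G where FG: "\<And>i. i \<in> S \<Longrightarrow> F i \<in> S'" "\<And>i. i \<in> S \<Longrightarrow> G (F i) = i"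
    "\<And>j. j \<in> S' \<Longrightarrow> G j \<in> S" "\<And>j. j \<in> S' \<Longrightarrow> F (G j) = j"
    "\<And>i j. i \<in> S \<Longrightarrow> j \<in> S \<Longrightarrow> fst c (i, j) = fst c' (F i, F j)"
    "\<And>i. i \<in> S \<Longrightarrow> snd c i = snd c' (F i)"
    unfolding partial_iso_def by blast
  have "?Q (\<lambda>i. prod_encode (F i, G i))"
    unfolding prod_encode_inverse fst_conv snd_conv
  proof (intro allI)
    fix i j
    show "(i \<in> S \<longrightarrow> F i \<in> S' \<and> (F i = j \<longrightarrow> G j = i)) \<and> (j \<in> S' \<longrightarrow> G j \<in> S \<and> (G j = i \<longrightarrow> F i = j)) \<and>
        (i \<in> S \<longrightarrow> j \<in> S \<longrightarrow> fst c (i, j) = fst c' (F i, F j)) \<and> (i \<in> S \<longrightarrow> snd c i = snd c' (F i))"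
    proof (intro conjI impI)
      show "F i \<in> S'" if "i \<in> S" by (rule FG(1)[OF that])
      show "G j = i" if "i \<in> S" "F i = j" using FG(2)[OF that(1)] unfolding that(2) .
      show "G j \<in> S" if "j \<in> S'" by (rule FG(3)[OF that])
      show "F i = j" if "j \<in> S'" "G j = i" using FG(4)[OF that(1)] unfolding that(2) .
      show "fst c (i, j) = fst c' (F i, F j)" if "i \<in> S" "j \<in> S" by (rule FG(5)[OF that])
      show "snd c i = snd c' (F i)" if "i \<in> S" by (rule FG(6)[OF that])
    qed
  qed
  then show "\<exists>x. ?Q x" by (rule exI[where P = ?Q])
next
  assume "\<exists>x. ?Q x"
  then obtain x where x: "?Q x" ..
  define F where "F i = fst (prod_decode (x i))" for i
  define G where "G j = snd (prod_decode (x j))" for j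
  have X: "(i \<in> S \<longrightarrow> F i \<in> S' \<and> (F i = j \<longrightarrow> G j = i)) \<and> (j \<in> S' \<longrightarrow> G j \<in> S \<and> (G j = i \<longrightarrow> F i = j)) \<and>
      (i \<in> S \<longrightarrow> j \<in> S \<longrightarrow> fst c (i, j) = fst c' (F i, F j)) \<and> (i \<in> S \<longrightarrow> snd c i = snd c' (F i))" for i j
    unfolding F_def G_def by (rule x[rule_format])
  show "partial_iso c c' S S'"
    unfolding partial_iso_def
  proof (rule exI[of _ F], rule exI[of _ G], intro conjI ballI)
    fix i assume i: "i \<in> S"
    show "F i \<in> S'" "G (F i) = i" using X[of i "F i"] i by simp_all
    show "snd c i = snd c' (F i)" using X[of i] i by simp
    fix j assume j: "j \<in> S"
    show "fst c (i, j) = fst c' (F i, F j)" using X[of i j] i j by simp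
  next
    fix j assume j: "j \<in> S'"
    show "G j \<in> S" "F (G j) = j" using X[of "G j" j] j by simp_all
  qed
qed

lemma pred_partial_iso:
  assumes [measurable]: "\<And>p. Measurable.pred baire_measure (\<lambda>z. fst (c z) p)"
    "\<And>n. Measurable.pred baire_measure (\<lambda>z. snd (c z) n)"
    "\<And>p. Measurable.pred baire_measure (\<lambda>z. fst (c' z) p)"
    "\<And>n. Measurable.pred baire_measure (\<lambda>z. snd (c' z) n)"
    "\<And>n. Measurable.pred baire_measure (\<lambda>z. n \<in> S z)"
    "\<And>n. Measurable.pred baire_measure (\<lambda>z. n \<in> S' z)"
  shows "Measurable.pred baire_measure (\<lambda>z. partial_iso (c z) (c' z) (S z) (S' z))"
  unfolding partial_iso_iff_ex
  by (rule pred_baire_souslin[of "\<lambda>i j a b z.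
     (i \<in> S z \<longrightarrow> fst (prod_decode a) \<in> S' z \<and> (fst (prod_decode a) = j \<longrightarrow> snd (prod_decode b) = i)) \<and>
     (j \<in> S' z \<longrightarrow> snd (prod_decode b) \<in> S z \<and> (snd (prod_decode b) = i \<longrightarrow> fst (prod_decode a) = j)) \<and>
     (i \<in> S z \<longrightarrow> j \<in> S z \<longrightarrow> fst (c z) (i, j) = fst (c' z) (fst (prod_decode a), fst (prod_decode b))) \<and>
     (i \<in> S z \<longrightarrow> snd (c z) i = snd (c' z) (fst (prod_decode a)))"]) measurable

lemma pred_code_less:
  assumes [measurable]: "\<And>p. Measurable.pred baire_measure (\<lambda>z. fst (c z) p)"
    "\<And>n. Measurable.pred baire_measure (\<lambda>z. snd (c z) n)"
    "\<And>p. Measurable.pred baire_measure (\<lambda>z. fst (c' z) p)"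
    "\<And>n. Measurable.pred baire_measure (\<lambda>z. snd (c' z) n)"
  shows "Measurable.pred baire_measure (\<lambda>z. code_less (c z) (c' z))"
proof -
  have [measurable]: "Measurable.pred baire_measure (\<lambda>z. i \<in> code_field (c z))"
    "Measurable.pred baire_measure (\<lambda>z. i \<in> code_field (c' z))"
    "Measurable.pred baire_measure (\<lambda>z. i \<in> code_below (c z) n)"
    "Measurable.pred baire_measure (\<lambda>z. i \<in> code_below (c' z) n)" for i n
    unfolding code_field_def code_below_def mem_Collect_eq by measurable
  have [measurable]: "Measurable.pred baire_measure
      (\<lambda>z. partial_iso (c z) (c' z) (code_field (c z)) (code_below (c' z) m))"
    "Measurable.pred baire_measure
      (\<lambda>z. partial_iso (c z) (c' z) (code_below (c z) n) (code_below (c' z) m))" for m n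
    by (rule pred_partial_iso; measurable)+
  show ?thesis unfolding code_less_def Bex_def by measurable
qed

text \<open>The order of the invariants is evaluated on the codes given by \<open>U'\<close>, since
  it is \<open>U'\<close> that is assumed measurable. By \<open>code_less_iff_lex_less\<close> the
  outcome depends on the invariants only, hence on the classes of \<open>E0\<close>.\<close>

theorem E0_reducible_imp_not_Ulm:
  fixes f :: "(nat \<Rightarrow> bool) \<Rightarrow> struct"
  assumes f: "f \<in> borel_measurable borel" "\<And>x. f x \<in> K"
    and red: "\<And>x y. struct_iso (f x) (f y) \<longleftrightarrow> E0 x y"
  shows "\<not> admits_Ulm_classification K"
proof
  assume "admits_Ulm_classification K"
  then obtain U U' where U: "\<And>M. M \<in> K \<Longrightarrow> U M \<in> countable_bin_seqs"
    "\<And>M N. M \<in> K \<Longrightarrow> N \<in> K \<Longrightarrow> struct_iso M N \<longleftrightarrow> U M = U N"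
    and U': "U' \<in> measurable (C_algebra (restrict_space borel K)) (borel :: real_code measure)"
    "\<And>M. M \<in> K \<Longrightarrow> codes (U' M) (U M)"
    unfolding admits_Ulm_classification_def by blast
  have meas: "(\<lambda>z. U' (f (g z))) \<in> borel_measurable baire_measure"
    if g: "g \<in> borel_measurable borel" for g :: "(nat \<Rightarrow> bool) \<Rightarrow> nat \<Rightarrow> bool"
  proof (rule measurableI)
    fix B :: "real_code set" assume B: "B \<in> sets borel"
    have "U' -` B \<inter> space (C_algebra (restrict_space borel K)) \<in> sets (C_algebra (restrict_space borel K))"
      using U'(1) B by (rule measurable_sets)
    moreover have "space (C_algebra (restrict_space borel K)) = K"
      by (simp add: C_algebra_def space_measure_of_conv space_restrict_space)
    ultimately have "cantor.baire_property ((\<lambda>z. f (g z)) -` (U' -` B \<inter> K))"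
      using f(2) by (intro C_algebra_vimage_baire[OF measurable_compose[OF g f(1)], of K]) simp_all
    moreover have "(\<lambda>z. f (g z)) -` (U' -` B \<inter> K) = (\<lambda>z. U' (f (g z))) -` B" using f(2) by auto
    ultimately show "(\<lambda>z. U' (f (g z))) -` B \<inter> space baire_measure \<in> sets baire_measure"
      by (simp add: sets_baire_measure)
  qed simp
  have coord: "Measurable.pred borel (\<lambda>z :: nat \<Rightarrow> bool. z i)" for i
    by (rule pred_coordinate) simp
  have "evens \<in> borel_measurable (borel :: (nat \<Rightarrow> bool) measure)"
    "odds \<in> borel_measurable (borel :: (nat \<Rightarrow> bool) measure)"
    by (intro measurable_into_pred_borel; simp add: evens_def odds_def coord)+
  note m = this[THEN meas]
  have "Measurable.pred baire_measure (\<lambda>z. code_less (U' (f (evens z))) (U' (f (odds z))))"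
    by (intro pred_code_less pred_coordinate borel_measurable_fst_snd m)
  then have "cantor.baire_property {z. code_less (U' (f (evens z))) (U' (f (odds z)))}"
    by (simp add: pred_baire_measure_iff)
  moreover have "code_less (U' (f x)) (U' (f y)) \<longleftrightarrow> lex_less (U (f x)) (U (f y))" for x y
    by (rule code_less_iff_lex_less) (simp_all add: U U' f)
  ultimately have BP: "cantor.baire_property {z. lex_less (U (f (evens z))) (U (f (odds z)))}" by simp
  show False
  proof (rule E0_not_linearly_orderable[of "\<lambda>x. U (f x)" lex_less])
    show "U (f x) = U (f y) \<longleftrightarrow> E0 x y" for x y using U(2)[OF f(2) f(2)] red by simp
    show "lex_less (U (f x)) (U (f y)) \<or> lex_less (U (f y)) (U (f x))"
      if "U (f x) \<noteq> U (f y)" for x y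
      by (rule lex_less_total[OF U(1)[OF f(2)] U(1)[OF f(2)] that])
  qed (use BP lex_less_asym in auto)
qed

section \<open>Borel actions and list structures\<close>

definition list_iso :: "(nat list \<Rightarrow> bool) \<Rightarrow> (nat list \<Rightarrow> bool) \<Rightarrow> bool" where
  "list_iso R R' \<longleftrightarrow> (\<exists>g. bij g \<and> (\<forall>t. R t \<longleftrightarrow> R' (map g t)))"

interpretation sym: seq_space "{g :: nat \<Rightarrow> nat. bij g}" .

lemma sym_cyl_iff: "x \<in> sym.cyl s \<longleftrightarrow> bij x \<and> (\<forall>n<length s. x n = s ! n)"
  unfolding sym.cyl_def list_eq_iff_nth_eq by simp

text \<open>Injectivity of a limit follows from its initial segments being extendible to
  permutations. Surjectivity does not, and is secured by the requirement that each \<open>n\<close>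
  occurs as a value.\<close>

lemma sym_nonmeager:
  assumes "sym.cyl s \<noteq> {}"
  shows "\<not> sym.meager (sym.cyl s)"
proof (rule sym.baire_category[OF assms, of "\<lambda>n u. n \<in> set u"])
  fix x :: "nat \<Rightarrow> nat"
  assume prefix: "\<And>n. sym.cyl (map x [0..<n]) \<noteq> {}" and onto: "\<And>n. \<exists>m. n \<in> set (map x [0..<m])"
  have "x i \<noteq> x j" if "i < j" for i j
  proof -
    obtain y where "y \<in> sym.cyl (map x [0..<Suc j])" using prefix by blast
    then have y: "bij y" "\<And>n. n < Suc j \<Longrightarrow> y n = x n" by (simp_all add: sym_cyl_iff del: upt_Suc)
    then have "y i \<noteq> y j" using that by (metis bij_pointE less_irrefl)
    then show ?thesis using y(2)[of i] y(2)[of j] that by simp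
  qed
  then have "inj x" by (metis injI linorder_neqE_nat)
  moreover have "surj x"
  proof (unfold surj_def, intro allI)
    fix n
    show "\<exists>m. n = x m" using onto[of n] by auto
  qed
  ultimately show "x \<in> {g. bij g}" by (simp add: bij_def)
next
  fix n and x :: "nat \<Rightarrow> nat" assume "x \<in> {g. bij g}"
  then obtain i where "x i = n" by (metis bij_pointE mem_Collect_eq)
  then have "n \<in> set (map x [0..<Suc i])" by simp
  then show "\<exists>m. n \<in> set (map x [0..<m])" by blast
qed

lemma sym_meager_translate:
  assumes "sym.meager A" "bij g"
  shows "sym.meager ((\<lambda>h. g \<circ> h) -` A)"
proof (rule sym.meager_vimage[OF assms(1)])
  fix s assume "sym.cyl s \<noteq> {}"
  then obtain h where h: "bij h" "\<forall>n<length s. h n = s ! n" by (auto simp: sym_cyl_iff)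
  have [simp]: "inv g (g n) = n" "g (inv g n) = n" for n
    using assms(2) by (simp_all add: bij_is_inj bij_is_surj surj_f_inv_f)
  have "g \<circ> h \<in> sym.cyl (map g s)" using h assms(2) by (simp add: sym_cyl_iff bij_comp)
  moreover have "(\<lambda>h. g \<circ> h) -` sym.cyl (map g s) \<subseteq> sym.cyl s"
  proof
    fix k assume "k \<in> (\<lambda>h. g \<circ> h) -` sym.cyl (map g s)"
    then have k: "bij (g \<circ> k)" "\<forall>n<length s. g (k n) = g (s ! n)" by (simp_all add: sym_cyl_iff)
    have "bij (inv g \<circ> (g \<circ> k))" by (intro bij_comp k(1) bij_imp_bij_inv assms(2))
    moreover have "inv g \<circ> (g \<circ> k) = k" by (simp add: fun_eq_iff)
    moreover have "\<forall>n<length s. k n = s ! n" using k(2) assms(2) by (metis bij_is_inj injD)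
    ultimately show "k \<in> sym.cyl s" by (simp add: sym_cyl_iff)
  qed
  ultimately show "\<exists>t. sym.cyl t \<noteq> {} \<and> (\<lambda>h. g \<circ> h) -` sym.cyl t \<subseteq> sym.cyl s" by blast
  have "inv g \<circ> h \<in> sym.cyl (map (inv g) s)"
    using h assms(2) by (simp add: sym_cyl_iff bij_comp bij_imp_bij_inv)
  moreover have "sym.cyl (map (inv g) s) \<subseteq> (\<lambda>h. g \<circ> h) -` sym.cyl s"
    using assms(2) by (auto simp: sym_cyl_iff bij_comp)
  ultimately show "\<exists>t. sym.cyl t \<noteq> {} \<and> sym.cyl t \<subseteq> (\<lambda>h. g \<circ> h) -` sym.cyl s" by blast
qed

section \<open>The Borel structure of Sym(\<omega>) and Vaught transforms\<close>

lemma space_Sym_omega: "space Sym_omega = {g. bij g}"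
  by (simp add: Sym_omega_def space_restrict_space)

lemma measurable_inv_Sym_omega: "inv \<in> measurable Sym_omega Sym_omega"
proof -
  have "(\<lambda>g. inv g j) \<in> borel_measurable Sym_omega" for j :: nat
  proof -
    have coord: "(\<lambda>g. g k) \<in> measurable Sym_omega (count_space UNIV)" for k :: nat
    proof -
      have "(\<lambda>g :: nat \<Rightarrow> nat. g k) \<in> borel_measurable borel" by (rule measurable_product_coordinates)
      then have "(\<lambda>g :: nat \<Rightarrow> nat. g k) \<in> borel_measurable Sym_omega"
        unfolding Sym_omega_def by (rule measurable_restrict_space1)
      then show ?thesis
        using measurable_cong_sets[OF refl sets_borel_eq_count_space] by blast
    qed
    have "(\<lambda>g. inv g j) \<in> measurable Sym_omega (count_space UNIV)"
      unfolding measurable_count_space_eq2_countable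
    proof (intro conjI ballI funcsetI UNIV_I)
      fix k :: nat
      have "inv g j = k \<longleftrightarrow> g k = j" if "bij g" for g :: "nat \<Rightarrow> nat"
        using bij_inv_eq_iff[OF that, of k j] by auto
      then have "(\<lambda>g. inv g j) -` {k} \<inter> space Sym_omega = (\<lambda>g. g k) -` {j} \<inter> space Sym_omega"
        unfolding space_Sym_omega by auto
      also have "\<dots> \<in> sets Sym_omega" by (rule measurable_sets[OF coord]) simp
      finally show "(\<lambda>g. inv g j) -` {k} \<inter> space Sym_omega \<in> sets Sym_omega" .
    qed
    then show ?thesis using measurable_cong_sets[OF refl sets_borel_eq_count_space] by blast
  qed
  then have "inv \<in> borel_measurable Sym_omega"
    by (rule measurable_coordinatewise_then_product)
  then show ?thesis
        using measurable_restrict_space2[of inv Sym_omega "{g. bij g}" borel]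
    by (simp add: Sym_omega_def[symmetric] space_Sym_omega bij_imp_bij_inv)
qed

text \<open>Cylinders contain permutations only, so the other functions form a nowhere dense set.
  Borel sets can therefore be treated in the type of all functions, and cutting them down to
  permutations changes them by a meager set.\<close>

lemma Sym_omega_baire_property:
  assumes "A \<in> sets Sym_omega"
  shows "sym.baire_property A"
proof -
  define BM where "BM = sigma UNIV {A. sym.baire_property A}"
  have sets_BM: "sets BM = {A. sym.baire_property A}"
    unfolding BM_def
    using sigma_algebra.sets_measure_of_eq[OF sym.sigma_algebra_baire_property] by simp
  have space_BM: "space BM = UNIV" by (simp add: BM_def space_measure_of_conv)
  have "sym.nowhere_dense (- {g. bij g})"
    unfolding sym.nowhere_dense_def by (auto simp: sym_cyl_iff)
  then have nonbij: "sym.meager (- {g. bij g})" by (rule sym.nowhere_dense_imp_meager)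
  have "(\<lambda>g. g i) \<in> borel_measurable BM" for i :: nat
  proof -
    have "(\<lambda>g. g i) \<in> measurable BM (count_space UNIV)"
      unfolding measurable_count_space_eq2_countable
    proof (intro conjI ballI funcsetI UNIV_I)
      fix k :: nat
      define U where "U = (\<Union>s\<in>{s. i < length s \<and> s ! i = k}. sym.cyl s)"
      have "sym_diff U ((\<lambda>g. g i) -` {k}) \<subseteq> - {g. bij g}"
      proof
        fix g assume g: "g \<in> sym_diff U ((\<lambda>g. g i) -` {k})"
        show "g \<in> - {g. bij g}"
        proof
          assume "g \<in> {g. bij g}"
          then have *: "g \<in> sym.cyl (map g [0..<Suc i])" by (simp add: sym_cyl_iff del: upt_Suc)
          have "g \<in> U" if "g i = k"
            unfolding U_def
            by (rule UN_I[of "map g [0..<Suc i]"]) (use that * in \<open>simp_all del: upt_Suc\<close>)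
          moreover have "g i = k" if "g \<in> U" using that by (auto simp: U_def sym_cyl_iff)
          ultimately show False using g by auto
        qed
      qed
      then have "sym.meager (sym_diff U ((\<lambda>g. g i) -` {k}))"
        using sym.meager_subset[OF nonbij] by blast
      moreover have "sym.baire_property U"
        unfolding U_def by (intro sym.baire_property_UN sym.baire_property_base) simp
      ultimately have "sym.baire_property ((\<lambda>g. g i) -` {k})"
        using sym.baire_property_cong by blast
      then show "(\<lambda>g. g i) -` {k} \<inter> space BM \<in> sets BM" by (simp add: space_BM sets_BM)
    qed
    then show ?thesis using measurable_cong_sets[OF refl sets_borel_eq_count_space] by blast
  qed
  then have id: "(\<lambda>g. g) \<in> borel_measurable BM" by (rule measurable_coordinatewise_then_product)
  obtain C :: "(nat \<Rightarrow> nat) set" where C: "C \<in> sets borel" "A = {g. bij g} \<inter> C"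
    using assms by (auto simp: Sym_omega_def sets_restrict_space)
  have "(\<lambda>g. g) -` C \<inter> space BM \<in> sets BM" by (rule measurable_sets[OF id C(1)])
  then have "sym.baire_property C" by (simp add: space_BM sets_BM)
  moreover have "sym_diff C A \<subseteq> - {g. bij g}" using C(2) by blast
  ultimately show ?thesis using sym.baire_property_cong sym.meager_subset[OF nonbij] by blast
qed

text \<open>This is the complement step for Vaught transforms: nonmeagerness of a complement becomes
  a countable disjunction, over smaller cylinders, of meagerness of the set itself.\<close>

lemma nonmeager_Diff_iff:
  assumes "sym.baire_property C"
  shows "\<not> sym.meager (sym.cyl s - C) \<longleftrightarrow>
    (\<exists>t. sym.cyl t \<noteq> {} \<and> sym.cyl t \<subseteq> sym.cyl s \<and> sym.meager (C \<inter> sym.cyl t))"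
proof
  assume "\<not> sym.meager (sym.cyl s - C)"
  moreover have "sym.baire_property (sym.cyl s - C)"
    by (intro sym.baire_property_Diff sym.baire_property_base assms)
  ultimately obtain i where i: "sym.meager (sym.cyl i - (sym.cyl s - C))"
    "\<not> sym.meager (sym.cyl i \<inter> (sym.cyl s - C))"
    using sym.nonmeager_localize by blast
  have "sym.cyl i \<inter> (sym.cyl s - C) \<noteq> {}"
  proof
    assume "sym.cyl i \<inter> (sym.cyl s - C) = {}"
    with i(2) show False by simp
  qed
  then obtain x where "x \<in> sym.cyl i" "x \<in> sym.cyl s" by blast
  then obtain k where k: "x \<in> sym.cyl k" "sym.cyl k \<subseteq> sym.cyl i \<inter> sym.cyl s" using sym.base_Int by blast
  have "sym.meager (C \<inter> sym.cyl k)" by (rule sym.meager_subset[OF i(1)]) (use k(2) in blast)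
  then show "\<exists>t. sym.cyl t \<noteq> {} \<and> sym.cyl t \<subseteq> sym.cyl s \<and> sym.meager (C \<inter> sym.cyl t)"
    using k by blast
next
  assume "\<exists>t. sym.cyl t \<noteq> {} \<and> sym.cyl t \<subseteq> sym.cyl s \<and> sym.meager (C \<inter> sym.cyl t)"
  then obtain t where t: "sym.cyl t \<noteq> {}" "sym.cyl t \<subseteq> sym.cyl s" "sym.meager (C \<inter> sym.cyl t)" by blast
  show "\<not> sym.meager (sym.cyl s - C)"
  proof
    assume "sym.meager (sym.cyl s - C)"
    from sym.meager_Un[OF this t(3)] have "sym.meager (sym.cyl t)"
      by (rule sym.meager_subset) (use t(2) in blast)
    with sym_nonmeager[OF t(1)] show False by simp
  qed
qed

text \<open>The two claims are proved together by induction over the generation of the product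
  sigma-algebra: at complements, \<open>nonmeager_Diff_iff\<close> uses the Baire property of the
  sections, and the cylinders it quantifies over are countably many.\<close>

lemma vaught_transform:
  assumes "B \<in> sets (Sym_omega \<Otimes>\<^sub>M X)"
  shows "(\<forall>x\<in>space X. sym.baire_property {g. (g, x) \<in> B}) \<and>
    (\<forall>s. {x \<in> space X. \<not> sym.meager ({g. (g, x) \<in> B} \<inter> sym.cyl s)} \<in> sets X)"
  using assms unfolding sets_pair_measure
proof (induction rule: sigma_sets.induct)
  case (Basic B)
  then obtain A C where B: "B = A \<times> C" "A \<in> sets Sym_omega" "C \<in> sets X" by auto
  have "{g. (g, x) \<in> B} = (if x \<in> C then A else {})" for x using B(1) by auto
  moreover have "{x \<in> space X. \<not> sym.meager ((if x \<in> C then A else {}) \<inter> sym.cyl s)} =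
      (if sym.meager (A \<inter> sym.cyl s) then {} else C)" for s
    using sets.sets_into_space[OF B(3)] by auto
  ultimately show ?case
    using B Sym_omega_baire_property sym.baire_property_meager[OF sym.meager_empty] by auto
next
  case Empty
  then show ?case using sym.baire_property_meager[OF sym.meager_empty] by simp
next
  case (Compl B)
  define V where "V s = {x \<in> space X. \<not> sym.meager ({g. (g, x) \<in> B} \<inter> sym.cyl s)}" for s
  define Sec where "Sec x = {g. (g, x) \<in> B}" for x
  have BP: "sym.baire_property (Sec x)" if "x \<in> space X" for x using Compl.IH that by (simp add: Sec_def)
  have V: "V s \<in> sets X" for s using Compl.IH by (simp add: V_def)
  have sec: "{g. (g, x) \<in> space Sym_omega \<times> space X - B} = sym.cyl [] - Sec x" if "x \<in> space X" for x
    using that by (auto simp: space_Sym_omega Sec_def sym_cyl_iff)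
  have "{x \<in> space X. \<not> sym.meager ({g. (g, x) \<in> space Sym_omega \<times> space X - B} \<inter> sym.cyl s)} =
      (\<Union>t\<in>{t. sym.cyl t \<noteq> {} \<and> sym.cyl t \<subseteq> sym.cyl s}. space X - V t)" for s
  proof -
    have *: "\<not> sym.meager ({g. (g, x) \<in> space Sym_omega \<times> space X - B} \<inter> sym.cyl s) \<longleftrightarrow>
        (\<exists>t. sym.cyl t \<noteq> {} \<and> sym.cyl t \<subseteq> sym.cyl s \<and> x \<notin> V t)" if x: "x \<in> space X" for x
    proof -
      have "{g. (g, x) \<in> space Sym_omega \<times> space X - B} \<inter> sym.cyl s = sym.cyl s - Sec x"
        unfolding sec[OF x] by (auto simp: sym_cyl_iff)
      then show ?thesis
        using nonmeager_Diff_iff[OF BP[OF x], of s] x by (simp add: V_def Sec_def)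
    qed
    show ?thesis
    proof (rule set_eqI)
      fix x
      show "x \<in> {x \<in> space X. \<not> sym.meager ({g. (g, x) \<in> space Sym_omega \<times> space X - B} \<inter> sym.cyl s)} \<longleftrightarrow>
          x \<in> (\<Union>t\<in>{t. sym.cyl t \<noteq> {} \<and> sym.cyl t \<subseteq> sym.cyl s}. space X - V t)"
      proof (cases "x \<in> space X")
        case True
        then show ?thesis unfolding mem_Collect_eq *[OF True] by blast
      qed simp
    qed
  qed
  moreover have "(\<Union>t\<in>{t. sym.cyl t \<noteq> {} \<and> sym.cyl t \<subseteq> sym.cyl s}. space X - V t) \<in> sets X" for s
    using V by (intro sets.countable_UN' sets.compl_sets) auto
  moreover have "sym.baire_property {g. (g, x) \<in> space Sym_omega \<times> space X - B}" if "x \<in> space X" for x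
    unfolding sec[OF that] by (intro sym.baire_property_Diff sym.baire_property_base BP that)
  ultimately show ?case by simp
next
  case (Union B)
  have sec: "{g. (g, x) \<in> (\<Union>i. B i)} = (\<Union>i. {g. (g, x) \<in> B i})" for x by blast
  have "sym.meager ((\<Union>i. {g. (g, x) \<in> B i}) \<inter> sym.cyl s) \<longleftrightarrow>
      (\<forall>i. sym.meager ({g. (g, x) \<in> B i} \<inter> sym.cyl s))" for x s
  proof
    assume *: "sym.meager ((\<Union>i. {g. (g, x) \<in> B i}) \<inter> sym.cyl s)"
    show "\<forall>i. sym.meager ({g. (g, x) \<in> B i} \<inter> sym.cyl s)"
      by (intro allI sym.meager_subset[OF *]) blast
  next
    assume "\<forall>i. sym.meager ({g. (g, x) \<in> B i} \<inter> sym.cyl s)"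
    then have "sym.meager (\<Union>i. {g. (g, x) \<in> B i} \<inter> sym.cyl s)" by (intro sym.meager_UN) auto
    then show "sym.meager ((\<Union>i. {g. (g, x) \<in> B i}) \<inter> sym.cyl s)" by (rule sym.meager_subset) blast
  qed
  then have "{x \<in> space X. \<not> sym.meager ({g. (g, x) \<in> (\<Union>i. B i)} \<inter> sym.cyl s)} =
      (\<Union>i. {x \<in> space X. \<not> sym.meager ({g. (g, x) \<in> B i} \<inter> sym.cyl s)})" for s
    unfolding sec by blast
  moreover have "(\<Union>i. {x \<in> space X. \<not> sym.meager ({g. (g, x) \<in> B i} \<inter> sym.cyl s)}) \<in> sets X" for s
    using Union.IH by (intro sets.countable_UN) auto
  moreover have "sym.baire_property {g. (g, x) \<in> (\<Union>i. B i)}" if "x \<in> space X" for x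
    unfolding sec using Union.IH that by (intro sym.baire_property_UN) auto
  ultimately show ?case by simp
qed

text \<open>The separating sets are balls of radius \<open>1 / (n + 1)\<close> around the points of
  a countable dense set.\<close>

lemma standard_borel_separating:
  fixes X :: "'x measure"
  assumes "standard_borel X"
  shows "\<exists>A :: nat \<Rightarrow> 'x set. (\<forall>n. A n \<in> sets X) \<and>
    (\<forall>x\<in>space X. \<forall>y\<in>space X. (\<forall>n. x \<in> A n \<longleftrightarrow> y \<in> A n) \<longrightarrow> x = y)"
proof -
  obtain T where T: "topspace T = space X" "completely_metrizable_space T" "separable_space T"
    "sets X = sigma_sets (space X) {U. openin T U}"
    using assms by (auto simp: standard_borel_def)
  obtain M d where M: "Metric_space M d" "T = Metric_space.mtopology M d"
    using completely_metrizable_imp_metrizable_space[OF T(2)] by (auto simp: metrizable_space_def)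
  interpret Metric_space M d by (rule M(1))
  have M_eq: "M = space X" using T(1) M(2) by simp
  obtain C where C: "countable C" "C \<subseteq> M" "mtopology closure_of C = M"
    using T(3) unfolding M(2) separable_space_def by auto
  \<comment> \<open>The empty set is included so that \<open>S\<close> is nonempty, as
    \<open>from_nat_into\<close> requires, even if the space has no points.\<close>
  define S where "S = insert {} ((\<lambda>(c, n). mball c (inverse (real (Suc n)))) ` (C \<times> UNIV))"
  have S: "countable S" "S \<noteq> {}" unfolding S_def using C(1) by auto
  have sets_S: "U \<in> sets X" if "U \<in> S" for U
  proof -
    have "openin T U" using that by (auto simp: S_def M(2))
    then show ?thesis unfolding T(4) by (intro sigma_sets.Basic) simp
  qed
  show ?thesis
  proof (intro exI[of _ "from_nat_into S"] conjI allI ballI impI)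
    show "from_nat_into S n \<in> sets X" for n by (intro sets_S from_nat_into S(2))
    fix x y assume xy: "x \<in> space X" "y \<in> space X"
      and eq: "\<forall>n. x \<in> from_nat_into S n \<longleftrightarrow> y \<in> from_nat_into S n"
    have eq': "x \<in> U \<longleftrightarrow> y \<in> U" if "U \<in> S" for U
      using from_nat_into_surj[OF S(1) that] eq by blast
    show "x = y"
    proof (rule ccontr)
      assume "x \<noteq> y"
      then have "0 < d x y / 2" using xy M_eq by simp
      then obtain n where n: "inverse (real (Suc n)) < d x y / 2" using reals_Archimedean by blast
      have xyM: "x \<in> M" "y \<in> M" using xy M_eq by simp_all
      then have "x \<in> mtopology closure_of C" using C(3) by simp
      then have "\<forall>r>0. \<exists>c\<in>C. c \<in> mball x r" unfolding metric_closure_of by blast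
      moreover have "0 < inverse (real (Suc n))" by simp
      ultimately obtain c where c: "c \<in> C" "c \<in> mball x (inverse (real (Suc n)))" by blast
      then have cM: "c \<in> M" "d x c < inverse (real (Suc n))" by (simp_all only: in_mball)
      have "mball c (inverse (real (Suc n))) \<in> S" using c(1) by (force simp: S_def)
      moreover have "x \<in> mball c (inverse (real (Suc n)))"
        using cM xyM by (simp only: in_mball commute)
      ultimately have "y \<in> mball c (inverse (real (Suc n)))" using eq' by blast
      then have "d c y < inverse (real (Suc n))" by (simp add: in_mball)
      moreover have "d x y \<le> d x c + d c y" using triangle cM(1) xyM by simp
      ultimately show False using n cM(2) by linarith
    qed
  qed
qed

text \<open>Acting by \<open>g\<close> on \<open>x\<close> translates \<open>E x n\<close> by
  \<open>g\<close> and so relabels the cylinders by \<open>map g\<close>; hence points of one orbit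
  get isomorphic predicates. Conversely, \<open>\<rho> x = \<rho> y\<close> makes
  \<open>E x n\<close> and \<open>E y n\<close> equal up to meager sets for all \<open>n\<close>. By
  category some permutation \<open>g\<close> lies in none of the differences, and then
  \<open>inv g\<close> carries \<open>x\<close> and \<open>y\<close> to points that no
  \<open>A n\<close> separates.\<close>

theorem borel_action_reduces_to_list_iso:
  fixes X :: "'x measure"
  assumes X: "standard_borel X" and a: "borel_action X a"
  shows "\<exists>\<rho> :: 'x \<Rightarrow> nat list \<Rightarrow> bool. (\<forall>t. Measurable.pred X (\<lambda>x. \<rho> x t)) \<and>
    (\<forall>x\<in>space X. \<forall>y\<in>space X. orbit_rel a x y \<longleftrightarrow> list_iso (\<rho> x) (\<rho> y))"
proof -
  obtain A :: "nat \<Rightarrow> 'x set" where A: "\<And>n. A n \<in> sets X"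
    "\<And>x y. x \<in> space X \<Longrightarrow> y \<in> space X \<Longrightarrow> (\<And>n. x \<in> A n \<longleftrightarrow> y \<in> A n) \<Longrightarrow> x = y"
    using standard_borel_separating[OF X] by metis
  have a_meas: "(\<lambda>(g, x). a g x) \<in> measurable (Sym_omega \<Otimes>\<^sub>M X) X"
    and a_id: "\<And>x. x \<in> space X \<Longrightarrow> a id x = x"
    and a_comp: "\<And>g h x. bij g \<Longrightarrow> bij h \<Longrightarrow> x \<in> space X \<Longrightarrow> a (g \<circ> h) x = a g (a h x)"
    using a by (auto simp: borel_action_def)
  have a_space: "a g x \<in> space X" if "bij g" "x \<in> space X" for g x
    using measurable_space[OF a_meas, of "(g, x)"] that by (simp add: space_pair_measure space_Sym_omega)
  \<comment> \<open>The inverse turns the action on \<open>x\<close> into left translation of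
    \<open>E x n\<close>.\<close>
  define E where "E x n = {g. bij g \<and> a (inv g) x \<in> A n}" for x n
  have ainv_meas: "(\<lambda>(g, x). a (inv g) x) \<in> measurable (Sym_omega \<Otimes>\<^sub>M X) X"
  proof -
    have "(\<lambda>p. (inv (fst p), snd p)) \<in> measurable (Sym_omega \<Otimes>\<^sub>M X) (Sym_omega \<Otimes>\<^sub>M X)"
      by (intro measurable_Pair measurable_compose[OF measurable_fst measurable_inv_Sym_omega] measurable_snd)
    from measurable_compose[OF this a_meas] show ?thesis by (simp add: case_prod_beta)
  qed
  define B where "B n = (\<lambda>(g, x). a (inv g) x) -` A n \<inter> space (Sym_omega \<Otimes>\<^sub>M X)" for n
  have B: "B n \<in> sets (Sym_omega \<Otimes>\<^sub>M X)" for n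
    unfolding B_def by (rule measurable_sets[OF ainv_meas A(1)])
  have E_B: "{g. (g, x) \<in> B n} = E x n" if "x \<in> space X" for x n
    using that by (auto simp: B_def E_def space_pair_measure space_Sym_omega)
  have E_BP: "sym.baire_property (E x n)" if "x \<in> space X" for x n
    using vaught_transform[OF B[of n]] E_B that by auto
  txt \<open>
    Since \<open>\<phi>\<close> takes every value infinitely often, the cylinders over sequences \<open>t\<close> with
    \<open>\<phi> (length t) = n\<close> still form a basis. This lets one predicate of sequences record all \<open>A n\<close>.
  \<close>
  define \<phi> where "\<phi> n = fst (prod_decode n)" for n
  have \<phi>: "\<exists>l\<ge>m. \<phi> l = n" for m n
    by (rule exI[of _ "prod_encode (n, m)"]) (simp add: \<phi>_def le_prod_encode_2)
  define \<rho> where "\<rho> x t \<longleftrightarrow> \<not> sym.meager (E x (\<phi> (length t)) \<inter> sym.cyl t)" for x t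
  have meas: "Measurable.pred X (\<lambda>x. \<rho> x t)" for t
  proof -
    have "{x \<in> space X. \<rho> x t} =
        {x \<in> space X. \<not> sym.meager ({g. (g, x) \<in> B (\<phi> (length t))} \<inter> sym.cyl t)}"
      using E_B by (auto simp: \<rho>_def)
    then show ?thesis using vaught_transform[OF B] by (simp add: pred_def)
  qed
  have equiv: "\<rho> (a g x) (map g t) \<longleftrightarrow> \<rho> x t" if g: "bij g" and x: "x \<in> space X" for g x t
  proof -
    define n where "n = \<phi> (length t)"
    have [simp]: "inv g (g k) = k" "g (inv g k) = k" for k
      using g by (simp_all add: bij_is_inj bij_is_surj surj_f_inv_f)
    have 1: "E (a g x) n \<inter> sym.cyl (map g t) = (\<lambda>h. inv g \<circ> h) -` (E x n \<inter> sym.cyl t)"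
    proof (intro set_eqI)
      fix h :: "nat \<Rightarrow> nat"
      have bij: "bij (inv g \<circ> h) \<longleftrightarrow> bij h"
      proof
        assume "bij (inv g \<circ> h)"
        then have "bij (g \<circ> (inv g \<circ> h))" using g by (rule bij_comp)
        moreover have "g \<circ> (inv g \<circ> h) = h" by (simp add: fun_eq_iff)
        ultimately show "bij h" by simp
      qed (simp add: bij_comp g bij_imp_bij_inv)
      have "a (inv (inv g \<circ> h)) x = a (inv h) (a g x)" if "bij h"
      proof -
        have "inv (inv g \<circ> h) = inv h \<circ> g"
          using o_inv_distrib[OF bij_imp_bij_inv[OF g] that] inv_inv_eq[OF g] by simp
        then show ?thesis using a_comp[OF bij_imp_bij_inv[OF that] g x] by simp
      qed
      moreover have "(\<forall>i<length t. h i = g (t ! i)) \<longleftrightarrow> (\<forall>i<length t. inv g (h i) = t ! i)"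
        using bij_inv_eq_iff[OF g] by metis
      ultimately show "h \<in> E (a g x) n \<inter> sym.cyl (map g t) \<longleftrightarrow>
          h \<in> (\<lambda>h. inv g \<circ> h) -` (E x n \<inter> sym.cyl t)"
        using bij by (auto simp: E_def sym_cyl_iff)
    qed
    have 2: "E x n \<inter> sym.cyl t = (\<lambda>h. g \<circ> h) -` (E (a g x) n \<inter> sym.cyl (map g t))"
    proof -
      have "inv g \<circ> (g \<circ> h) = h" for h :: "nat \<Rightarrow> nat" by (simp add: fun_eq_iff)
      then show ?thesis unfolding 1 by (auto simp: vimage_def)
    qed
    have "sym.meager (E (a g x) n \<inter> sym.cyl (map g t)) \<longleftrightarrow> sym.meager (E x n \<inter> sym.cyl t)"
    proof
      assume "sym.meager (E (a g x) n \<inter> sym.cyl (map g t))"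
      from sym_meager_translate[OF this g] show "sym.meager (E x n \<inter> sym.cyl t)" by (simp only: 2)
    next
      assume "sym.meager (E x n \<inter> sym.cyl t)"
      from sym_meager_translate[OF this bij_imp_bij_inv[OF g]]
      show "sym.meager (E (a g x) n \<inter> sym.cyl (map g t))" by (simp only: 1)
    qed
    then show ?thesis by (simp add: \<rho>_def n_def)
  qed
  have diff: "sym.meager (E x n - E y n)"
    if x: "x \<in> space X" and y: "y \<in> space X" and eq: "\<rho> x = \<rho> y" for x y n
  proof (rule ccontr)
    assume "\<not> sym.meager (E x n - E y n)"
    moreover have "sym.baire_property (E x n - E y n)" by (intro sym.baire_property_Diff E_BP x y)
    ultimately obtain s where s: "sym.meager (sym.cyl s - (E x n - E y n))"
      "\<not> sym.meager (sym.cyl s \<inter> (E x n - E y n))"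
      using sym.nonmeager_localize by blast
    have "sym.cyl s \<noteq> {}"
    proof
      assume "sym.cyl s = {}"
      with s(2) show False by simp
    qed
    then obtain g where g: "g \<in> sym.cyl s" by blast
    obtain l where l: "l \<ge> length s" "\<phi> l = n" using \<phi> by blast
    define t where "t = map g [0..<l]"
    have "sym.cyl t \<noteq> {}" using g by (auto simp: t_def sym_cyl_iff)
    moreover have sub: "sym.cyl t \<subseteq> sym.cyl s" using g l(1) by (auto simp: t_def sym_cyl_iff)
    ultimately have nm: "\<not> sym.meager (sym.cyl t)" using sym_nonmeager by blast
    have "\<rho> x t"
    proof (rule ccontr)
      assume "\<not> \<rho> x t"
      then have "sym.meager (E x n \<inter> sym.cyl t)" by (simp add: \<rho>_def t_def l(2))
      from sym.meager_Un[OF this s(1)] have "sym.meager (sym.cyl t)"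
        by (rule sym.meager_subset) (use sub in blast)
      with nm show False by simp
    qed
    moreover have "\<not> \<rho> y t"
    proof -
      have "sym.meager (E y n \<inter> sym.cyl t)"
        by (rule sym.meager_subset[OF s(1)]) (use sub in blast)
      then show ?thesis by (simp add: \<rho>_def t_def l(2))
    qed
    ultimately show False using eq by simp
  qed
  have inj: "x = y" if x: "x \<in> space X" and y: "y \<in> space X" and eq: "\<rho> x = \<rho> y" for x y
  proof -
    have "sym.meager (\<Union>n. (E x n - E y n) \<union> (E y n - E x n))"
      by (intro sym.meager_UN_nat sym.meager_Un diff x y eq eq[symmetric])
    moreover have "\<not> sym.meager (sym.cyl [])"
    proof (rule sym_nonmeager)
      have "id \<in> sym.cyl []" by (simp add: sym_cyl_iff)
      then show "sym.cyl [] \<noteq> {}" by blast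
    qed
    ultimately have "\<not> sym.cyl [] \<subseteq> (\<Union>n. (E x n - E y n) \<union> (E y n - E x n))"
      using sym.meager_subset by blast
    then obtain g where g0: "g \<in> sym.cyl []" "g \<notin> (\<Union>n. (E x n - E y n) \<union> (E y n - E x n))" by blast
    have g: "bij g" using g0(1) by (simp add: sym_cyl_iff)
    have gE: "g \<in> E x n \<longleftrightarrow> g \<in> E y n" for n using g0(2) by blast
    have ig: "bij (inv g)" by (rule bij_imp_bij_inv[OF g])
    have "a (inv g) x \<in> A n \<longleftrightarrow> a (inv g) y \<in> A n" for n
      using gE[of n] g by (simp add: E_def)
    then have "a (inv g) x = a (inv g) y" by (intro A(2) a_space ig x y)
    then have "a (g \<circ> inv g) x = a (g \<circ> inv g) y" by (simp add: a_comp g ig x y)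
    moreover have "g \<circ> inv g = id" using g by (metis bij_is_surj surj_iff)
    ultimately show "x = y" by (simp add: a_id x y)
  qed
  have "orbit_rel a x y \<longleftrightarrow> list_iso (\<rho> x) (\<rho> y)" if x: "x \<in> space X" and y: "y \<in> space X" for x y
  proof
    assume "orbit_rel a x y"
    then obtain g where "bij g" "a g x = y" by (auto simp: orbit_rel_def)
    then show "list_iso (\<rho> x) (\<rho> y)" using equiv x by (auto simp: list_iso_def)
  next
    assume "list_iso (\<rho> x) (\<rho> y)"
    then obtain g where g: "bij g" "\<And>t. \<rho> x t \<longleftrightarrow> \<rho> y (map g t)" by (auto simp: list_iso_def)
    have "\<rho> y t = \<rho> (a g x) t" for t
    proof -
      have t: "t = map g (map (inv g) t)" using g(1) by (metis bij_is_surj list.map_comp list.map_id surj_iff)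
      show ?thesis by (subst (1 2) t) (simp only: g(2)[symmetric] equiv[OF g(1) x])
    qed
    then have "\<rho> y = \<rho> (a g x)" by (rule ext)
    then have "y = a g x" by (rule inj[OF y a_space[OF g(1) x]])
    then show "orbit_rel a x y" using g(1) by (auto simp: orbit_rel_def)
  qed
  with meas show ?thesis by blast
qed

section \<open>Configurations\<close>

text \<open>A number \<open>d\<close> is read as the finite set of its bits, and a list with head
  \<open>d\<close> compares \<open>x\<close> with \<open>d\<close> at the position given by the
  length of the tail. An isomorphism \<open>g\<close> forces \<open>x\<close> and \<open>y\<close>
  to differ exactly at the bits of \<open>g 0\<close>, which are finitely many. Conversely, if the
  bits of \<open>e\<close> are the places where \<open>x\<close> and \<open>y\<close> differ, then
  \<open>xor\<close> with \<open>e\<close> is an isomorphism.\<close>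

lemma E0_reduces_to_list_iso:
  defines "\<rho> \<equiv> \<lambda>(x :: nat \<Rightarrow> bool) t. case t of [] \<Rightarrow> False | d # u \<Rightarrow> x (length u) \<noteq> bit d (length u)"
  shows "list_iso (\<rho> x) (\<rho> y) \<longleftrightarrow> E0 x y"
proof
  assume "list_iso (\<rho> x) (\<rho> y)"
  then obtain g where g: "\<And>t. \<rho> x t \<longleftrightarrow> \<rho> y (map g t)" by (auto simp: list_iso_def)
  have *: "x n \<longleftrightarrow> (y n \<noteq> bit (g 0) n)" for n
    using g[of "replicate (Suc n) 0"] by (simp add: \<rho>_def)
  have "\<not> bit (g 0) n" if "g 0 < n" for n
  proof -
    have "g 0 < 2 ^ n" using that less_exp[of n] by linarith
    then show ?thesis by (simp add: bit_iff_odd)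
  qed
  then have "{n. x n \<noteq> y n} \<subseteq> {..g 0}" using * by (auto simp: not_less)
  then show "E0 x y" unfolding E0_def using finite_subset by blast
next
  assume "E0 x y"
  then have "finite {n. x n \<noteq> y n}" by (simp add: E0_def)
  moreover have "\<exists>e :: nat. \<forall>n. bit e n \<longleftrightarrow> n \<in> F" if "finite F" for F
    using that
  proof induction
    case empty
    then show ?case by (intro exI[of _ 0]) simp
  next
    case (insert k F)
    then obtain e :: nat where "\<forall>n. bit e n \<longleftrightarrow> n \<in> F" by blast
    then show ?case by (intro exI[of _ "set_bit k e"]) (auto simp: bit_set_bit_iff)
  qed
  ultimately obtain e :: nat where "\<forall>n. bit e n \<longleftrightarrow> n \<in> {n. x n \<noteq> y n}" by blast
  then have e: "bit e n \<longleftrightarrow> x n \<noteq> y n" for n by simp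
  define g where "g d = xor e d" for d
  have gg: "g (g d) = d" for d by (rule bit_eqI) (auto simp: g_def bit_xor_iff)
  then have "bij g" by (intro o_bij[of g]) (simp_all add: fun_eq_iff)
  moreover have "\<rho> x t \<longleftrightarrow> \<rho> y (map g t)" for t
    by (cases t) (auto simp: \<rho>_def g_def bit_xor_iff e)
  ultimately show "list_iso (\<rho> x) (\<rho> y)" by (auto simp: list_iso_def)
qed

section \<open>Configurations as bipartite graphs\<close>

record 'v config =
  cells :: "'v set"
  side :: "'v \<Rightarrow> bool"
  adj :: "'v \<Rightarrow> 'v \<Rightarrow> bool"

text \<open>The last condition excludes cycles of length four, that is, two points on two common
  lines. Adjacency is symmetric, so that an argument about points also serves for lines.\<close>

definition configuration :: "'v config \<Rightarrow> bool" where
  "configuration C \<longleftrightarrow>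
     (\<forall>u v. adj C u v \<longrightarrow> u \<in> cells C \<and> v \<in> cells C \<and> side C u \<noteq> side C v \<and> adj C v u) \<and>
     (\<forall>x y z w. adj C x z \<and> adj C y z \<and> adj C x w \<and> adj C y w \<longrightarrow> x = y \<or> z = w)"

definition config_embed :: "'v config \<Rightarrow> 'w config \<Rightarrow> ('v \<Rightarrow> 'w) \<Rightarrow> bool" where
  "config_embed C C' h \<longleftrightarrow> (\<forall>u\<in>cells C. side C u \<longleftrightarrow> side C' (h u)) \<and>
     (\<forall>u\<in>cells C. \<forall>v\<in>cells C. adj C u v \<longleftrightarrow> adj C' (h u) (h v))"

definition config_iso :: "'v config \<Rightarrow> 'w config \<Rightarrow> bool" where
  "config_iso C C' \<longleftrightarrow> (\<exists>h. bij_betw h (cells C) (cells C') \<and> config_embed C C' h)"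

lemma configurationD:
  assumes "configuration C"
  shows config_cells: "adj C u v \<Longrightarrow> u \<in> cells C" "adj C u v \<Longrightarrow> v \<in> cells C"
    and config_side: "adj C u v \<Longrightarrow> side C u \<noteq> side C v"
    and config_sym: "adj C u v \<Longrightarrow> adj C v u"
    and config_linear: "adj C x z \<Longrightarrow> adj C y z \<Longrightarrow> adj C x w \<Longrightarrow> adj C y w \<Longrightarrow> x = y \<or> z = w"
  using assms unfolding configuration_def by blast+

text \<open>Listing the cells in increasing order of their codes is a canonical renaming to
  \<omega>, which makes \<open>to_struct\<close> measurable in the configuration.\<close>

definition enum :: "'v::countable config \<Rightarrow> nat \<Rightarrow> 'v" where
  "enum C n = from_nat (enumerate (to_nat ` cells C) n)"

definition to_struct :: "'v::countable config \<Rightarrow> struct" where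
  "to_struct C = (\<lambda>n. side C (enum C n), \<lambda>n. \<not> side C (enum C n),
     \<lambda>(m, n). side C (enum C m) \<and> \<not> side C (enum C n) \<and> adj C (enum C m) (enum C n))"

lemma bij_enum:
  assumes "infinite (cells C)"
  shows "bij_betw (enum C) UNIV (cells C)"
proof -
  have "infinite (to_nat ` cells C)" using assms finite_imageD[of to_nat "cells C"] by auto
  then have 1: "bij_betw (enumerate (to_nat ` cells C)) UNIV (to_nat ` cells C)" by (rule bij_enumerate)
  have "bij_betw from_nat (to_nat ` cells C) (cells C)"
    by (rule bij_betw_byWitness[where f' = to_nat]) auto
  from bij_betw_trans[OF 1 this] show ?thesis by (simp add: enum_def[abs_def] comp_def)
qed

lemma to_struct_simps [simp]:
  "pt (to_struct C) n \<longleftrightarrow> side C (enum C n)"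
  "ln (to_struct C) n \<longleftrightarrow> \<not> side C (enum C n)"
  "inc (to_struct C) m n \<longleftrightarrow> side C (enum C m) \<and> \<not> side C (enum C n) \<and> adj C (enum C m) (enum C n)"
  by (simp_all add: to_struct_def pt_def ln_def inc_def)

lemma struct_iso_to_struct_iff:
  assumes C: "configuration C" "infinite (cells C)" and C': "configuration C'" "infinite (cells C')"
  shows "struct_iso (to_struct C) (to_struct C') \<longleftrightarrow> config_iso C C'"
proof
  have e: "bij_betw (enum C) UNIV (cells C)" "bij_betw (enum C') UNIV (cells C')"
    using bij_enum C(2) C'(2) by blast+
  have mem: "enum C n \<in> cells C" "enum C' n \<in> cells C'" for n
    using e by (auto simp: bij_betw_def)
  {
    assume "struct_iso (to_struct C) (to_struct C')"
    then obtain g where g: "bij g" "\<And>x. pt (to_struct C) x \<longleftrightarrow> pt (to_struct C') (g x)"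
      "\<And>x y. inc (to_struct C) x y \<longleftrightarrow> inc (to_struct C') (g x) (g y)"
      unfolding struct_iso_def by blast
    define h where "h v = enum C' (g (inv_into UNIV (enum C) v))" for v
    have h_enum: "h (enum C n) = enum C' (g n)" for n
      using e(1) by (simp add: h_def bij_betw_def)
    have all: "(\<forall>v\<in>cells C. P v) \<longleftrightarrow> (\<forall>n. P (enum C n))" for P
      using bij_betw_imp_surj_on[OF e(1)] by (metis imageE rangeI)
    have "bij_betw (enum C' \<circ> g \<circ> inv_into UNIV (enum C)) (cells C) (cells C')"
      by (intro bij_betw_trans[OF bij_betw_inv_into[OF e(1)]] bij_betw_trans[OF g(1)] e(2))
    then have "bij_betw h (cells C) (cells C')" by (simp add: h_def[abs_def] comp_def)
    moreover have side: "side C (enum C n) \<longleftrightarrow> side C' (enum C' (g n))" for n using g(2)[of n] by simp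
    moreover have "adj C (enum C m) (enum C n) \<longleftrightarrow> adj C' (enum C' (g m)) (enum C' (g n))" for m n
    proof -
      have 1: "adj C (enum C m) (enum C n) \<longleftrightarrow> inc (to_struct C) m n \<or> inc (to_struct C) n m" for m n
        using config_side[OF C(1), of "enum C m" "enum C n"] config_sym[OF C(1)] by auto
      have 2: "adj C' (enum C' m) (enum C' n) \<longleftrightarrow> inc (to_struct C') m n \<or> inc (to_struct C') n m" for m n
        using config_side[OF C'(1), of "enum C' m" "enum C' n"] config_sym[OF C'(1)] by auto
      show ?thesis unfolding 1 2 g(3) ..
    qed
    ultimately show "config_iso C C'"
      unfolding config_iso_def config_embed_def all h_enum by (intro exI[of _ h]) (simp add: h_enum)
  next
    assume "config_iso C C'"
    then obtain h where h: "bij_betw h (cells C) (cells C')"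
      "\<And>u. u \<in> cells C \<Longrightarrow> side C u \<longleftrightarrow> side C' (h u)"
      "\<And>u v. u \<in> cells C \<Longrightarrow> v \<in> cells C \<Longrightarrow> adj C u v \<longleftrightarrow> adj C' (h u) (h v)"
      unfolding config_iso_def config_embed_def by blast
    define g where "g n = inv_into UNIV (enum C') (h (enum C n))" for n
    have "bij (inv_into UNIV (enum C') \<circ> (h \<circ> enum C))"
      by (rule bij_betw_trans[OF bij_betw_trans[OF e(1) h(1)] bij_betw_inv_into[OF e(2)]])
    then have "bij g" by (simp add: g_def[abs_def] comp_def)
    moreover have "enum C' (g n) = h (enum C n)" for n
      using mem(1)[of n] h(1) e(2) unfolding g_def
      by (intro f_inv_into_f) (auto simp: bij_betw_def)
    ultimately show "struct_iso (to_struct C) (to_struct C')"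
      unfolding struct_iso_def using h(2,3)[OF mem(1)] mem(1)
      by (intro exI[of _ g]) auto
  }
qed

lemma plane_to_struct:
  assumes C: "configuration C" "infinite (cells C)"
    and join: "\<And>p q. p \<in> cells C \<Longrightarrow> q \<in> cells C \<Longrightarrow> side C p \<Longrightarrow> side C q \<Longrightarrow> p \<noteq> q \<Longrightarrow>
      \<exists>l. adj C p l \<and> adj C q l"
    and two: "\<And>l. l \<in> cells C \<Longrightarrow> \<not> side C l \<Longrightarrow> \<exists>p q. p \<noteq> q \<and> adj C p l \<and> adj C q l"
    and tri: "p0 \<in> cells C" "q0 \<in> cells C" "r0 \<in> cells C" "side C p0" "side C q0" "side C r0"
      "distinct [p0, q0, r0]" "\<And>l. \<not> (adj C p0 l \<and> adj C q0 l \<and> adj C r0 l)"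
  shows "plane (to_struct C)"
proof -
  define e where "e = enum C"
  have e: "bij_betw e UNIV (cells C)" unfolding e_def by (rule bij_enum[OF C(2)])
  have mem: "e n \<in> cells C" for n using e by (auto simp: bij_betw_def)
  have inj: "e m = e n \<longleftrightarrow> m = n" for m n using e by (auto simp: bij_betw_def inj_on_def)
  have surj: "\<exists>n. e n = v" if "v \<in> cells C" for v
    using bij_betw_imp_surj_on[OF e] that by (metis imageE)
  have inc: "inc (to_struct C) p l \<longleftrightarrow> side C (e p) \<and> adj C (e p) (e l)" for p l
    using config_side[OF C(1)] by (auto simp: e_def)
  have lin: "p = q \<or> l = l'" if "adj C (e p) (e l)" "adj C (e q) (e l)" "adj C (e p) (e l')" "adj C (e q) (e l')"
    for p q l l'
    using config_linear[OF C(1) that] inj by blast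
  obtain p q r where pqr: "e p = p0" "e q = q0" "e r = r0" using surj tri by metis
  show ?thesis
    unfolding plane_def
  proof (intro conjI allI impI)
    fix p q assume pq: "pt (to_struct C) p \<and> pt (to_struct C) q \<and> p \<noteq> q"
    then obtain l where l: "adj C (e p) l" "adj C (e q) l"
      using join[OF mem mem, of p q] inj by (auto simp: e_def)
    obtain n where "e n = l" using surj config_cells(2)[OF C(1) l(1)] by blast
    then have "ln (to_struct C) n \<and> inc (to_struct C) p n \<and> inc (to_struct C) q n"
      using l config_side[OF C(1) l(1)] pq unfolding inc by (auto simp: e_def)
    then show "\<exists>!l. ln (to_struct C) l \<and> inc (to_struct C) p l \<and> inc (to_struct C) q l"
      using lin pq unfolding inc by (intro ex_ex1I) blast+
  next
    fix l l' p q
    assume "ln (to_struct C) l \<and> ln (to_struct C) l' \<and> l \<noteq> l'"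
      "inc (to_struct C) p l \<and> inc (to_struct C) p l' \<and> inc (to_struct C) q l \<and> inc (to_struct C) q l'"
    then show "p = q" using lin unfolding inc by blast
  next
    fix l assume "ln (to_struct C) l"
    then obtain p q where pq: "p \<noteq> q" "adj C p (e l)" "adj C q (e l)" "\<not> side C (e l)"
      using two[OF mem, of l] by (auto simp: e_def)
    obtain m n where "e m = p" "e n = q" using surj config_cells(1)[OF C(1)] pq by metis
    then show "\<exists>p q. p \<noteq> q \<and> inc (to_struct C) p l \<and> inc (to_struct C) q l"
      using pq config_side[OF C(1)] unfolding inc by (intro exI[of _ m] exI[of _ n]) auto
  next
    show "\<exists>p q r. pt (to_struct C) p \<and> pt (to_struct C) q \<and> pt (to_struct C) r \<and> distinct [p, q, r] \<and>
        \<not> collinear_pts (to_struct C) p q r"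
    proof (intro exI conjI)
      show "pt (to_struct C) p" "pt (to_struct C) q" "pt (to_struct C) r"
        using pqr tri by (simp_all add: e_def)
      show "distinct [p, q, r]" using pqr tri(7) by auto
      show "\<not> collinear_pts (to_struct C) p q r"
        using tri(8) pqr unfolding collinear_pts_def inc by blast
    qed
  qed (auto simp: inc e_def)
qed

lemma projective_to_struct:
  assumes C: "configuration C" "infinite (cells C)" and plane: "plane (to_struct C)"
    and meet: "\<And>l l'. l \<in> cells C \<Longrightarrow> l' \<in> cells C \<Longrightarrow> \<not> side C l \<Longrightarrow> \<not> side C l' \<Longrightarrow> l \<noteq> l' \<Longrightarrow>
      \<exists>p. adj C p l \<and> adj C p l'"
  shows "projective (to_struct C)"
  unfolding projective_def
proof (intro conjI plane allI impI)
  have e: "bij_betw (enum C) UNIV (cells C)" by (rule bij_enum[OF C(2)])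
  have mem: "enum C n \<in> cells C" for n using e by (auto simp: bij_betw_def)
  have inj: "enum C m = enum C n \<longleftrightarrow> m = n" for m n using e by (auto simp: bij_betw_def inj_on_def)
  have surj: "\<exists>n. enum C n = v" if "v \<in> cells C" for v
    using bij_betw_imp_surj_on[OF e] that by (metis imageE)
  fix l l' assume ll: "ln (to_struct C) l \<and> ln (to_struct C) l' \<and> l \<noteq> l'"
  then obtain p where p: "adj C p (enum C l)" "adj C p (enum C l')"
    using meet[OF mem mem, of l l'] inj by auto
  obtain n where "enum C n = p" using surj config_cells(1)[OF C(1) p(1)] by blast
  then have "pt (to_struct C) n \<and> inc (to_struct C) n l \<and> inc (to_struct C) n l'"
    using p ll config_side[OF C(1) p(1)] by auto
  moreover have "m = n" if "inc (to_struct C) m l" "inc (to_struct C) m l'"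
    "inc (to_struct C) n l" "inc (to_struct C) n l'" for m n
    using plane ll that unfolding plane_def by blast
  ultimately show "\<exists>!p. pt (to_struct C) p \<and> inc (to_struct C) p l \<and> inc (to_struct C) p l'"
    by (intro ex_ex1I) blast+
qed

text \<open>By induction on \<open>n\<close>, the statement that \<open>k\<close> is the code of the
  \<open>n\<close>-th cell is a countable combination of statements that certain cells are
  present.\<close>

lemma borel_measurable_to_struct:
  fixes C :: "'a \<Rightarrow> 'v::countable config"
  assumes [measurable]: "\<And>v. Measurable.pred M (\<lambda>x. v \<in> cells (C x))"
    "\<And>v. Measurable.pred M (\<lambda>x. side (C x) v)" "\<And>u v. Measurable.pred M (\<lambda>x. adj (C x) u v)"
    and inf: "\<And>x. infinite (cells (C x))"
  shows "(\<lambda>x. to_struct (C x)) \<in> borel_measurable M"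
proof -
  define D where "D x = to_nat ` cells (C x)" for x
  have D_inf: "infinite (D x)" for x
    using inf[of x] finite_imageD[of to_nat "cells (C x)"] by (auto simp: D_def)
  have D_iff: "k \<in> D x \<longleftrightarrow> (\<exists>v. v \<in> cells (C x) \<and> to_nat v = k)" for k x
    by (auto simp: D_def)
  have [measurable]: "Measurable.pred M (\<lambda>x. k \<in> D x)" for k
    unfolding D_iff by measurable
  have [measurable]: "Measurable.pred M (\<lambda>x. enumerate (D x) n = k)" for n k
  proof (induction n arbitrary: k)
    case 0
    have eq: "enumerate (D x) 0 = k \<longleftrightarrow> k \<in> D x \<and> (\<forall>j<k. j \<notin> D x)" for x
    proof -
      have "D x \<noteq> {}" using D_inf[of x] by auto
      then show ?thesis
        unfolding enumerate_0
        by (metis LeastI_ex Least_equality equals0I leI not_less_Least)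
    qed
    show ?case unfolding eq by measurable
  next
    case (Suc n)
    note [measurable] = Suc.IH
    have eq: "enumerate (D x) (Suc n) = k \<longleftrightarrow> (\<exists>i. enumerate (D x) n = i \<and> i < k \<and> k \<in> D x \<and>
        (\<forall>j<k. i < j \<longrightarrow> j \<notin> D x))" for x
    proof -
      define i where "i = enumerate (D x) n"
      have "\<exists>s. s \<in> D x \<and> i < s" using D_inf[of x] by (auto simp: infinite_nat_iff_unbounded)
      then have "(LEAST s. s \<in> D x \<and> i < s) \<in> D x" "i < (LEAST s. s \<in> D x \<and> i < s)"
        using LeastI_ex[of "\<lambda>s. s \<in> D x \<and> i < s"] by blast+
      moreover have "(LEAST s. s \<in> D x \<and> i < s) = k"
        if "i < k" "k \<in> D x" "\<forall>j<k. i < j \<longrightarrow> j \<notin> D x"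
      proof (rule Least_equality)
        fix y assume "y \<in> D x \<and> i < y"
        with that(3) show "k \<le> y" by (metis leI)
      qed (use that in simp)
      ultimately have "(LEAST s. s \<in> D x \<and> i < s) = k \<longleftrightarrow>
          i < k \<and> k \<in> D x \<and> (\<forall>j<k. i < j \<longrightarrow> j \<notin> D x)"
        using not_less_Least[of _ "\<lambda>s. s \<in> D x \<and> i < s"] by metis
      then show ?thesis using enumerate_Suc''[OF D_inf[of x], of n] by (simp add: i_def)
    qed
    show ?case unfolding eq by measurable
  qed
  have enum: "enum (C x) n = from_nat (enumerate (D x) n)" for x n by (simp add: enum_def D_def)
  have e: "P (enum (C x) n) \<longleftrightarrow> (\<exists>k. enumerate (D x) n = k \<and> P (from_nat k))" for P x n
    by (simp add: enum)
  have pt: "Measurable.pred M (\<lambda>x. side (C x) (enum (C x) n))" for n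
    unfolding e[of "side (C _)"] by measurable
  have adj: "Measurable.pred M (\<lambda>x. adj (C x) (enum (C x) m) (enum (C x) n))" for m n
  proof -
    have eq: "adj (C x) (enum (C x) m) (enum (C x) n) \<longleftrightarrow> (\<exists>k j. enumerate (D x) m = k \<and> enumerate (D x) n = j \<and>
        adj (C x) (from_nat k) (from_nat j))" for x by (simp add: enum)
    show ?thesis unfolding eq by measurable
  qed
  note [measurable] = pt adj
  show ?thesis
    unfolding borel_measurable_struct_iff to_struct_simps by (intro conjI allI; measurable)
qed

section \<open>The configuration of a list structure\<close>

text \<open>\<open>Elt\<close> and \<open>Tup\<close> index the lines \<open>Vx\<close>, for numbers
  and for sequences; the other constructors of \<open>cell\<close> are points.
  \<open>Par a t\<close> ties \<open>a # t\<close> to its tail, \<open>Las a t\<close> ties it to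
  its head, and \<open>Prv\<close> gives the private points.\<close>

datatype vtx = Elt nat | Tup "nat list"
datatype cell = Vx vtx | Par nat "nat list" | Las nat "nat list" | Prv vtx nat

instance vtx :: countable by countable_datatype
instance cell :: countable by countable_datatype

text \<open>Three marks the numbers, larger values the sequences: of the excess over four, the half
  is the length and the parity tells membership in \<open>R\<close>. No value is below three, so
  every line has more points than a trivial one.\<close>

fun num :: "(nat list \<Rightarrow> bool) \<Rightarrow> vtx \<Rightarrow> nat" where
  "num R (Elt a) = 3"
| "num R (Tup t) = 4 + 2 * length t + (if R t then 1 else 0)"

fun on :: "cell \<Rightarrow> vtx \<Rightarrow> bool" where
  "on (Vx _) v \<longleftrightarrow> False"
| "on (Par a t) v \<longleftrightarrow> v = Tup (a # t) \<or> v = Tup t"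
| "on (Las a t) v \<longleftrightarrow> v = Tup (a # t) \<or> v = Elt a"
| "on (Prv w i) v \<longleftrightarrow> v = w"

definition list_cells :: "(nat list \<Rightarrow> bool) \<Rightarrow> cell set" where
  "list_cells R = {x. case x of Prv v i \<Rightarrow> i < num R v | _ \<Rightarrow> True}"

definition list_config :: "(nat list \<Rightarrow> bool) \<Rightarrow> cell config" where
  "list_config R = \<lparr>cells = list_cells R, side = (\<lambda>x. \<not> (\<exists>v. x = Vx v)),
     adj = (\<lambda>x y. x \<in> list_cells R \<and> y \<in> list_cells R \<and>
       ((\<exists>v. y = Vx v \<and> on x v) \<or> (\<exists>v. x = Vx v \<and> on y v)))\<rparr>"

lemma list_cells_simps [simp]:
  "Vx v \<in> list_cells R" "Par a t \<in> list_cells R" "Las a t \<in> list_cells R"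
  "Prv v i \<in> list_cells R \<longleftrightarrow> i < num R v"
  by (simp_all add: list_cells_def)

lemma list_config_simps [simp]:
  "cells (list_config R) = list_cells R"
  "side (list_config R) x \<longleftrightarrow> \<not> (\<exists>v. x = Vx v)"
  by (simp_all add: list_config_def)

lemma adj_list_config_line [simp]: "adj (list_config R) x (Vx v) \<longleftrightarrow> x \<in> list_cells R \<and> on x v"
  by (cases x) (auto simp: list_config_def)

lemma adj_list_config_sym: "adj (list_config R) x y \<longleftrightarrow> adj (list_config R) y x"
  by (auto simp: list_config_def)

lemma adj_list_config_cases:
  assumes "adj (list_config R) x y"
  obtains v where "y = Vx v" "x \<in> list_cells R" "on x v" | v where "x = Vx v" "y \<in> list_cells R" "on y v"
  using assms by (auto simp: list_config_def)

lemma on_linear: "on x v \<Longrightarrow> on y v \<Longrightarrow> on x w \<Longrightarrow> on y w \<Longrightarrow> x = y \<or> v = w"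
  by (cases x; cases y) auto

lemma on_imp_point: "on x v \<Longrightarrow> x \<noteq> Vx w"
  by auto

lemma list_config_configuration: "configuration (list_config R)"
  unfolding configuration_def
proof (intro conjI allI impI)
  fix u v assume uv: "adj (list_config R) u v"
  then show "u \<in> cells (list_config R)" "v \<in> cells (list_config R)" by (auto simp: list_config_def)
  show "side (list_config R) u \<noteq> side (list_config R) v"
    using uv by (rule adj_list_config_cases) (use on_imp_point in auto)
  show "adj (list_config R) v u" using uv adj_list_config_sym by blast
next
  fix x y z w
  assume *: "adj (list_config R) x z \<and> adj (list_config R) y z \<and> adj (list_config R) x w \<and> adj (list_config R) y w"
  show "x = y \<or> z = w"
  proof (cases "\<exists>v. z = Vx v")
    case True
    then obtain v where v: "z = Vx v" by blast
    then have "on x v" "on y v" using * by simp_all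
    moreover have "x \<noteq> Vx u" for u using on_imp_point[OF \<open>on x v\<close>] by simp
    then obtain u where "w = Vx u" using * by (metis adj_list_config_cases)
    moreover have "on x u" "on y u" using * \<open>w = Vx u\<close> by simp_all
    ultimately show ?thesis using on_linear v by metis
  next
    case False
    then obtain v u where v: "x = Vx v" "y = Vx u" using * by (metis adj_list_config_cases)
    then have "on z v" "on w v" "on z u" "on w u"
      using * adj_list_config_sym adj_list_config_line by metis+
    then show ?thesis using on_linear v by metis
  qed
qed

lemma infinite_list_cells: "infinite (list_cells R)"
proof
  assume "finite (list_cells R)"
  moreover have "range (\<lambda>n. Vx (Elt n)) \<subseteq> list_cells R" by auto
  ultimately have "finite (range (\<lambda>n. Vx (Elt n)))" using finite_subset by blast
  then show False by (rule notE[OF range_inj_infinite, rotated]) (simp add: inj_def)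
qed

text \<open>\<open>Par\<close> and \<open>Las\<close> points lie on two different lines, so the
  points on one line only are those introduced by \<open>Prv\<close>. This makes
  \<open>num R v\<close> visible to isomorphisms.\<close>

lemma private_points:
  "{x. adj (list_config R) x (Vx v) \<and> (\<forall>y. adj (list_config R) x y \<longrightarrow> y = Vx v)} = Prv v ` {..<num R v}"
proof (intro set_eqI iffI)
  fix x assume "x \<in> {x. adj (list_config R) x (Vx v) \<and> (\<forall>y. adj (list_config R) x y \<longrightarrow> y = Vx v)}"
  then have x: "x \<in> list_cells R" "on x v" and all: "\<And>y. adj (list_config R) x y \<Longrightarrow> y = Vx v" by auto
  have only: "w = v" if "on x w" for w using all[of "Vx w"] x(1) that by simp
  show "x \<in> Prv v ` {..<num R v}"
  proof (cases x)
    case (Par a t)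
    then have "Tup (a # t) = v" "Tup t = v" using only[of "Tup (a # t)"] only[of "Tup t"] by auto
    then show ?thesis by auto
  next
    case (Las a t)
    then have "Tup (a # t) = v" "Elt a = v" using only[of "Tup (a # t)"] only[of "Elt a"] by auto
    then show ?thesis by auto
  qed (use x in auto)
next
  fix x assume "x \<in> Prv v ` {..<num R v}"
  then show "x \<in> {x. adj (list_config R) x (Vx v) \<and> (\<forall>y. adj (list_config R) x y \<longrightarrow> y = Vx v)}"
    by (auto elim!: adj_list_config_cases)
qed

lemma card_private_points:
  "card {x. adj (list_config R) x (Vx v) \<and> (\<forall>y. adj (list_config R) x y \<longrightarrow> y = Vx v)} = num R v"
  unfolding private_points by (simp add: card_image inj_on_def)

lemma lines_meet_iff:
  assumes "v \<noteq> w"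
  shows "(\<exists>x. adj (list_config R) x (Vx v) \<and> adj (list_config R) x (Vx w)) \<longleftrightarrow>
    (\<exists>a t. {v, w} = {Tup (a # t), Tup t} \<or> {v, w} = {Tup (a # t), Elt a})"
proof
  assume "\<exists>x. adj (list_config R) x (Vx v) \<and> adj (list_config R) x (Vx w)"
  then obtain x where "on x v" "on x w" by auto
  then show "\<exists>a t. {v, w} = {Tup (a # t), Tup t} \<or> {v, w} = {Tup (a # t), Elt a}"
    using assms by (cases x) auto
next
  assume "\<exists>a t. {v, w} = {Tup (a # t), Tup t} \<or> {v, w} = {Tup (a # t), Elt a}"
  then obtain a t where "{v, w} = {Tup (a # t), Tup t} \<or> {v, w} = {Tup (a # t), Elt a}" by blast
  then show "\<exists>x. adj (list_config R) x (Vx v) \<and> adj (list_config R) x (Vx w)"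
  proof
    assume "{v, w} = {Tup (a # t), Tup t}"
    then show ?thesis by (intro exI[of _ "Par a t"]) (auto simp: doubleton_eq_iff)
  next
    assume "{v, w} = {Tup (a # t), Elt a}"
    then show ?thesis by (intro exI[of _ "Las a t"]) (auto simp: doubleton_eq_iff)
  qed
qed

lemma num_Elt_iff: "num R v = 3 \<longleftrightarrow> (\<exists>a. v = Elt a)"
  by (cases v) auto

lemma num_Tup:
  assumes "num R' w = num R (Tup t)"
  shows "\<exists>u. w = Tup u \<and> length u = length t \<and> R' u = R t"
proof (cases w)
  case (Elt a)
  then show ?thesis using assms by (simp split: if_splits)
next
  case (Tup u)
  then have *: "2 * length u + (if R' u then 1 else 0) = 2 * length t + (if R t then 1 else (0::nat))"
    using assms by simp
  have "length u = length t" "R' u = R t" using * by (simp_all split: if_splits) presburger+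
  then show ?thesis using Tup by simp
qed

fun map_vtx_nat :: "(nat \<Rightarrow> nat) \<Rightarrow> vtx \<Rightarrow> vtx" where
  "map_vtx_nat g (Elt a) = Elt (g a)"
| "map_vtx_nat g (Tup t) = Tup (map g t)"

fun map_cell_nat :: "(nat \<Rightarrow> nat) \<Rightarrow> cell \<Rightarrow> cell" where
  "map_cell_nat g (Vx v) = Vx (map_vtx_nat g v)"
| "map_cell_nat g (Par a t) = Par (g a) (map g t)"
| "map_cell_nat g (Las a t) = Las (g a) (map g t)"
| "map_cell_nat g (Prv v i) = Prv (map_vtx_nat g v) i"

lemma map_vtx_nat_inverse: "(\<And>n. g' (g n) = n) \<Longrightarrow> map_vtx_nat g' (map_vtx_nat g v) = v"
  by (cases v) (simp_all add: map_idI)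

lemma map_cell_nat_inverse: "(\<And>n. g' (g n) = n) \<Longrightarrow> map_cell_nat g' (map_cell_nat g x) = x"
  by (cases x) (simp_all add: map_idI map_vtx_nat_inverse)

text \<open>An isomorphism permutes the lines and preserves their numbers of private points, hence
  the kind of a line, the length of its sequence and membership in \<open>R\<close>. It also
  preserves which lines meet, hence tails and heads; so by induction on the sequence it acts by the
  map \<open>g\<close> that it induces on numbers.\<close>

lemma list_config_iso_iff: "config_iso (list_config R) (list_config R') \<longleftrightarrow> list_iso R R'"
proof
  assume "list_iso R R'"
  then obtain g where g: "bij g" "\<And>t. R t \<longleftrightarrow> R' (map g t)" by (auto simp: list_iso_def)
  have [simp]: "inv g (g n) = n" "g (inv g n) = n" for n
    using g(1) by (simp_all add: bij_is_inj bij_is_surj surj_f_inv_f)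
  have num: "num R' (map_vtx_nat g v) = num R v" for v by (cases v) (simp_all add: g(2))
  have cells: "map_cell_nat g x \<in> list_cells R' \<longleftrightarrow> x \<in> list_cells R" for x
    by (cases x) (simp_all add: num)
  have inverse: "map_cell_nat (inv g) (map_cell_nat g x) = x" "map_cell_nat g (map_cell_nat (inv g) x) = x"
    "map_vtx_nat (inv g) (map_vtx_nat g v) = v" for x v
    by (simp_all add: map_cell_nat_inverse map_vtx_nat_inverse)
  have inj: "map_vtx_nat g v = map_vtx_nat g w \<longleftrightarrow> v = w" for v w using inverse(3) by metis
  have bij: "bij_betw (map_cell_nat g) (list_cells R) (list_cells R')"
  proof (rule bij_betw_byWitness[where f' = "map_cell_nat (inv g)"])
    show "map_cell_nat (inv g) ` list_cells R' \<subseteq> list_cells R"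
      using cells inverse(2) by (metis image_subsetI)
  qed (use inverse cells in auto)
  have on: "on (map_cell_nat g x) (map_vtx_nat g v) \<longleftrightarrow> on x v" for x v
  proof (cases x)
    case (Par a t)
    then show ?thesis using inj[of v "Tup (a # t)"] inj[of v "Tup t"] by simp
  next
    case (Las a t)
    then show ?thesis using inj[of v "Tup (a # t)"] inj[of v "Elt a"] by simp
  qed (simp_all add: inj)
  have Vx: "map_cell_nat g x = Vx w \<longleftrightarrow> (\<exists>v. x = Vx v \<and> w = map_vtx_nat g v)" for x w
    by (cases x) auto
  have adj: "adj (list_config R') (map_cell_nat g x) (map_cell_nat g y) \<longleftrightarrow> adj (list_config R) x y" for x y
    by (auto simp: list_config_def cells Vx on)
  have "config_embed (list_config R) (list_config R') (map_cell_nat g)"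
    unfolding config_embed_def by (auto simp: adj Vx)
  then show "config_iso (list_config R) (list_config R')"
    unfolding config_iso_def using bij by auto
next
  assume "config_iso (list_config R) (list_config R')"
  then obtain h where h: "bij_betw h (list_cells R) (list_cells R')"
    and emb: "config_embed (list_config R) (list_config R') h"
    unfolding config_iso_def by auto
  have side: "(\<exists>v. x = Vx v) \<longleftrightarrow> (\<exists>v. h x = Vx v)" if "x \<in> list_cells R" for x
  proof -
    have "side (list_config R) x \<longleftrightarrow> side (list_config R') (h x)"
      using emb that unfolding config_embed_def by simp
    then show ?thesis unfolding list_config_simps by blast
  qed
  have adj: "adj (list_config R) x y \<longleftrightarrow> adj (list_config R') (h x) (h y)"
    if "x \<in> list_cells R" "y \<in> list_cells R" for x y
    using emb that by (simp add: config_embed_def)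
  have cells_adj: "x \<in> list_cells R" "y \<in> list_cells R" if "adj (list_config R) x y" for R x y
    using that config_cells[OF list_config_configuration] by fastforce+
  have inj: "h x = h y \<longleftrightarrow> x = y" if "x \<in> list_cells R" "y \<in> list_cells R" for x y
    using h that by (auto simp: bij_betw_def inj_on_def)
  have surj: "\<exists>x\<in>list_cells R. h x = y" if "y \<in> list_cells R'" for y
    using bij_betw_imp_surj_on[OF h] that by (metis imageE)
  have "\<forall>v. \<exists>w. h (Vx v) = Vx w" using side by (metis list_cells_simps(1))
  then obtain \<sigma> where \<sigma>: "\<And>v. h (Vx v) = Vx (\<sigma> v)" by metis
  have \<sigma>_inj: "\<sigma> v = \<sigma> w \<longleftrightarrow> v = w" for v w
    using inj[of "Vx v" "Vx w"] by (simp add: \<sigma>)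
  have \<sigma>_surj: "\<exists>v. \<sigma> v = w" for w
  proof -
    obtain x where x: "x \<in> list_cells R" "h x = Vx w" using surj[of "Vx w"] by auto
    then obtain v where "x = Vx v" using side by blast
    then show ?thesis using x(2) \<sigma> by auto
  qed
  have num: "num R' (\<sigma> v) = num R v" for v
  proof -
    let ?A = "{x. adj (list_config R) x (Vx v) \<and> (\<forall>y. adj (list_config R) x y \<longrightarrow> y = Vx v)}"
    let ?B = "{x. adj (list_config R') x (Vx (\<sigma> v)) \<and> (\<forall>y. adj (list_config R') x y \<longrightarrow> y = Vx (\<sigma> v))}"
    have sub: "?A \<subseteq> list_cells R" using cells_adj by blast
    have "h x \<in> ?B \<longleftrightarrow> x \<in> ?A" if x: "x \<in> list_cells R" for x
    proof -
      have "adj (list_config R') (h x) (Vx (\<sigma> v)) \<longleftrightarrow> adj (list_config R) x (Vx v)"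
        using adj[OF x, of "Vx v"] unfolding \<sigma> by (simp del: adj_list_config_line)
      moreover have "(\<forall>y. adj (list_config R') (h x) y \<longrightarrow> y = Vx (\<sigma> v)) \<longleftrightarrow>
          (\<forall>y. adj (list_config R) x y \<longrightarrow> y = Vx v)"
      proof
        assume *: "\<forall>y. adj (list_config R') (h x) y \<longrightarrow> y = Vx (\<sigma> v)"
        show "\<forall>y. adj (list_config R) x y \<longrightarrow> y = Vx v"
        proof (intro allI impI)
          fix y assume y: "adj (list_config R) x y"
          then have "y \<in> list_cells R" by (rule cells_adj(2))
          moreover from this have "h y = h (Vx v)" using * adj[OF x] y \<sigma> by metis
          ultimately show "y = Vx v" using inj by simp
        qed
      next
        assume *: "\<forall>y. adj (list_config R) x y \<longrightarrow> y = Vx v"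
        show "\<forall>y. adj (list_config R') (h x) y \<longrightarrow> y = Vx (\<sigma> v)"
        proof (intro allI impI)
          fix y assume y: "adj (list_config R') (h x) y"
          then have "y \<in> list_cells R'" by (rule cells_adj(2))
          then obtain z where z: "z \<in> list_cells R" "h z = y" using surj by blast
          then have "adj (list_config R) x z" using adj[OF x z(1)] y by simp
          then show "y = Vx (\<sigma> v)" using * z(2) \<sigma> by metis
        qed
      qed
      ultimately show ?thesis unfolding mem_Collect_eq by blast
    qed
    note B = this
    have "h ` ?A = ?B"
    proof
      show "h ` ?A \<subseteq> ?B" using B sub by blast
      show "?B \<subseteq> h ` ?A"
      proof
        fix y assume y: "y \<in> ?B"
        then have "y \<in> list_cells R'" using cells_adj(1) by blast
        then obtain x where "x \<in> list_cells R" "h x = y" using surj by blast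
        then show "y \<in> h ` ?A" using B y by blast
      qed
    qed
    moreover have "card (h ` ?A) = card ?A"
      by (rule card_image, rule inj_on_subset[OF bij_betw_imp_inj_on[OF h] sub])
    ultimately have "card ?A = card ?B" by simp
    then show ?thesis unfolding card_private_points by simp
  qed
  have meets: "(\<exists>a t. {\<sigma> v, \<sigma> w} = {Tup (a # t), Tup t} \<or> {\<sigma> v, \<sigma> w} = {Tup (a # t), Elt a})"
    if vw: "v \<noteq> w" and "\<exists>a t. {v, w} = {Tup (a # t), Tup t} \<or> {v, w} = {Tup (a # t), Elt a}" for v w
  proof -
    have "\<exists>x. adj (list_config R) x (Vx v) \<and> adj (list_config R) x (Vx w)"
      using lines_meet_iff[OF vw, of R] that(2) by blast
    then obtain x where x: "adj (list_config R) x (Vx v)" "adj (list_config R) x (Vx w)" by blast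
    have "x \<in> list_cells R" by (rule cells_adj(1)[OF x(1)])
    then have "adj (list_config R') (h x) (Vx (\<sigma> v))" "adj (list_config R') (h x) (Vx (\<sigma> w))"
      using adj x \<sigma> list_cells_simps(1) by metis+
    then show ?thesis using lines_meet_iff[of "\<sigma> v" "\<sigma> w" R'] vw \<sigma>_inj by blast
  qed
  have "\<forall>a. \<exists>b. \<sigma> (Elt a) = Elt b" using num num_Elt_iff by metis
  then obtain g where g: "\<And>a. \<sigma> (Elt a) = Elt (g a)" by metis
  have "\<forall>t. \<exists>u. \<sigma> (Tup t) = Tup u \<and> length u = length t \<and> R' u = R t" using num num_Tup by metis
  then obtain k where k: "\<And>t. \<sigma> (Tup t) = Tup (k t)" "\<And>t. length (k t) = length t" "\<And>t. R' (k t) = R t"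
    by metis
  have k_map: "k t = map g t" for t
  proof (induction t)
    case Nil
    then show ?case using k(2)[of "[]"] by simp
  next
    case (Cons a t)
    have "\<exists>b u. {Tup (k (a # t)), Tup (k t)} = {Tup (b # u), Tup u} \<or>
        {Tup (k (a # t)), Tup (k t)} = {Tup (b # u), Elt b}"
    proof -
      have "\<exists>b u. {Tup (a # t), Tup t} = {Tup (b # u), Tup u} \<or> {Tup (a # t), Tup t} = {Tup (b # u), Elt b}"
        by (rule exI[of _ a], rule exI[of _ t]) simp
      from meets[OF _ this] show ?thesis unfolding k(1) by simp
    qed
    then obtain b where b: "k (a # t) = b # k t \<or> k t = b # k (a # t)"
      by (auto simp: doubleton_eq_iff)
    \<comment> \<open>That two lines meet does not say which of the sequences is the tail of the
      other; the lengths do.\<close>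
    have "k t \<noteq> b # k (a # t)"
    proof
      assume "k t = b # k (a # t)"
      then have "length (k t) = Suc (length (k (a # t)))" by simp
      then show False by (simp add: k(2))
    qed
    with b have b: "k (a # t) = b # k t" by blast
    have "\<exists>c u. {Tup (k (a # t)), Elt (g a)} = {Tup (c # u), Tup u} \<or>
        {Tup (k (a # t)), Elt (g a)} = {Tup (c # u), Elt c}"
    proof -
      have "\<exists>b u. {Tup (a # t), Elt a} = {Tup (b # u), Tup u} \<or> {Tup (a # t), Elt a} = {Tup (b # u), Elt b}"
        by (rule exI[of _ a], rule exI[of _ t]) simp
      from meets[OF _ this] show ?thesis unfolding k(1) g by simp
    qed
    then have "\<exists>u. k (a # t) = g a # u" by (auto simp: doubleton_eq_iff)
    then show ?case using b Cons.IH by simp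
  qed
  have "inj g" using \<sigma>_inj g by (metis injI vtx.inject(1))
  moreover have "surj g"
    unfolding surj_def
  proof
    fix b
    obtain v where v: "\<sigma> v = Elt b" using \<sigma>_surj by blast
    then have "num R v = 3" using num[of v] by simp
    then obtain a where "v = Elt a" using num_Elt_iff by blast
    then show "\<exists>a. b = g a" using v g by auto
  qed
  ultimately show "list_iso R R'"
    unfolding list_iso_def using k(3) k_map by (intro exI[of _ g]) (auto simp: bij_def)
qed

section \<open>Adding trivial lines\<close>

text \<open>Keeping the inverse with an isomorphism gives a symmetric notion, so that facts proved
  for \<open>h\<close> can be reused for \<open>k\<close>.\<close>

definition iso_pair :: "'v config \<Rightarrow> 'w config \<Rightarrow> ('v \<Rightarrow> 'w) \<Rightarrow> ('w \<Rightarrow> 'v) \<Rightarrow> bool" where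
  "iso_pair C C' h k \<longleftrightarrow> (\<forall>v\<in>cells C. h v \<in> cells C' \<and> k (h v) = v) \<and>
     (\<forall>v\<in>cells C'. k v \<in> cells C \<and> h (k v) = v) \<and> config_embed C C' h"

lemma iso_pairD:
  assumes "iso_pair C C' h k"
  shows "v \<in> cells C \<Longrightarrow> h v \<in> cells C'" "v \<in> cells C \<Longrightarrow> k (h v) = v"
    "w \<in> cells C' \<Longrightarrow> k w \<in> cells C" "w \<in> cells C' \<Longrightarrow> h (k w) = w"
    "v \<in> cells C \<Longrightarrow> side C' (h v) \<longleftrightarrow> side C v"
    "u \<in> cells C \<Longrightarrow> v \<in> cells C \<Longrightarrow> adj C' (h u) (h v) \<longleftrightarrow> adj C u v"
  using assms unfolding iso_pair_def config_embed_def by blast+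

lemma iso_pair_sym: "iso_pair C C' h k \<Longrightarrow> iso_pair C' C k h"
  unfolding iso_pair_def config_embed_def by (intro conjI ballI) (metis+)

lemma config_iso_iff_iso_pair: "config_iso C C' \<longleftrightarrow> (\<exists>h k. iso_pair C C' h k)"
proof
  assume "config_iso C C'"
  then obtain h where h: "bij_betw h (cells C) (cells C')" "config_embed C C' h"
    unfolding config_iso_def by blast
  have "iso_pair C C' h (inv_into (cells C) h)"
    unfolding iso_pair_def
    using h bij_betw_inv_into_left[OF h(1)] bij_betw_inv_into_right[OF h(1)]
      bij_betwE[OF h(1)] bij_betwE[OF bij_betw_inv_into[OF h(1)]] by blast
  then show "\<exists>h k. iso_pair C C' h k" by blast
next
  assume "\<exists>h k. iso_pair C C' h k"
  then obtain h k where hk: "iso_pair C C' h k" by blast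
  have "bij_betw h (cells C) (cells C')"
    by (rule bij_betw_byWitness[where f' = k]) (use iso_pairD[OF hk] in auto)
  then show "config_iso C C'" using hk unfolding config_iso_def iso_pair_def by blast
qed

text \<open>A trivial line is named by the unordered pair of its points; finite sets identify the
  two orders and keep the type countable.\<close>

definition new_line :: "'v config \<Rightarrow> 'v fset \<Rightarrow> bool" where
  "new_line C s \<longleftrightarrow> (\<exists>p q. s = {|p, q|} \<and> p \<noteq> q \<and> p \<in> cells C \<and> q \<in> cells C \<and> side C p \<and> side C q \<and>
     \<not> (\<exists>l. adj C p l \<and> adj C q l))"

fun ext_adj :: "'v config \<Rightarrow> 'v + 'v fset \<Rightarrow> 'v + 'v fset \<Rightarrow> bool" where
  "ext_adj C (Inl u) (Inl v) \<longleftrightarrow> adj C u v"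
| "ext_adj C (Inl u) (Inr s) \<longleftrightarrow> new_line C s \<and> u |\<in>| s"
| "ext_adj C (Inr s) (Inl u) \<longleftrightarrow> new_line C s \<and> u |\<in>| s"
| "ext_adj C (Inr s) (Inr t) \<longleftrightarrow> False"

definition plane_ext :: "'v config \<Rightarrow> ('v + 'v fset) config" where
  "plane_ext C = \<lparr>cells = {x. case x of Inl v \<Rightarrow> v \<in> cells C | Inr s \<Rightarrow> new_line C s},
     side = (\<lambda>x. case x of Inl v \<Rightarrow> side C v | Inr s \<Rightarrow> False), adj = ext_adj C\<rparr>"

lemma plane_ext_simps [simp]:
  "Inl v \<in> cells (plane_ext C) \<longleftrightarrow> v \<in> cells C" "Inr s \<in> cells (plane_ext C) \<longleftrightarrow> new_line C s"
  "side (plane_ext C) (Inl v) \<longleftrightarrow> side C v" "side (plane_ext C) (Inr s) \<longleftrightarrow> False"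
  "adj (plane_ext C) = ext_adj C"
  by (simp_all add: plane_ext_def)

text \<open>Trivial lines have two points, so this condition makes the original lines recognizable
  in the extension.\<close>

definition three_points :: "'v config \<Rightarrow> bool" where
  "three_points C \<longleftrightarrow> (\<forall>l\<in>cells C. \<not> side C l \<longrightarrow>
     (\<exists>p q r. p \<noteq> q \<and> p \<noteq> r \<and> q \<noteq> r \<and> adj C p l \<and> adj C q l \<and> adj C r l))"

lemma new_line_mem: "new_line C s \<Longrightarrow> u |\<in>| s \<Longrightarrow> u \<in> cells C \<and> side C u"
  by (auto simp: new_line_def)

lemma new_line_linear:
  assumes "new_line C s" "new_line C t" "u |\<in>| s" "u |\<in>| t" "v |\<in>| s" "v |\<in>| t" "u \<noteq> v"
  shows "s = t"
  using assms by (auto simp: new_line_def)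

lemma new_line_not_joined:
  assumes C: "configuration C" and "new_line C s" "u |\<in>| s" "v |\<in>| s" "adj C u l" "adj C v l"
  shows "u = v"
  using assms(2-) by (auto simp: new_line_def)

text \<open>A new line joins points that no old line joins, so it has at most one point in common
  with an old line; and two new lines with two common points are the same pair.\<close>

lemma configuration_plane_ext:
  assumes C: "configuration C"
  shows "configuration (plane_ext C)"
  unfolding configuration_def
proof (intro conjI allI impI)
  fix x y assume xy: "adj (plane_ext C) x y"
  show "x \<in> cells (plane_ext C)" "y \<in> cells (plane_ext C)"
    using xy by (cases x; cases y; auto dest: new_line_mem config_cells[OF C])+
  show "side (plane_ext C) x \<noteq> side (plane_ext C) y"
    using xy by (cases x; cases y; auto dest: new_line_mem config_side[OF C])
  show "adj (plane_ext C) y x"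
    using xy config_sym[OF C] by (cases x; cases y; auto)
next
  fix x y z w
  assume *: "adj (plane_ext C) x z \<and> adj (plane_ext C) y z \<and> adj (plane_ext C) x w \<and> adj (plane_ext C) y w"
  show "x = y \<or> z = w"
  proof (cases "\<exists>s. x = Inr s \<or> y = Inr s")
    case False
    then obtain u v where uv: "x = Inl u" "y = Inl v" by (metis sum.exhaust)
    show ?thesis
    proof (cases z)
      case z: (Inl z')
      show ?thesis
      proof (cases w)
        case (Inl w')
        then show ?thesis using * uv z config_linear[OF C, of u z' v w'] by simp
      next
        case (Inr t)
        then show ?thesis using * uv z new_line_not_joined[OF C, of t u v z'] by simp
      qed
    next
      case z: (Inr s)
      show ?thesis
      proof (cases w)
        case (Inl w')
        then show ?thesis using * uv z new_line_not_joined[OF C, of s u v w'] by simp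
      next
        case (Inr t)
        then show ?thesis using * uv z new_line_linear[of C s t u v] by auto
      qed
    qed
  next
    case True
    then obtain u v where uv: "z = Inl u" "w = Inl v"
      using * by (cases z; cases w; cases x; cases y) auto
    show ?thesis
    proof (cases x)
      case x: (Inl x')
      then obtain t where y: "y = Inr t" using True by auto
      then show ?thesis using * uv x new_line_not_joined[OF C, of t u v x'] config_sym[OF C] by auto
    next
      case x: (Inr s)
      show ?thesis
      proof (cases y)
        case (Inl y')
        then show ?thesis using * uv x new_line_not_joined[OF C, of s u v y'] config_sym[OF C] by auto
      next
        case (Inr t)
        then show ?thesis using * uv x new_line_linear[of C s t u v] by auto
      qed
    qed
  qed
qed

lemma infinite_plane_ext: "infinite (cells C) \<Longrightarrow> infinite (cells (plane_ext C))"
proof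
  assume "infinite (cells C)" "finite (cells (plane_ext C))"
  moreover have "Inl ` cells C \<subseteq> cells (plane_ext C)" by auto
  ultimately show False using finite_subset finite_imageD[of Inl "cells C"] by (metis inj_Inl inj_on_subset subset_UNIV)
qed

lemma new_line_two: "new_line C s \<Longrightarrow> \<exists>p q. p \<noteq> q \<and> (\<forall>x. ext_adj C x (Inr s) \<longleftrightarrow> x = Inl p \<or> x = Inl q)"
proof -
  assume s: "new_line C s"
  then obtain p q where pq: "s = {|p, q|}" "p \<noteq> q" by (auto simp: new_line_def)
  have "ext_adj C x (Inr s) \<longleftrightarrow> x = Inl p \<or> x = Inl q" for x
    using s pq by (cases x) auto
  then show ?thesis using pq(2) by blast
qed

lemma plane_plane_ext:
  assumes C: "configuration C" "infinite (cells C)" "three_points C"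
    and tri: "p0 \<in> cells C" "q0 \<in> cells C" "r0 \<in> cells C" "side C p0" "side C q0" "side C r0"
      "distinct [p0, q0, r0]" "\<And>l. \<not> (adj C p0 l \<and> adj C q0 l \<and> adj C r0 l)"
  shows "plane (to_struct (plane_ext C))"
proof (rule plane_to_struct[OF configuration_plane_ext[OF C(1)] infinite_plane_ext[OF C(2)],
    where ?p0.0 = "Inl p0" and ?q0.0 = "Inl q0" and ?r0.0 = "Inl r0"])
  fix p q assume pq: "p \<in> cells (plane_ext C)" "q \<in> cells (plane_ext C)" "side (plane_ext C) p"
    "side (plane_ext C) q" "p \<noteq> q"
  then obtain u v where uv: "p = Inl u" "q = Inl v" by (cases p; cases q) auto
  show "\<exists>l. adj (plane_ext C) p l \<and> adj (plane_ext C) q l"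
  proof (cases "\<exists>l. adj C u l \<and> adj C v l")
    case True
    then obtain l where "adj C u l" "adj C v l" by blast
    then show ?thesis by (intro exI[of _ "Inl l"]) (simp add: uv)
  next
    case False
    then have "new_line C {|u, v|}" using pq uv unfolding new_line_def by auto
    then show ?thesis by (intro exI[of _ "Inr {|u, v|}"]) (simp add: uv)
  qed
next
  fix l assume l: "l \<in> cells (plane_ext C)" "\<not> side (plane_ext C) l"
  show "\<exists>p q. p \<noteq> q \<and> adj (plane_ext C) p l \<and> adj (plane_ext C) q l"
  proof (cases l)
    case (Inl v)
    then obtain p q where "p \<noteq> q" "adj C p v" "adj C q v" using l C(3) unfolding three_points_def by auto
    then show ?thesis using Inl by (intro exI[of _ "Inl p"] exI[of _ "Inl q"]) simp
  next
    case (Inr s)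
    then obtain p q where pq: "p \<noteq> q" "\<forall>x. ext_adj C x (Inr s) \<longleftrightarrow> x = Inl p \<or> x = Inl q"
      using l new_line_two[of C s] by auto
    then have e: "ext_adj C (Inl p) (Inr s)" "ext_adj C (Inl q) (Inr s)" by blast+
    show ?thesis unfolding Inr
      by (rule exI[of _ "Inl p"], rule exI[of _ "Inl q"]) (use pq(1) e in simp)
  qed
next
  fix l
  show "\<not> (adj (plane_ext C) (Inl p0) l \<and> adj (plane_ext C) (Inl q0) l \<and> adj (plane_ext C) (Inl r0) l)"
  proof (cases l)
    case (Inl v)
    then show ?thesis using tri(8)[of v] by simp
  next
    case (Inr s)
    show ?thesis
    proof
      assume *: "adj (plane_ext C) (Inl p0) l \<and> adj (plane_ext C) (Inl q0) l \<and> adj (plane_ext C) (Inl r0) l"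
      then have "new_line C s" using Inr by simp
      then obtain p q where pq: "\<forall>x. ext_adj C x (Inr s) \<longleftrightarrow> x = Inl p \<or> x = Inl q" using new_line_two by metis
      have "p0 = p \<or> p0 = q" "q0 = p \<or> q0 = q" "r0 = p \<or> r0 = q"
        using * pq Inr by (metis plane_ext_simps(5) sum.inject(1))+
      then show False using tri(7) by auto
    qed
  qed
qed (use tri in auto)

text \<open>Nontrivial lines are old, and each point is on at most two old lines. So any seventeen
  points can serve as the exceptional ones.\<close>

lemma simple_plane_ext:
  fixes C :: "'v::countable config"
  assumes C: "configuration C" "infinite {p \<in> cells C. side C p}"
    and plane: "plane (to_struct (plane_ext C))"
    and two: "\<And>p. p \<in> cells C \<Longrightarrow> side C p \<Longrightarrow> \<exists>a b. {l. adj C p l} \<subseteq> {a, b}"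
  shows "simple_plane (to_struct (plane_ext C))"
proof -
  have inf: "infinite (cells C)" using C(2) by (rule contrapos_nn) simp
  define e where "e = enum (plane_ext C)"
  have e: "bij_betw e UNIV (cells (plane_ext C))"
    unfolding e_def by (rule bij_enum[OF infinite_plane_ext[OF inf]])
  have mem: "e n \<in> cells (plane_ext C)" for n using bij_betw_imp_surj_on[OF e] by blast
  have inj: "e m = e n \<longleftrightarrow> m = n" for m n using e by (auto simp: bij_betw_def inj_on_def)
  have surj: "\<exists>n. e n = v" if "v \<in> cells (plane_ext C)" for v
    using bij_betw_imp_surj_on[OF e] that by (metis imageE)
  have inc: "inc (to_struct (plane_ext C)) m n \<longleftrightarrow> side (plane_ext C) (e m) \<and> ext_adj C (e m) (e n)" for m n
    using config_side[OF configuration_plane_ext[OF C(1)], of "e m" "e n"] by (auto simp: e_def)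
  have nontriv: "\<exists>v. e l = Inl v" if l: "nontrivial_line (to_struct (plane_ext C)) l" for l
  proof (rule ccontr)
    assume "\<nexists>v. e l = Inl v"
    then obtain s where s: "e l = Inr s" by (metis sum.exhaust)
    then have nl: "new_line C s" using mem[of l] by simp
    then obtain p q where pq: "p \<noteq> q" "\<forall>x. ext_adj C x (Inr s) \<longleftrightarrow> x = Inl p \<or> x = Inl q"
      using new_line_two by metis
    then have p: "p |\<in>| s" "q |\<in>| s" by (metis ext_adj.simps(2))+
    then have pc: "p \<in> cells C" "q \<in> cells C" "side C p" "side C q" using new_line_mem[OF nl] by blast+
    obtain m n where mn: "e m = Inl p" "e n = Inl q" using surj pc by (metis plane_ext_simps(1))
    have "inc (to_struct (plane_ext C)) k l \<longleftrightarrow> k = m \<or> k = n" for k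
    proof -
      have "inc (to_struct (plane_ext C)) k l \<longleftrightarrow> e k = Inl p \<or> e k = Inl q"
        unfolding inc s using pq(2)[rule_format, of "e k"] pc by auto
      then show ?thesis unfolding mn[symmetric] inj .
    qed
    moreover have "m \<noteq> n" using mn pq(1) by auto
    ultimately show False using l unfolding nontrivial_line_iff by blast
  qed
  have "infinite {n. pt (to_struct (plane_ext C)) n}"
  proof
    assume "finite {n. pt (to_struct (plane_ext C)) n}"
    then have "finite (e ` {n. pt (to_struct (plane_ext C)) n})" by simp
    moreover have "(Inl :: 'v \<Rightarrow> 'v + 'v fset) ` {p \<in> cells C. side C p} \<subseteq> e ` {n. pt (to_struct (plane_ext C)) n}"
    proof
      fix x :: "'v + 'v fset" assume "x \<in> Inl ` {p \<in> cells C. side C p}"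
      then obtain p where p: "x = Inl p" "p \<in> cells C" "side C p" by blast
      then obtain n where n: "e n = x" using surj by (metis plane_ext_simps(1))
      then have "pt (to_struct (plane_ext C)) n" using p by (simp add: e_def)
      then show "x \<in> e ` {n. pt (to_struct (plane_ext C)) n}" using n by blast
    qed
    ultimately have "finite ((Inl :: 'v \<Rightarrow> 'v + 'v fset) ` {p \<in> cells C. side C p})"
      using finite_subset by blast
    then have "finite {p \<in> cells C. side C p}" by (rule finite_imageD) simp
    with C(2) show False by simp
  qed
  then obtain S where S: "finite S" "card S = 17" "S \<subseteq> {n. pt (to_struct (plane_ext C)) n}"
    using infinite_arbitrarily_large by blast
  obtain xs where xs: "set xs = S" using finite_list[OF S(1)] by blast
  show ?thesis
    unfolding simple_plane_iff
  proof (intro conjI plane exI[of _ xs] allI impI)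
    show "card (set xs) = 17" using S xs by simp
    show "pt (to_struct (plane_ext C)) p" if "p \<in> set xs" for p using that S xs by blast
    fix p assume p: "pt (to_struct (plane_ext C)) p \<and> p \<notin> set xs"
    then obtain u where u: "e p = Inl u" "u \<in> cells C" "side C u"
      using mem[of p] by (cases "e p") (auto simp: e_def)
    obtain a b where ab: "{l. adj C u l} \<subseteq> {a, b}" using two[OF u(2,3)] by blast
    have "\<exists>a'. \<forall>l. e l = Inl a \<longrightarrow> l = a'" "\<exists>b'. \<forall>l. e l = Inl b \<longrightarrow> l = b'"
      using inj by metis+
    then obtain a' b' where a': "\<And>l. e l = Inl a \<Longrightarrow> l = a'" and b': "\<And>l. e l = Inl b \<Longrightarrow> l = b'" by blast
    show "\<exists>a b. \<forall>l. nontrivial_line (to_struct (plane_ext C)) l \<and> inc (to_struct (plane_ext C)) p l \<longrightarrow>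
        l = a \<or> l = b"
    proof (intro exI allI impI)
      fix l assume l: "nontrivial_line (to_struct (plane_ext C)) l \<and> inc (to_struct (plane_ext C)) p l"
      then obtain v where v: "e l = Inl v" using nontriv by blast
      then have "adj C u v" using l u(1) unfolding inc by simp
      then have "v = a \<or> v = b" using ab by blast
      then show "l = a' \<or> l = b'" using a' b' v by blast
    qed
  qed
qed

lemma plane_ext_old_iff:
  assumes C: "three_points C" and x: "x \<in> cells (plane_ext C)"
  shows "(\<exists>v. x = Inl v) \<longleftrightarrow> side (plane_ext C) x \<or>
    (\<exists>p q r. p \<noteq> q \<and> p \<noteq> r \<and> q \<noteq> r \<and> ext_adj C p x \<and> ext_adj C q x \<and> ext_adj C r x)"
proof (cases x)
  case (Inl v)
  have "\<exists>p q r. p \<noteq> q \<and> p \<noteq> r \<and> q \<noteq> r \<and> ext_adj C p x \<and> ext_adj C q x \<and> ext_adj C r x" if nv: "\<not> side C v"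
  proof -
    obtain p q r where "p \<noteq> q" "p \<noteq> r" "q \<noteq> r" "adj C p v" "adj C q v" "adj C r v"
      using C[unfolded three_points_def, rule_format, of v] x nv Inl by auto
    then show ?thesis using Inl
      by (intro exI[of _ "Inl p"] exI[of _ "Inl q"] exI[of _ "Inl r"]) simp
  qed
  then show ?thesis using Inl by auto
next
  case (Inr s)
  then obtain p q where "\<forall>y. ext_adj C y x \<longleftrightarrow> y = Inl p \<or> y = Inl q"
    using x new_line_two[of C s] by auto
  then show ?thesis using Inr by auto
qed

lemma new_line_image:
  assumes hk: "iso_pair C C' h k" and C': "configuration C'" and s: "new_line C s"
  shows "new_line C' (h |`| s)"
proof -
  note I = iso_pairD[OF hk]
  obtain p q where pq: "s = {|p, q|}" "p \<noteq> q" "p \<in> cells C" "q \<in> cells C" "side C p" "side C q"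
    "\<not> (\<exists>l. adj C p l \<and> adj C q l)" using s unfolding new_line_def by blast
  have "\<not> (\<exists>l. adj C' (h p) l \<and> adj C' (h q) l)"
  proof
    assume "\<exists>l. adj C' (h p) l \<and> adj C' (h q) l"
    then obtain l where l: "adj C' (h p) l" "adj C' (h q) l" by blast
    have lc: "l \<in> cells C'" by (rule config_cells(2)[OF C' l(1)])
    then have "adj C p (k l)" "adj C q (k l)"
      using l I(6)[OF pq(3) I(3)[OF lc]] I(6)[OF pq(4) I(3)[OF lc]] by (simp_all add: I(4))
    then show False using pq(7) by blast
  qed
  moreover have "h p \<noteq> h q" using I(2) pq by metis
  ultimately show ?thesis
    unfolding new_line_def using pq I(1,5) by (intro exI[of _ "h p"] exI[of _ "h q"]) auto
qed

lemma iso_pair_plane_ext: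
  assumes hk: "iso_pair C C' h k" and C: "configuration C" and C': "configuration C'"
  shows "iso_pair (plane_ext C) (plane_ext C') (map_sum h (fimage h)) (map_sum k (fimage k))"
proof -
  note I = iso_pairD[OF hk]
  have fwd: "map_sum h (fimage h) x \<in> cells (plane_ext C') \<and> map_sum k (fimage k) (map_sum h (fimage h) x) = x"
    if x: "x \<in> cells (plane_ext C)" and hk: "iso_pair C C' h k" and C': "configuration C'"
    for C C' :: "_ config" and h k x
  proof (cases x)
    case (Inl v)
    then show ?thesis using x iso_pairD[OF hk] by simp
  next
    case (Inr s)
    then have s: "new_line C s" using x by simp
    have "k |`| (h |`| s) = (\<lambda>v. v) |`| s"
      unfolding fimage_fimage by (rule fimage_cong) (use new_line_mem[OF s] iso_pairD(2)[OF hk] in auto)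
    then show ?thesis using Inr s new_line_image[OF hk C'] by simp
  qed
  have "config_embed (plane_ext C) (plane_ext C') (map_sum h (fimage h))"
    unfolding config_embed_def
  proof (intro conjI ballI)
    fix x assume x: "x \<in> cells (plane_ext C)"
    then show "side (plane_ext C) x \<longleftrightarrow> side (plane_ext C') (map_sum h (fimage h) x)"
      by (cases x) (simp_all add: I(5))
    have mem: "h u |\<in>| h |`| s \<longleftrightarrow> u |\<in>| s" if "new_line C s" "u \<in> cells C" for u s
      using new_line_mem[OF that(1)] I(2) that(2) by (metis fimageE fimageI)
    fix y assume y: "y \<in> cells (plane_ext C)"
    show "adj (plane_ext C) x y \<longleftrightarrow> adj (plane_ext C') (map_sum h (fimage h) x) (map_sum h (fimage h) y)"
    proof (cases x)
      case x': (Inl u)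
      show ?thesis
      proof (cases y)
        case (Inl v)
        then show ?thesis using x' x y by (simp add: I(6))
      next
        case (Inr s)
        then show ?thesis using x' x y mem new_line_image[OF hk C'] by simp
      qed
    next
      case x': (Inr s)
      show ?thesis
      proof (cases y)
        case (Inl v)
        then show ?thesis using x' x y mem new_line_image[OF hk C'] by simp
      next
        case (Inr t)
        then show ?thesis using x' by simp
      qed
    qed
  qed
  then show ?thesis
    unfolding iso_pair_def
    using fwd[OF _ hk C'] fwd[OF _ iso_pair_sym[OF hk] C] by blast
qed

text \<open>By \<open>plane_ext_old_iff\<close> an isomorphism of the extensions maps original cells
  to original cells, so it restricts to the configurations.\<close>

lemma plane_ext_iso_iff:
  fixes C C' :: "'v config"
  assumes C: "configuration C" "three_points C" and C': "configuration C'" "three_points C'"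
  shows "config_iso (plane_ext C) (plane_ext C') \<longleftrightarrow> config_iso C C'"
proof
  assume "config_iso (plane_ext C) (plane_ext C')"
  then obtain h where h: "bij_betw h (cells (plane_ext C)) (cells (plane_ext C'))"
    and emb: "config_embed (plane_ext C) (plane_ext C') h" unfolding config_iso_def by blast
  have side: "side (plane_ext C) x \<longleftrightarrow> side (plane_ext C') (h x)" if "x \<in> cells (plane_ext C)" for x
    using emb that by (simp add: config_embed_def)
  have adj: "ext_adj C x y \<longleftrightarrow> ext_adj C' (h x) (h y)"
    if "x \<in> cells (plane_ext C)" "y \<in> cells (plane_ext C)" for x y
    using emb that by (simp add: config_embed_def)
  have inj: "h x = h y \<longleftrightarrow> x = y" if "x \<in> cells (plane_ext C)" "y \<in> cells (plane_ext C)" for x y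
    using h that by (auto simp: bij_betw_def inj_on_def)
  have surj: "\<exists>x\<in>cells (plane_ext C). h x = y" if "y \<in> cells (plane_ext C')" for y
    using bij_betw_imp_surj_on[OF h] that by (metis imageE)
  have mem: "h x \<in> cells (plane_ext C')" if "x \<in> cells (plane_ext C)" for x
    using bij_betw_imp_surj_on[OF h] that by blast
  have cells: "x \<in> cells (plane_ext C)" if "ext_adj C x y" for x y
    using config_cells(1)[OF configuration_plane_ext[OF C(1)], of x y] that by simp
  have cells': "x \<in> cells (plane_ext C')" if "ext_adj C' x y" for x y
    using config_cells(1)[OF configuration_plane_ext[OF C'(1)], of x y] that by simp
  have old: "(\<exists>v. x = Inl v) \<longleftrightarrow> (\<exists>v. h x = Inl v)" if x: "x \<in> cells (plane_ext C)" for x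
  proof -
    have "(\<exists>p q r. p \<noteq> q \<and> p \<noteq> r \<and> q \<noteq> r \<and> ext_adj C p x \<and> ext_adj C q x \<and> ext_adj C r x) \<longleftrightarrow>
        (\<exists>p q r. p \<noteq> q \<and> p \<noteq> r \<and> q \<noteq> r \<and> ext_adj C' p (h x) \<and> ext_adj C' q (h x) \<and> ext_adj C' r (h x))"
    proof
      assume "\<exists>p q r. p \<noteq> q \<and> p \<noteq> r \<and> q \<noteq> r \<and> ext_adj C p x \<and> ext_adj C q x \<and> ext_adj C r x"
      then obtain p q r where pqr: "p \<noteq> q" "p \<noteq> r" "q \<noteq> r" "ext_adj C p x" "ext_adj C q x" "ext_adj C r x"
        by blast
      note c = pqr(4-6)[THEN cells]
      show "\<exists>p q r. p \<noteq> q \<and> p \<noteq> r \<and> q \<noteq> r \<and> ext_adj C' p (h x) \<and> ext_adj C' q (h x) \<and> ext_adj C' r (h x)"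
        by (rule exI[of _ "h p"], rule exI[of _ "h q"], rule exI[of _ "h r"])
          (use pqr c x inj adj in simp)
    next
      assume "\<exists>p q r. p \<noteq> q \<and> p \<noteq> r \<and> q \<noteq> r \<and> ext_adj C' p (h x) \<and> ext_adj C' q (h x) \<and> ext_adj C' r (h x)"
      then obtain p q r where pqr: "p \<noteq> q" "p \<noteq> r" "q \<noteq> r" "ext_adj C' p (h x)" "ext_adj C' q (h x)"
        "ext_adj C' r (h x)" by blast
      obtain p' q' r' where c: "p' \<in> cells (plane_ext C)" "h p' = p" "q' \<in> cells (plane_ext C)" "h q' = q"
        "r' \<in> cells (plane_ext C)" "h r' = r" using surj pqr(4-6)[THEN cells'] by metis
      show "\<exists>p q r. p \<noteq> q \<and> p \<noteq> r \<and> q \<noteq> r \<and> ext_adj C p x \<and> ext_adj C q x \<and> ext_adj C r x"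
        by (rule exI[of _ p'], rule exI[of _ q'], rule exI[of _ r']) (use pqr c x adj in auto)
    qed
    then show ?thesis
      using plane_ext_old_iff[OF C(2) x] plane_ext_old_iff[OF C'(2) mem[OF x]] side[OF x] by simp
  qed
  have "\<forall>v\<in>cells C. \<exists>w. h (Inl v) = Inl w" using old by (metis plane_ext_simps(1))
  then obtain k where k: "\<And>v. v \<in> cells C \<Longrightarrow> h (Inl v) = Inl (k v)" by metis
  have "bij_betw k (cells C) (cells C')"
    unfolding bij_betw_def
  proof
    show "inj_on k (cells C)"
    proof (rule inj_onI)
      fix u v assume "u \<in> cells C" "v \<in> cells C" "k u = k v"
      then show "u = v" using inj[of "Inl u" "Inl v"] k by simp
    qed
    show "k ` cells C = cells C'"
    proof (intro subset_antisym subsetI)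
      fix w assume "w \<in> k ` cells C"
      then obtain v where "v \<in> cells C" "w = k v" by blast
      then show "w \<in> cells C'" using mem[of "Inl v"] k by simp
    next
      fix w assume "w \<in> cells C'"
      then obtain x where x: "x \<in> cells (plane_ext C)" "h x = Inl w" using surj[of "Inl w"] by auto
      then obtain v where v: "x = Inl v" using old by blast
      then show "w \<in> k ` cells C" using x k[of v] by force
    qed
  qed
  moreover have "config_embed C C' k"
    unfolding config_embed_def
  proof (intro conjI ballI)
    fix u assume u: "u \<in> cells C"
    show "side C u \<longleftrightarrow> side C' (k u)" using side[of "Inl u"] k[OF u] u by simp
    fix v assume v: "v \<in> cells C"
    show "adj C u v \<longleftrightarrow> adj C' (k u) (k v)" using adj[of "Inl u" "Inl v"] k[OF u] k[OF v] u v by simp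
  qed
  ultimately show "config_iso C C'" unfolding config_iso_def by blast
next
  assume "config_iso C C'"
  then show "config_iso (plane_ext C) (plane_ext C')"
    unfolding config_iso_iff_iso_pair using iso_pair_plane_ext C(1) C'(1) by blast
qed

lemma list_config_three_points: "three_points (list_config R)"
  unfolding three_points_def
proof (intro ballI impI)
  fix l assume "l \<in> cells (list_config R)" "\<not> side (list_config R) l"
  then obtain v where v: "l = Vx v" by auto
  have "3 \<le> num R v" by (cases v) simp_all
  then show "\<exists>p q r. p \<noteq> q \<and> p \<noteq> r \<and> q \<noteq> r \<and> adj (list_config R) p l \<and> adj (list_config R) q l \<and>
      adj (list_config R) r l"
    using v by (intro exI[of _ "Prv v 0"] exI[of _ "Prv v 1"] exI[of _ "Prv v 2"]) simp
qed

lemma list_config_two_lines: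
  assumes "side (list_config R) p"
  shows "\<exists>a b. {l. adj (list_config R) p l} \<subseteq> {a, b}"
proof -
  have line: "\<exists>v. l = Vx v \<and> on p v" if "adj (list_config R) p l" for l
    using that assms by (auto elim!: adj_list_config_cases)
  show ?thesis
  proof (cases p)
    case (Par a t)
    then have "{l. adj (list_config R) p l} \<subseteq> {Vx (Tup (a # t)), Vx (Tup t)}" using line by fastforce
    then show ?thesis by blast
  next
    case (Las a t)
    then have "{l. adj (list_config R) p l} \<subseteq> {Vx (Tup (a # t)), Vx (Elt a)}" using line by fastforce
    then show ?thesis by blast
  next
    case (Prv v i)
    then have "{l. adj (list_config R) p l} \<subseteq> {Vx v, Vx v}" using line by fastforce
    then show ?thesis by blast
  qed (use assms in auto)
qed

definition simple_code :: "(nat list \<Rightarrow> bool) \<Rightarrow> struct" where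
  "simple_code R = to_struct (plane_ext (list_config R))"

lemma simple_code_simple: "simple_code R \<in> simple_planes"
proof -
  have inf: "infinite (cells (list_config R))" by (simp add: infinite_list_cells)
  have "infinite {p \<in> cells (list_config R). side (list_config R) p}"
  proof
    assume "finite {p \<in> cells (list_config R). side (list_config R) p}"
    moreover have "range (\<lambda>a. Par a []) \<subseteq> {p \<in> cells (list_config R). side (list_config R) p}" by auto
    ultimately have "finite (range (\<lambda>a. Par a []))" using finite_subset by blast
    then show False by (rule notE[OF range_inj_infinite, rotated]) (simp add: inj_def)
  qed
  moreover have "plane (to_struct (plane_ext (list_config R)))"
  \<comment> \<open>\<open>Par 0 []\<close> and \<open>Par 1 []\<close> share only the line of the
    empty sequence, and \<open>Las 0 [0]\<close> is not on it.\<close>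
  proof (rule plane_plane_ext[OF list_config_configuration inf list_config_three_points,
        of "Par 0 []" "Par 1 []" "Las 0 [0]"])
    fix l
    show "\<not> (adj (list_config R) (Par 0 []) l \<and> adj (list_config R) (Par 1 []) l \<and>
        adj (list_config R) (Las 0 [0]) l)"
      by (auto elim!: adj_list_config_cases)
  qed auto
  ultimately show ?thesis
    unfolding simple_planes_def simple_code_def
    using simple_plane_ext[OF list_config_configuration _ _ list_config_two_lines] by blast
qed

lemma simple_code_iso_iff: "struct_iso (simple_code R) (simple_code R') \<longleftrightarrow> list_iso R R'"
  unfolding simple_code_def
  by (simp add: struct_iso_to_struct_iff configuration_plane_ext list_config_configuration
      infinite_plane_ext infinite_list_cells plane_ext_iso_iff list_config_three_points list_config_iso_iff)

lemma list_config_measurable: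
  assumes [measurable]: "\<And>t. Measurable.pred M (\<lambda>x. \<rho> x t)"
  shows "Measurable.pred M (\<lambda>x. v \<in> cells (list_config (\<rho> x)))"
    "Measurable.pred M (\<lambda>x. side (list_config (\<rho> x)) v)"
    "Measurable.pred M (\<lambda>x. adj (list_config (\<rho> x)) u v)"
proof -
  have num: "Measurable.pred M (\<lambda>x. i < num (\<rho> x) w)" for i w
  proof (cases w)
    case (Tup t)
    have "i < num (\<rho> x) w \<longleftrightarrow> (if \<rho> x t then i < 5 + 2 * length t else i < 4 + 2 * length t)" for x
      by (auto simp: Tup)
    then show ?thesis by simp
  qed simp
  then have cells [measurable]: "Measurable.pred M (\<lambda>x. w \<in> list_cells (\<rho> x))" for w by (cases w) simp_all
  then show "Measurable.pred M (\<lambda>x. v \<in> cells (list_config (\<rho> x)))" by simp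
  show "Measurable.pred M (\<lambda>x. side (list_config (\<rho> x)) v)" by simp
  show "Measurable.pred M (\<lambda>x. adj (list_config (\<rho> x)) u v)"
    unfolding list_config_def config.select_convs by measurable
qed

lemma simple_code_measurable:
  assumes "\<And>t. Measurable.pred M (\<lambda>x. \<rho> x t)"
  shows "(\<lambda>x. simple_code (\<rho> x)) \<in> borel_measurable M"
  unfolding simple_code_def
proof (rule borel_measurable_to_struct)
  note [measurable] = list_config_measurable[OF assms]
  have new [measurable]: "Measurable.pred M (\<lambda>x. new_line (list_config (\<rho> x)) s)" for s
    unfolding new_line_def by measurable
  show "Measurable.pred M (\<lambda>x. v \<in> cells (plane_ext (list_config (\<rho> x))))" for v
    by (cases v) (simp_all del: list_config_simps add: list_config_measurable[OF assms] new)
  show "Measurable.pred M (\<lambda>x. side (plane_ext (list_config (\<rho> x))) v)" for v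
    by (cases v) (simp_all del: list_config_simps add: list_config_measurable[OF assms] new)
  show "Measurable.pred M (\<lambda>x. adj (plane_ext (list_config (\<rho> x))) u v)" for u v
    by (cases u; cases v) (simp_all del: list_config_simps adj_list_config_line
        add: list_config_measurable[OF assms] new)
qed (simp add: infinite_plane_ext infinite_list_cells)

section \<open>Free projective completions\<close>

text \<open>The Fano plane from the difference set \<open>{0, 1, 3}\<close> modulo 7.\<close>

definition fano_list :: "(nat \<times> nat) list" where
  "fano_list = [(0,0),(0,1),(0,3),(1,1),(1,2),(1,4),(2,2),(2,3),(2,5),(3,3),(3,4),(3,6),
     (4,4),(4,5),(4,0),(5,5),(5,6),(5,1),(6,6),(6,0),(6,2)]"

text \<open>
  Pairs of a point and a line. Point 0 is the centre of perspective, 1, 2, 3 and 4, 5, 6 are the two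
  triangles, and 7, 8, 9 are the intersections of corresponding sides; line 9 passes through 7
  and 8 but not through 9.
\<close>

definition desargues_list :: "(nat \<times> nat) list" where
  "desargues_list = [(0,0),(1,0),(4,0),(0,1),(2,1),(5,1),(0,2),(3,2),(6,2),(1,3),(2,3),(7,3),
     (4,4),(5,4),(7,4),(1,5),(3,5),(8,5),(4,6),(6,6),(8,6),(2,7),(3,7),(9,7),(5,8),(6,8),(9,8),(7,9),(8,9)]"

text \<open>All quantifiers are bounded by the list, and tests come before the inner ones, so that
  \<open>code_simp\<close> can evaluate the condition.\<close>

definition pairs_linear :: "(nat \<times> nat) list \<Rightarrow> bool" where
  "pairs_linear L \<longleftrightarrow> list_all (\<lambda>p. list_all (\<lambda>q. if snd p = snd q \<and> fst p \<noteq> fst q then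
     list_all (\<lambda>r. if fst r = fst p \<and> snd r \<noteq> snd p then \<not> List.member L (fst q, snd r) else True) L
     else True) L) L"

lemma pairs_linear_fano: "pairs_linear fano_list"
  by code_simp

lemma pairs_linear_desargues: "pairs_linear desargues_list"
  by code_simp

lemma pairs_linearD:
  assumes "pairs_linear L" "(i, j) \<in> set L" "(i', j) \<in> set L" "(i, j') \<in> set L" "(i', j') \<in> set L"
  shows "i = i' \<or> j = j'"
proof (rule ccontr)
  assume ne: "\<not> ?thesis"
  have "\<forall>p\<in>set L. \<forall>q\<in>set L. snd p = snd q \<and> fst p \<noteq> fst q \<longrightarrow>
      (\<forall>r\<in>set L. fst r = fst p \<and> snd r \<noteq> snd p \<longrightarrow> (fst q, snd r) \<notin> set L)"
    using assms(1) unfolding pairs_linear_def list_all_iff by (auto split: if_splits)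
  from this[rule_format, OF assms(2) assms(3) _ assms(4)] show False using ne assms(5) by simp
qed

text \<open>The lower bounds count distinct neighbours and the upper bounds count entries of the
  list, so both apply to the number of neighbours: exactly 3 in the Fano plane, 2 or 3 in the
  Desargues configuration.\<close>

definition pairs_bounded :: "nat \<Rightarrow> nat \<Rightarrow> (nat \<times> nat) list \<Rightarrow> bool" where
  "pairs_bounded n m L \<longleftrightarrow> list_all (\<lambda>p. fst p < n \<and> snd p < n) L \<and>
     list_all (\<lambda>i. m \<le> length (remdups (map snd (filter (\<lambda>p. fst p = i) L))) \<and>
       length (filter (\<lambda>p. fst p = i) L) \<le> 3 \<and>
       m \<le> length (remdups (map fst (filter (\<lambda>p. snd p = i) L))) \<and>
       length (filter (\<lambda>p. snd p = i) L) \<le> 3) [0..<n]"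

lemma pairs_bounded_fano: "pairs_bounded 7 3 fano_list"
  by code_simp

lemma pairs_bounded_desargues: "pairs_bounded 10 2 desargues_list"
  by code_simp

text \<open>The flags tell the sides, \<open>True\<close> for the points of the list; in this way
  the list of incidences becomes a symmetric relation.\<close>

definition gadget_adj :: "(nat \<times> nat) list \<Rightarrow> bool \<Rightarrow> nat \<Rightarrow> bool \<Rightarrow> nat \<Rightarrow> bool" where
  "gadget_adj L b i c j \<longleftrightarrow> b \<noteq> c \<and> (if b then (i, j) else (j, i)) \<in> set L"

lemma gadget_adj_sym: "gadget_adj L b i c j \<longleftrightarrow> gadget_adj L c j b i"
  by (auto simp: gadget_adj_def)

lemma gadget_adj_linear:
  assumes "pairs_linear L" "gadget_adj L b i c j" "gadget_adj L b' i' c j" "gadget_adj L b i c' j'"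
    "gadget_adj L b' i' c' j'"
  shows "(b, i) = (b', i') \<or> (c, j) = (c', j')"
  using assms(2-5) pairs_linearD[OF assms(1), of i j i' j'] pairs_linearD[OF assms(1), of j i j' i']
  by (cases b; cases c; cases b'; cases c') (auto simp: gadget_adj_def)

definition gadget_nbrs :: "(nat \<times> nat) list \<Rightarrow> bool \<Rightarrow> nat \<Rightarrow> nat set" where
  "gadget_nbrs L b i = {j. gadget_adj L b i (\<not> b) j}"

lemma gadget_nbrs_eq:
  "gadget_nbrs L b i = (if b then set (remdups (map snd (filter (\<lambda>p. fst p = i) L)))
     else set (remdups (map fst (filter (\<lambda>p. snd p = i) L))))"
  by (force simp: gadget_nbrs_def gadget_adj_def)

lemma gadget_nbrs_bounds:
  assumes "pairs_bounded n m L"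
  shows "finite (gadget_nbrs L b i)" "gadget_nbrs L b i \<subseteq> {..<n}" "card (gadget_nbrs L b i) \<le> 3"
    "i < n \<Longrightarrow> m \<le> card (gadget_nbrs L b i)"
proof -
  have L: "fst p < n" "snd p < n" if "p \<in> set L" for p
    using assms that unfolding pairs_bounded_def list_all_iff by auto
  have L': "m \<le> length (remdups (map snd (filter (\<lambda>p. fst p = i) L)))"
    "length (filter (\<lambda>p. fst p = i) L) \<le> 3"
    "m \<le> length (remdups (map fst (filter (\<lambda>p. snd p = i) L)))"
    "length (filter (\<lambda>p. snd p = i) L) \<le> 3" if "i < n"
    using assms that unfolding pairs_bounded_def list_all_iff by auto
  show "finite (gadget_nbrs L b i)" unfolding gadget_nbrs_eq by simp
  show "gadget_nbrs L b i \<subseteq> {..<n}" unfolding gadget_nbrs_eq using L by auto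
  show "m \<le> card (gadget_nbrs L b i)" if "i < n"
    unfolding gadget_nbrs_eq using L'[OF that] by (simp add: length_remdups_card_conv)
  show "card (gadget_nbrs L b i) \<le> 3"
  proof (cases "i < n")
    case True
    show ?thesis
      unfolding gadget_nbrs_eq set_remdups
      using L'(2,4)[OF True] card_length[of "map snd (filter (\<lambda>p. fst p = i) L)"]
        card_length[of "map fst (filter (\<lambda>p. snd p = i) L)"]
      by (cases b) (simp_all del: set_map set_filter)
  next
    case False
    then have "gadget_nbrs L b i = {}" unfolding gadget_nbrs_eq using L by auto
    then show ?thesis by simp
  qed
qed

lemma gadget_adj_less:
  assumes "pairs_bounded n m L" "gadget_adj L b i c j"
  shows "i < n" "j < n"
proof -
  have "c = (\<not> b)" using assms(2) by (auto simp: gadget_adj_def)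
  then have "j \<in> gadget_nbrs L b i" "i \<in> gadget_nbrs L c j"
    using assms(2) gadget_adj_sym[of L b i c j] by (auto simp: gadget_nbrs_def)
  then show "i < n" "j < n" using gadget_nbrs_bounds(2)[OF assms(1)] by blast+
qed

text \<open>
  \<open>Fan v True 0\<close> stands for \<open>v\<close> itself, and \<open>Fan v b i\<close> with \<open>b\<close> true for the cells of the Fano
  plane at \<open>v\<close> that are on the same side as \<open>v\<close>; this treats points and lines alike.
\<close>

datatype 'v fan = Fan 'v bool nat | Dg bool nat

instance fan :: (countable) countable by countable_datatype

fun fan_adj :: "'v config \<Rightarrow> 'v fan \<Rightarrow> 'v fan \<Rightarrow> bool" where
  "fan_adj C (Fan v b i) (Fan w c j) \<longleftrightarrow> v \<in> cells C \<and> w \<in> cells C \<and>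
     (v = w \<and> gadget_adj fano_list b i c j \<or> b \<and> c \<and> i = 0 \<and> j = 0 \<and> adj C v w)"
| "fan_adj C (Dg b i) (Dg c j) \<longleftrightarrow> gadget_adj desargues_list b i c j"
| "fan_adj C _ _ \<longleftrightarrow> False"

definition fan_config :: "'v config \<Rightarrow> 'v fan config" where
  "fan_config C = \<lparr>cells = {x. case x of Fan v b i \<Rightarrow> v \<in> cells C \<and> i < 7 | Dg b i \<Rightarrow> i < 10},
     side = (\<lambda>x. case x of Fan v b i \<Rightarrow> side C v = b | Dg b i \<Rightarrow> b), adj = fan_adj C\<rparr>"

lemma fan_config_simps [simp]:
  "Fan v b i \<in> cells (fan_config C) \<longleftrightarrow> v \<in> cells C \<and> i < 7"
  "Dg b i \<in> cells (fan_config C) \<longleftrightarrow> i < 10"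
  "side (fan_config C) (Fan v b i) \<longleftrightarrow> side C v = b"
  "side (fan_config C) (Dg b i) \<longleftrightarrow> b"
  "adj (fan_config C) = fan_adj C"
  by (simp_all add: fan_config_def)

lemma gadget_adj_side: "gadget_adj L b i c j \<Longrightarrow> b \<noteq> c"
  by (simp add: gadget_adj_def)

text \<open>Different Fano planes are adjacent only through their cells \<open>Fan v True 0\<close>,
  where adjacency is that of \<open>C\<close>. A cycle of length four would therefore lie in a
  single gadget or among these cells.\<close>

lemma configuration_fan_config:
  assumes C: "configuration C"
  shows "configuration (fan_config C)"
  unfolding configuration_def
proof (intro conjI allI impI)
  fix x y assume xy: "adj (fan_config C) x y"
  show "x \<in> cells (fan_config C)" "y \<in> cells (fan_config C)"
    using xy by (cases x; cases y; auto dest: gadget_adj_less[OF pairs_bounded_fano]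
        gadget_adj_less[OF pairs_bounded_desargues])+
  show "side (fan_config C) x \<noteq> side (fan_config C) y"
    using xy by (cases x; cases y; auto dest: gadget_adj_side config_side[OF C])
  show "adj (fan_config C) y x"
    using xy by (cases x; cases y; auto simp: gadget_adj_sym dest: config_sym[OF C])
next
  fix x y z w
  assume "adj (fan_config C) x z \<and> adj (fan_config C) y z \<and> adj (fan_config C) x w \<and> adj (fan_config C) y w"
  then have *: "fan_adj C x z" "fan_adj C y z" "fan_adj C x w" "fan_adj C y w" by simp_all
  show "x = y \<or> z = w"
  proof (cases x)
    case x: (Dg b i)
    then obtain c j where z: "z = Dg c j" using *(1) by (cases z) auto
    then obtain b' i' where y: "y = Dg b' i'" using *(2) by (cases y) auto
    obtain c' j' where w: "w = Dg c' j'" using *(3) x by (cases w) auto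
    show ?thesis
      using * gadget_adj_linear[OF pairs_linear_desargues, of b i c j b' i' c' j'] x y z w by auto
  next
    case x: (Fan v b i)
    then obtain w1 c j where z: "z = Fan w1 c j" using *(1) by (cases z) auto
    then obtain v' b' i' where y: "y = Fan v' b' i'" using *(2) by (cases y) auto
    obtain w2 c' j' where w: "w = Fan w2 c' j'" using *(3) x by (cases w) auto
    have irr: "\<not> adj C u u" for u using config_side[OF C, of u u] by blast
    have lin: "v = v' \<or> w1 = w2" if "adj C v w1" "adj C v' w1" "adj C v w2" "adj C v' w2"
      using config_linear[OF C that] .
    have glin: "b = b' \<and> i = i' \<or> c = c' \<and> j = j'"
      if "gadget_adj fano_list b i c j" "gadget_adj fano_list b' i' c j" "gadget_adj fano_list b i c' j'"
        "gadget_adj fano_list b' i' c' j'"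
      using gadget_adj_linear[OF pairs_linear_fano that] by simp
    have neq: "\<not> gadget_adj fano_list d k d l" for d k l by (simp add: gadget_adj_def)
    show ?thesis
      using * irr lin glin neq unfolding x y z w fan_adj.simps fan.inject
      by (cases b; cases b'; cases c; cases c'; simp; metis)
  qed
qed

lemma iso_pair_fan_config:
  assumes hk: "iso_pair C C' h k"
  shows "iso_pair (fan_config C) (fan_config C') (map_fan h) (map_fan k)"
proof -
  note I = iso_pairD[OF hk]
  have fwd: "map_fan h x \<in> cells (fan_config C') \<and> map_fan k (map_fan h x) = x"
    if "iso_pair C C' h k" "x \<in> cells (fan_config C)" for C :: "'x config" and C' :: "'y config" and h k x
    using that(2) iso_pairD[OF that(1)] by (cases x) simp_all
  have inj: "h u = h v \<longleftrightarrow> u = v" if "u \<in> cells C" "v \<in> cells C" for u v using I(2) that by metis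
  have "config_embed (fan_config C) (fan_config C') (map_fan h)"
    unfolding config_embed_def
  proof (intro conjI ballI)
    fix x assume x: "x \<in> cells (fan_config C)"
    then show "side (fan_config C) x \<longleftrightarrow> side (fan_config C') (map_fan h x)" by (cases x) (simp_all add: I)
    fix y assume y: "y \<in> cells (fan_config C)"
    show "adj (fan_config C) x y \<longleftrightarrow> adj (fan_config C') (map_fan h x) (map_fan h y)"
      using x y by (cases x; cases y) (simp_all add: I inj)
  qed
  then show ?thesis
    unfolding iso_pair_def using fwd[OF hk] fwd[OF iso_pair_sym[OF hk]] by blast
qed

section \<open>The free completion by stages\<close>

datatype 'u fr = Base 'u | New "'u fr" "'u fr"

instance fr :: (countable) countable by countable_datatype

primrec fr_side :: "'u config \<Rightarrow> 'u fr \<Rightarrow> bool" where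
  "fr_side C (Base u) = side C u"
| "fr_side C (New a b) = (\<not> fr_side C a)"

fun kids :: "'u fr \<Rightarrow> 'u fr set" where
  "kids (Base u) = {}"
| "kids (New a b) = {a, b}"

text \<open>Adjacency is determined by the terms alone, so it does not change from one stage to the
  next.\<close>

definition fr_adj :: "'u config \<Rightarrow> 'u fr \<Rightarrow> 'u fr \<Rightarrow> bool" where
  "fr_adj C x y \<longleftrightarrow> (\<exists>u v. x = Base u \<and> y = Base v \<and> adj C u v) \<or> x \<in> kids y \<or> y \<in> kids x"

text \<open>The condition on \<^const>\<open>to_nat\<close> selects one of the terms \<open>New a b\<close> and \<open>New b a\<close>.\<close>

primrec stage :: "'u::countable config \<Rightarrow> nat \<Rightarrow> 'u fr set" where
  "stage C 0 = Base ` cells C"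
| "stage C (Suc n) = stage C n \<union> {t. \<exists>a b. t = New a b \<and> a \<in> stage C n \<and> b \<in> stage C n \<and>
     to_nat a < to_nat b \<and> fr_side C a = fr_side C b \<and>
     \<not> (\<exists>c. c \<in> stage C n \<and> fr_adj C a c \<and> fr_adj C b c)}"

definition free_config :: "'u::countable config \<Rightarrow> 'u fr config" where
  "free_config C = \<lparr>cells = (\<Union>n. stage C n), side = fr_side C,
     adj = (\<lambda>x y. (\<exists>n. x \<in> stage C n) \<and> (\<exists>n. y \<in> stage C n) \<and> fr_adj C x y)\<rparr>"

lemma free_config_simps [simp]:
  "x \<in> cells (free_config C) \<longleftrightarrow> (\<exists>n. x \<in> stage C n)" "side (free_config C) = fr_side C"
  "adj (free_config C) x y \<longleftrightarrow> (\<exists>n. x \<in> stage C n) \<and> (\<exists>n. y \<in> stage C n) \<and> fr_adj C x y"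
  by (simp_all add: free_config_def)

lemma stage_mono: "m \<le> n \<Longrightarrow> stage C m \<subseteq> stage C n"
  by (induction n) (auto simp: le_Suc_eq)

lemma stage_Base: "Base u \<in> stage C n \<longleftrightarrow> u \<in> cells C"
  by (induction n) auto

lemma stage_kids: "t \<in> stage C (Suc n) \<Longrightarrow> kids t \<subseteq> stage C n"
proof (induction n)
  case (Suc n)
  then consider "t \<in> stage C (Suc n)" | a b where "t = New a b" "a \<in> stage C (Suc n)" "b \<in> stage C (Suc n)"
    unfolding stage.simps(2)[of C "Suc n"] by blast
  then show ?case
    using Suc.IH stage_mono[of n "Suc n" C] by cases auto
qed auto

lemma stage_kids_side: "t \<in> stage C n \<Longrightarrow> a \<in> kids t \<Longrightarrow> fr_side C t \<noteq> fr_side C a"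
  by (induction n) auto

lemma fr_adj_sym: "configuration C \<Longrightarrow> fr_adj C x y \<Longrightarrow> fr_adj C y x"
  unfolding fr_adj_def by (auto dest: config_sym)

text \<open>The kids of every cell of stage \<open>Suc n\<close> lie in stage \<open>n\<close>, so a
  cell that is new at \<open>Suc n\<close> is not yet a kid of anything there. Only the two cells it
  was made from remain as neighbours.\<close>

lemma new_nbrs:
  assumes "t \<in> stage C (Suc n)" "t \<notin> stage C n" "y \<in> stage C (Suc n)" "fr_adj C t y"
  shows "y \<in> kids t"
proof -
  have "t \<notin> kids y" using stage_kids[OF assms(3)] assms(2) by blast
  moreover have "t \<noteq> Base u" for u using assms(1,2) stage_Base by metis
  ultimately show ?thesis using assms(4) by (auto simp: fr_adj_def)
qed

text \<open>The neighbours \<open>z\<close> and \<open>w\<close> of the new cell \<open>x\<close>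
  are the two cells it was made from. As these had no common neighbour at stage \<open>n\<close>,
  the cell \<open>y\<close> is new as well and was made from the same pair; the order by
  \<open>to_nat\<close> then makes the terms equal.\<close>

lemma new_cell_unique:
  assumes C: "configuration C" and mem: "x \<in> stage C (Suc n)" "y \<in> stage C (Suc n)" "z \<in> stage C (Suc n)"
    "w \<in> stage C (Suc n)" and new: "x \<notin> stage C n" and ne: "z \<noteq> w"
    and adj: "fr_adj C x z" "fr_adj C y z" "fr_adj C x w" "fr_adj C y w"
  shows "x = y"
proof -
  obtain a b where x: "x = New a b" "to_nat a < to_nat b"
    "\<not> (\<exists>c. c \<in> stage C n \<and> fr_adj C a c \<and> fr_adj C b c)" using mem(1) new by auto
  have "z \<in> {a, b}" "w \<in> {a, b}" using new_nbrs[OF mem(1) new] mem adj x(1) by auto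
  then have zw: "{z, w} = {a, b}" using ne by auto
  have "fr_adj C a y" "fr_adj C b y" using zw fr_adj_sym[OF C adj(2)] fr_adj_sym[OF C adj(4)]
    by (auto simp: doubleton_eq_iff)
  then have y_new: "y \<notin> stage C n" using x(3) by blast
  then obtain a' b' where y: "y = New a' b'" "to_nat a' < to_nat b'" using mem(2) by auto
  have "z \<in> {a', b'}" "w \<in> {a', b'}" using new_nbrs[OF mem(2) y_new] mem adj y(1) by auto
  then have "{a, b} = {a', b'}" using ne zw by auto
  then show ?thesis using x y by (auto simp: doubleton_eq_iff)
qed

lemma stage_linear:
  assumes C: "configuration C"
  shows "x \<in> stage C n \<Longrightarrow> y \<in> stage C n \<Longrightarrow> z \<in> stage C n \<Longrightarrow> w \<in> stage C n \<Longrightarrow>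
    fr_adj C x z \<Longrightarrow> fr_adj C y z \<Longrightarrow> fr_adj C x w \<Longrightarrow> fr_adj C y w \<Longrightarrow> x = y \<or> z = w"
proof (induction n)
  case 0
  then obtain x' y' z' w' where xs: "x = Base x'" "y = Base y'" "z = Base z'" "w = Base w'" by auto
  then show ?case using 0 config_linear[OF C, of x' z' y' w'] by (auto simp: fr_adj_def)
next
  case (Suc n)
  note m = Suc.prems(1-4) and a = Suc.prems(5-8)
  note a' = a[THEN fr_adj_sym[OF C]]
  show ?case
  proof (rule ccontr)
    assume ne: "\<not> (x = y \<or> z = w)"
    have "x \<in> stage C n" using new_cell_unique[OF C m(1,2,3,4) _ _ a] ne by blast
    moreover have "y \<in> stage C n" using new_cell_unique[OF C m(2,1,3,4) _ _ a(2,1,4,3)] ne by blast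
    moreover have "z \<in> stage C n" using new_cell_unique[OF C m(3,4,1,2) _ _ a'(1,3,2,4)] ne by blast
    moreover have "w \<in> stage C n" using new_cell_unique[OF C m(4,3,1,2) _ _ a'(3,1,4,2)] ne by blast
    ultimately show False using Suc.IH a ne by blast
  qed
qed

lemma configuration_free_config:
  assumes C: "configuration C"
  shows "configuration (free_config C)"
  unfolding configuration_def
proof (intro conjI allI impI)
  fix x y assume xy: "adj (free_config C) x y"
  show "x \<in> cells (free_config C)" "y \<in> cells (free_config C)" using xy by auto
  obtain n m where nm: "x \<in> stage C n" "y \<in> stage C m" "fr_adj C x y" using xy by auto
  show "side (free_config C) x \<noteq> side (free_config C) y"
    using nm stage_kids_side[OF nm(1)] stage_kids_side[OF nm(2)] config_side[OF C]
    by (auto simp: fr_adj_def)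
  show "adj (free_config C) y x" using nm fr_adj_sym[OF C] by auto
next
  fix x y z w
  assume *: "adj (free_config C) x z \<and> adj (free_config C) y z \<and> adj (free_config C) x w \<and> adj (free_config C) y w"
  then obtain i j k l where "x \<in> stage C i" "y \<in> stage C j" "z \<in> stage C k" "w \<in> stage C l" by auto
  then have "x \<in> stage C (i + j + k + l)" "y \<in> stage C (i + j + k + l)" "z \<in> stage C (i + j + k + l)"
    "w \<in> stage C (i + j + k + l)"
    using stage_mono[of _ "i + j + k + l" C] by (meson le_add1 le_add2 le_trans subsetD)+
  then show "x = y \<or> z = w" using stage_linear[OF C] * by auto
qed

text \<open>An isomorphism of configurations need not respect \<open>to_nat\<close>, so the image of
  \<open>New a b\<close> has to be put into the order that holds in the target.\<close>

definition mk_new :: "'u::countable fr \<Rightarrow> 'u fr \<Rightarrow> 'u fr" where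
  "mk_new a b = (if to_nat a < to_nat b then New a b else New b a)"

lemma mk_new_commute: "a \<noteq> b \<Longrightarrow> mk_new a b = mk_new b a"
  using to_nat_split[of a b] by (auto simp: mk_new_def)

lemma kids_mk_new [simp]: "kids (mk_new a b) = {a, b}"
  by (auto simp: mk_new_def)

lemma free_config_common_nbr:
  assumes C: "configuration C" and ab: "a \<in> cells (free_config C)" "b \<in> cells (free_config C)" "a \<noteq> b"
    "fr_side C a = fr_side C b"
  shows "\<exists>c. adj (free_config C) a c \<and> adj (free_config C) b c"
proof -
  obtain i j where "a \<in> stage C i" "b \<in> stage C j" using ab by auto
  then have mem: "a \<in> stage C (i + j)" "b \<in> stage C (i + j)"
    using stage_mono[of _ "i + j" C] by (meson le_add1 le_add2 subsetD)+
  show ?thesis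
  proof (cases "\<exists>c. c \<in> stage C (i + j) \<and> fr_adj C a c \<and> fr_adj C b c")
    case True
    then show ?thesis using mem by auto
  next
    case False
    have "to_nat a < to_nat b \<or> to_nat b < to_nat a"
      using ab(3) by (metis linorder_less_linear to_nat_split)
    then have "mk_new a b \<in> stage C (Suc (i + j))"
      using mem ab(4) False by (auto simp: mk_new_def)
    moreover have "fr_adj C a (mk_new a b)" "fr_adj C b (mk_new a b)" by (simp_all add: fr_adj_def)
    ultimately show ?thesis using mem by (metis free_config_simps(3))
  qed
qed

primrec fr_map :: "('u \<Rightarrow> 'w::countable) \<Rightarrow> 'u fr \<Rightarrow> 'w fr" where
  "fr_map h (Base u) = Base (h u)"
| "fr_map h (New a b) = mk_new (fr_map h a) (fr_map h b)"

lemma fr_map_adj: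
  assumes hk: "iso_pair C C' h k" and C: "configuration C" and adj: "fr_adj C x y"
  shows "fr_adj C' (fr_map h x) (fr_map h y)"
proof -
  have kid: "fr_map h a \<in> kids (fr_map h t)" if "a \<in> kids t" for a t using that by (cases t) auto
  from adj show ?thesis
    unfolding fr_adj_def
  proof (elim disjE exE conjE)
    fix u v assume *: "x = Base u" "y = Base v" "adj C u v"
    then have "adj C' (h u) (h v)" using iso_pairD(6)[OF hk] config_cells[OF C *(3)] by blast
    then show "(\<exists>u v. fr_map h x = Base u \<and> fr_map h y = Base v \<and> adj C' u v) \<or>
        fr_map h x \<in> kids (fr_map h y) \<or> fr_map h y \<in> kids (fr_map h x)"
      using * by simp
  qed (use kid in blast)+
qed

text \<open>That the images of two cells without a common neighbour have none either is seen by
  mapping such a neighbour back with \<open>k\<close>. Hence both directions advance together from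
  stage to stage.\<close>

lemma fr_map_stage_step:
  assumes hk: "iso_pair C C' h k" and C: "configuration C" and C': "configuration C'"
    and fwd: "\<And>t. t \<in> stage C n \<Longrightarrow> fr_map h t \<in> stage C' n \<and> fr_map k (fr_map h t) = t \<and>
      fr_side C' (fr_map h t) = fr_side C t"
    and bwd: "\<And>t. t \<in> stage C' n \<Longrightarrow> fr_map k t \<in> stage C n"
    and t: "t \<in> stage C (Suc n)"
  shows "fr_map h t \<in> stage C' (Suc n) \<and> fr_map k (fr_map h t) = t \<and> fr_side C' (fr_map h t) = fr_side C t"
proof (cases "t \<in> stage C n")
  case True
  then show ?thesis using fwd by simp
next
  case False
  then obtain a b where ab: "t = New a b" "a \<in> stage C n" "b \<in> stage C n" "to_nat a < to_nat b"
    "fr_side C a = fr_side C b" "\<not> (\<exists>c. c \<in> stage C n \<and> fr_adj C a c \<and> fr_adj C b c)"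
    using t by auto
  note fa = fwd[OF ab(2)] and fb = fwd[OF ab(3)]
  have ne: "a \<noteq> b" using ab(4) by auto
  have ne': "fr_map h a \<noteq> fr_map h b" using fa fb ne by metis
  have no: "\<not> (\<exists>c. c \<in> stage C' n \<and> fr_adj C' (fr_map h a) c \<and> fr_adj C' (fr_map h b) c)"
  proof
    assume "\<exists>c. c \<in> stage C' n \<and> fr_adj C' (fr_map h a) c \<and> fr_adj C' (fr_map h b) c"
    then obtain c where c: "c \<in> stage C' n" "fr_adj C' (fr_map h a) c" "fr_adj C' (fr_map h b) c" by blast
    have "fr_adj C a (fr_map k c)" "fr_adj C b (fr_map k c)"
      using fr_map_adj[OF iso_pair_sym[OF hk] C' c(2)] fr_map_adj[OF iso_pair_sym[OF hk] C' c(3)] fa fb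
      by simp_all
    then show False using ab(6) bwd[OF c(1)] by blast
  qed
  have "to_nat (fr_map h a) < to_nat (fr_map h b) \<or> to_nat (fr_map h b) < to_nat (fr_map h a)"
    using ne' by (metis linorder_less_linear to_nat_split)
  then have "mk_new (fr_map h a) (fr_map h b) \<in> stage C' (Suc n)"
    using no fa fb ab(5) by (auto simp: mk_new_def)
  moreover have "fr_map k (mk_new (fr_map h a) (fr_map h b)) = mk_new a b"
    using fa fb mk_new_commute[OF ne] by (simp add: mk_new_def[of "fr_map h a"])
  moreover have "mk_new a b = New a b" using ab(4) by (simp add: mk_new_def)
  moreover have "fr_side C' (mk_new (fr_map h a) (fr_map h b)) = fr_side C (New a b)"
    using fa fb ab(5) by (simp add: mk_new_def)
  ultimately show ?thesis using ab(1) by simp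
qed

lemma fr_map_stage:
  assumes hk: "iso_pair C C' h k" and C: "configuration C" and C': "configuration C'"
  shows "(\<forall>t\<in>stage C n. fr_map h t \<in> stage C' n \<and> fr_map k (fr_map h t) = t \<and>
      fr_side C' (fr_map h t) = fr_side C t) \<and>
    (\<forall>t\<in>stage C' n. fr_map k t \<in> stage C n \<and> fr_map h (fr_map k t) = t \<and>
      fr_side C (fr_map k t) = fr_side C' t)"
proof (induction n)
  case 0
  show ?case using iso_pairD[OF hk] iso_pairD(5)[OF iso_pair_sym[OF hk]] by auto
next
  case (Suc n)
  show ?case
    using fr_map_stage_step[OF hk C C', of n] fr_map_stage_step[OF iso_pair_sym[OF hk] C' C, of n] Suc.IH
    by blast
qed

lemma iso_pair_free_config:
  assumes hk: "iso_pair C C' h k" and C: "configuration C" and C': "configuration C'"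
  shows "iso_pair (free_config C) (free_config C') (fr_map h) (fr_map k)"
proof -
  note S = fr_map_stage[OF hk C C']
  have "fr_adj C x y \<longleftrightarrow> fr_adj C' (fr_map h x) (fr_map h y)"
    if "x \<in> stage C m" "y \<in> stage C n" for x y m n
    using fr_map_adj[OF hk C, of x y] fr_map_adj[OF iso_pair_sym[OF hk] C', of "fr_map h x" "fr_map h y"]
      S[of m] S[of n] that by auto
  then have "config_embed (free_config C) (free_config C') (fr_map h)"
    unfolding config_embed_def using S by (auto simp del: stage.simps) blast+
  then show ?thesis
    unfolding iso_pair_def using S by (auto simp del: stage.simps) blast+
qed

lemma infinite_free_config: "infinite (cells C) \<Longrightarrow> infinite (cells (free_config C))"
proof
  assume "infinite (cells C)" "finite (cells (free_config C))"
  moreover have "Base ` cells C \<subseteq> cells (free_config C)"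
  proof
    fix x assume "x \<in> Base ` cells C"
    then have "x \<in> stage C 0" by simp
    then show "x \<in> cells (free_config C)" unfolding free_config_simps by blast
  qed
  ultimately have "finite (Base ` cells C)" using finite_subset by blast
  then have "finite (cells C)" by (rule finite_imageD) (simp add: inj_on_def)
  with \<open>infinite (cells C)\<close> show False by simp
qed

lemma projective_free_config:
  assumes C: "configuration C" "infinite (cells C)"
    and two: "\<And>l. l \<in> cells C \<Longrightarrow> \<not> side C l \<Longrightarrow> \<exists>p q. p \<noteq> q \<and> adj C p l \<and> adj C q l"
    and tri: "p0 \<in> cells C" "q0 \<in> cells C" "r0 \<in> cells C" "side C p0" "side C q0" "side C r0"
      "distinct [p0, q0, r0]" "\<And>l. \<not> (adj C p0 l \<and> adj C q0 l \<and> adj C r0 l)"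
  shows "projective (to_struct (free_config C))"
proof -
  note F = configuration_free_config[OF C(1)] infinite_free_config[OF C(2)]
  have base: "Base u \<in> cells (free_config C) \<longleftrightarrow> u \<in> cells C" for u by (simp add: stage_Base)
  have common: "\<exists>c. adj (free_config C) a c \<and> adj (free_config C) b c"
    if "a \<in> cells (free_config C)" "b \<in> cells (free_config C)" "a \<noteq> b"
      "side (free_config C) a = side (free_config C) b" for a b
    using free_config_common_nbr[OF C(1) that(1,2,3)] that(4) by simp
  have "plane (to_struct (free_config C))"
  proof (rule plane_to_struct[OF F, where ?p0.0 = "Base p0" and ?q0.0 = "Base q0" and ?r0.0 = "Base r0"])
    fix p q assume "p \<in> cells (free_config C)" "q \<in> cells (free_config C)" "side (free_config C) p"
      "side (free_config C) q" "p \<noteq> q"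
    then show "\<exists>l. adj (free_config C) p l \<and> adj (free_config C) q l" using common by blast
  next
    fix l assume l: "l \<in> cells (free_config C)" "\<not> side (free_config C) l"
    show "\<exists>p q. p \<noteq> q \<and> adj (free_config C) p l \<and> adj (free_config C) q l"
    proof (cases l)
      case (Base v)
      then obtain p q where pq: "p \<noteq> q" "adj C p v" "adj C q v" using two[of v] l base by auto
      have "adj (free_config C) (Base p) l" "adj (free_config C) (Base q) l"
        using pq l(1) config_cells[OF C(1)] Base by (auto simp: stage_Base fr_adj_def)
      then show ?thesis using pq(1) by blast
    next
      case (New a b)
      obtain n where n: "l \<in> stage C n" using l by auto
      then have "l \<in> stage C (Suc n)" by simp
      from stage_kids[OF this] have "a \<in> stage C n" "b \<in> stage C n" using New by auto
      moreover have "a \<noteq> b"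
      proof -
        have "to_nat a < to_nat b" using n unfolding New by (induction n) auto
        then show ?thesis by auto
      qed
      moreover have "fr_adj C a l" "fr_adj C b l" by (simp_all add: New fr_adj_def)
      ultimately have "a \<noteq> b \<and> adj (free_config C) a l \<and> adj (free_config C) b l"
        using n by auto
      then show ?thesis by blast
    qed
  next
    fix l
    show "\<not> (adj (free_config C) (Base p0) l \<and> adj (free_config C) (Base q0) l \<and>
        adj (free_config C) (Base r0) l)"
    proof (cases l)
      case (Base v)
      then show ?thesis using tri(8)[of v] by (auto simp: fr_adj_def)
    next
      case (New a b)
      show ?thesis
      proof
        assume "adj (free_config C) (Base p0) l \<and> adj (free_config C) (Base q0) l \<and>
          adj (free_config C) (Base r0) l"
        then have "Base p0 \<in> {a, b}" "Base q0 \<in> {a, b}" "Base r0 \<in> {a, b}"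
          using New by (auto simp: fr_adj_def)
        then show False using tri(7) by auto
      qed
    qed
  qed (use tri base in auto)
  then show ?thesis
    using projective_to_struct[OF F] common config_sym[OF F(1)] by metis
qed

section \<open>Planes with a failing Desargues configuration\<close>

lemma planeD:
  assumes "plane M"
  shows plane_inc: "inc M p l \<Longrightarrow> pt M p" "inc M p l \<Longrightarrow> ln M l"
    and plane_join: "pt M p \<Longrightarrow> pt M q \<Longrightarrow> p \<noteq> q \<Longrightarrow> \<exists>!l. ln M l \<and> inc M p l \<and> inc M q l"
    and plane_meet: "ln M l \<Longrightarrow> ln M l' \<Longrightarrow> l \<noteq> l' \<Longrightarrow> inc M p l \<Longrightarrow> inc M p l' \<Longrightarrow> inc M q l \<Longrightarrow>
      inc M q l' \<Longrightarrow> p = q"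
proof -
  note P = assms[unfolded plane_def, THEN conjunct2]
  show "inc M p l \<Longrightarrow> pt M p" "inc M p l \<Longrightarrow> ln M l"
    using P[THEN conjunct1, rule_format, of p l] by blast+
  show "pt M p \<Longrightarrow> pt M q \<Longrightarrow> p \<noteq> q \<Longrightarrow> \<exists>!l. ln M l \<and> inc M p l \<and> inc M q l"
    using P[THEN conjunct2, THEN conjunct1, rule_format, of p q] by blast
  show "ln M l \<Longrightarrow> ln M l' \<Longrightarrow> l \<noteq> l' \<Longrightarrow> inc M p l \<Longrightarrow> inc M p l' \<Longrightarrow> inc M q l \<Longrightarrow> inc M q l' \<Longrightarrow> p = q"
    using P[THEN conjunct2, THEN conjunct2, THEN conjunct1, rule_format, of l l' p q] by blast
qed

lemma join_eqI:
  assumes "plane M" "inc M a l" "inc M b l" "a \<noteq> b"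
  shows "join M a b = l"
  unfolding join_def
  by (rule the1_equality[OF plane_join[OF assms(1) plane_inc(1)[OF assms(1,2)] plane_inc(1)[OF assms(1,3)] assms(4)]])
    (use assms plane_inc(2) in blast)

lemma meet_eqI:
  assumes "plane M" "inc M p l" "inc M p l'" "l \<noteq> l'"
  shows "meet M l l' = p"
  unfolding meet_def
proof (rule the_equality)
  show "pt M p \<and> inc M p l \<and> inc M p l'" using assms plane_inc(1) by blast
  fix q assume "pt M q \<and> inc M q l \<and> inc M q l'"
  then show "q = p"
    using plane_meet[OF assms(1) plane_inc(2)[OF assms(1,2)] plane_inc(2)[OF assms(1,3)] assms(4), of q p]
      assms(2,3) by blast
qed

lemma not_desarguesianI:
  assumes M: "plane M"
    and inc: "\<And>i j. (i, j) \<in> set desargues_list \<Longrightarrow> inc M (P i) (L j)"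
    and P: "\<And>i j. i < 10 \<Longrightarrow> j < 10 \<Longrightarrow> P i = P j \<longleftrightarrow> i = j"
    and L: "\<And>i j. i < 10 \<Longrightarrow> j < 10 \<Longrightarrow> L i = L j \<longleftrightarrow> i = j"
    and not_inc: "\<not> inc M (P 9) (L 9)"
  shows "\<not> desarguesian M"
proof
  assume D: "desarguesian M"
  have I: "inc M (P i) (L j)" if "List.member desargues_list (i, j)" for i j
    using that inc by (simp add: List.member_iff)
  have pt: "pt M (P i)" if "List.member desargues_list (i, j)" for i j
    by (rule plane_inc(1)[OF M I[OF that]])
  have J: "join M (P i) (P j) = L k"
    if "List.member desargues_list (i, k)" "List.member desargues_list (j, k)" "i < 10" "j < 10" "i \<noteq> j" for i j k
    using join_eqI[OF M I[OF that(1)] I[OF that(2)]] P that by simp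
  have Me: "meet M (L j) (L k) = P i"
    if "List.member desargues_list (i, j)" "List.member desargues_list (i, k)" "j < 10" "k < 10" "j \<noteq> k" for i j k
    using meet_eqI[OF M I[OF that(1)] I[OF that(2)]] L that by simp
  note mem = desargues_list_def List.member_iff
  have joins: "join M (P 1) (P 4) = L 0" "join M (P 2) (P 5) = L 1" "join M (P 3) (P 6) = L 2"
    "join M (P 1) (P 2) = L 3" "join M (P 4) (P 5) = L 4" "join M (P 1) (P 3) = L 5"
    "join M (P 4) (P 6) = L 6" "join M (P 2) (P 3) = L 7" "join M (P 5) (P 6) = L 8" "join M (P 7) (P 8) = L 9"
    by (rule J; simp add: mem)+
  have meets: "meet M (L 3) (L 4) = P 7" "meet M (L 5) (L 6) = P 8" "meet M (L 7) (L 8) = P 9"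
    by (rule Me; simp add: mem)+
  have pts: "pt M (P 0)" "pt M (P 1)" "pt M (P 2)" "pt M (P 3)" "pt M (P 4)" "pt M (P 5)" "pt M (P 6)"
    by (rule pt[of _ 0], simp add: mem, rule pt[of _ 0], simp add: mem, rule pt[of _ 1], simp add: mem,
        rule pt[of _ 2], simp add: mem, rule pt[of _ 0], simp add: mem, rule pt[of _ 1], simp add: mem,
        rule pt[of _ 2], simp add: mem)
  have incs: "inc M (P 0) (L 0)" "inc M (P 0) (L 1)" "inc M (P 0) (L 2)"
    by (rule I; simp add: mem)+
  have "collinear_pts M (P 7) (P 8) (P 9)"
    using D[unfolded desarguesian_def, rule_format, of "P 1" "P 2" "P 3" "P 4" "P 5" "P 6"]
    unfolding joins meets using pts incs by (auto simp: P L)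
  then obtain l where l: "inc M (P 7) l" "inc M (P 8) l" "inc M (P 9) l"
    unfolding collinear_pts_def by blast
  have "l = L 9" using join_eqI[OF M l(1,2)] joins(10) P[of 7 8] by simp
  then show False using l(3) not_inc by simp
qed

text \<open>This is the union of the finite confined subconfigurations, in which every cell has at
  least three neighbours; the set \<open>N\<close> exhibits three of them.\<close>

definition core :: "'v config \<Rightarrow> 'v set" where
  "core C = {x. \<exists>S. finite S \<and> x \<in> S \<and> S \<subseteq> cells C \<and>
     (\<forall>y\<in>S. \<exists>N\<subseteq>S. card N = 3 \<and> (\<forall>z\<in>N. adj C y z))}"

text \<open>In the completions below the hubs are the original points and lines, and the definition
  is invariant under isomorphisms.\<close>

definition hub :: "'v config \<Rightarrow> 'v set" where
  "hub C = {x \<in> core C. \<exists>N\<subseteq>core C. card N = 4 \<and> (\<forall>z\<in>N. adj C x z)}"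

lemma iso_pair_inj_on: "iso_pair C C' h k \<Longrightarrow> inj_on h (cells C)"
  by (rule inj_on_inverseI[where g = k]) (rule iso_pairD(2))

lemma core_subset: "core C \<subseteq> cells C"
  by (auto simp: core_def)

lemma iso_pair_core:
  assumes hk: "iso_pair C C' h k" and x: "x \<in> core C"
  shows "h x \<in> core C'"
proof -
  note I = iso_pairD[OF hk]
  obtain S where S: "finite S" "x \<in> S" "S \<subseteq> cells C"
    "\<And>y. y \<in> S \<Longrightarrow> \<exists>N\<subseteq>S. card N = 3 \<and> (\<forall>z\<in>N. adj C y z)" using x unfolding core_def by blast
  have "\<exists>N\<subseteq>h ` S. card N = 3 \<and> (\<forall>z\<in>N. adj C' y z)" if "y \<in> h ` S" for y
  proof -
    obtain y' where y': "y = h y'" "y' \<in> S" using \<open>y \<in> h ` S\<close> by blast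
    obtain N where N: "N \<subseteq> S" "card N = 3" "\<forall>z\<in>N. adj C y' z" using S(4)[OF y'(2)] by blast
    have "card (h ` N) = 3"
      using card_image[OF inj_on_subset[OF iso_pair_inj_on[OF hk]], of N] N S(3) by auto
    moreover have "\<forall>z\<in>h ` N. adj C' y z"
    proof
      fix z assume "z \<in> h ` N"
      then obtain z' where z': "z = h z'" "z' \<in> N" by blast
      have "y' \<in> cells C" "z' \<in> cells C" using y'(2) z'(2) N(1) S(3) by blast+
      then show "adj C' y z" using I(6)[of y' z'] N(3) z' y'(1) by simp
    qed
    moreover have "h ` N \<subseteq> h ` S" using N(1) by (rule image_mono)
    ultimately show ?thesis by (intro exI[of _ "h ` N"] conjI)
  qed
  moreover have "h ` S \<subseteq> cells C'" using S(3) I(1) by blast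
  ultimately show ?thesis unfolding core_def using S(1,2) by blast
qed

lemma iso_pair_hub:
  assumes hk: "iso_pair C C' h k" and x: "x \<in> hub C"
  shows "h x \<in> hub C'"
proof -
  obtain N where N: "N \<subseteq> core C" "card N = 4" "\<forall>z\<in>N. adj C x z" and xc: "x \<in> core C"
    using x unfolding hub_def by blast
  have NC: "N \<subseteq> cells C" by (rule subset_trans[OF N(1) core_subset])
  have "card (h ` N) = 4"
    using card_image[OF inj_on_subset[OF iso_pair_inj_on[OF hk] NC]] N(2) by simp
  moreover have "h ` N \<subseteq> core C'" 
  proof
    fix z assume "z \<in> h ` N"
    then obtain z' where z': "z = h z'" "z' \<in> N" by blast
    show "z \<in> core C'" unfolding z'(1) by (rule iso_pair_core[OF hk subsetD[OF N(1) z'(2)]])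
  qed
  moreover have "\<forall>z\<in>h ` N. adj C' (h x) z"
  proof
    fix z assume "z \<in> h ` N"
    then obtain z' where z': "z = h z'" "z' \<in> N" by blast
    have "x \<in> cells C" "z' \<in> cells C" by (rule subsetD[OF core_subset xc], rule subsetD[OF NC z'(2)])
    then show "adj C' (h x) z" using iso_pairD(6)[OF hk, of x z'] N(3) z' by simp
  qed
  ultimately show ?thesis unfolding hub_def using iso_pair_core[OF hk xc] by blast
qed

text \<open>
  A cell of a finite confined set that was added last would have only the two neighbours it was
  created from. Hence confined sets already lie in the configuration the construction starts from.
\<close>

lemma core_free_config: "core (free_config C) \<subseteq> Base ` cells C"
proof
  fix x assume "x \<in> core (free_config C)"
  then obtain S where S: "finite S" "x \<in> S" "S \<subseteq> cells (free_config C)"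
    "\<And>y. y \<in> S \<Longrightarrow> \<exists>N\<subseteq>S. card N = 3 \<and> (\<forall>z\<in>N. adj (free_config C) y z)" unfolding core_def by blast
  have "\<exists>n. S \<subseteq> stage C n"
    using S(1,3)
  proof (induction S rule: finite_induct)
    case (insert y S)
    then obtain m n where "y \<in> stage C m" "S \<subseteq> stage C n" by auto
    then have "insert y S \<subseteq> stage C (m + n)"
      using stage_mono[of m "m + n" C] stage_mono[of n "m + n" C] by auto
    then show ?case by blast
  qed simp
  moreover have "S \<subseteq> stage C n \<Longrightarrow> S \<subseteq> stage C 0" for n
  proof (induction n)
    case (Suc n)
    have "S \<subseteq> stage C n"
    proof
      fix t assume t: "t \<in> S"
      show "t \<in> stage C n"
      proof (rule ccontr)
        assume new: "t \<notin> stage C n"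
        obtain N where N: "N \<subseteq> S" "card N = 3" "\<forall>z\<in>N. adj (free_config C) t z" using S(4)[OF t] by blast
        have "N \<subseteq> kids t"
        proof
          fix z assume "z \<in> N"
          then have "fr_adj C t z" "z \<in> stage C (Suc n)" using N Suc.prems by auto
          then show "z \<in> kids t" using new_nbrs[OF _ new] t Suc.prems by blast
        qed
        moreover have "finite (kids t)" "card (kids t) \<le> 2" by (cases t; simp add: card_insert_if)+
        ultimately have "card N \<le> 2" using card_mono le_trans by metis
        then show False using N(2) by simp
      qed
    qed
    then show ?case by (rule Suc.IH)
  qed simp
  ultimately show "x \<in> Base ` cells C" using S(2) by auto
qed

lemma fan_nbrs_internal:
  assumes "fan_adj C (Fan v b i) y" "\<not> (b \<and> i = 0)"
  shows "y \<in> Fan v (\<not> b) ` gadget_nbrs fano_list b i"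
  using assms by (cases y) (auto simp: gadget_nbrs_def gadget_adj_def)

text \<open>By \<open>core_free_config\<close> only neighbours in \<open>fan_config C\<close> count.
  There a cell has at most three unless it is one of the attaching cells
  \<open>Fan v True 0\<close>, which have three in their Fano plane and, by \<open>nbr\<close>, a
  further one from \<open>C\<close>.\<close>

lemma hub_free_fan_config:
  assumes C: "configuration C" and nbr: "\<And>v. v \<in> cells C \<Longrightarrow> \<exists>w. adj C v w"
  shows "hub (free_config (fan_config C)) = (\<lambda>v. Base (Fan v True 0)) ` cells C"
proof (intro subset_antisym subsetI)
  have adj_free: "fan_adj C u v" if "adj (free_config (fan_config C)) (Base u) (Base v)" for u v
    using that by (simp add: fr_adj_def)
  fix x assume x: "x \<in> hub (free_config (fan_config C))"
  then have "x \<in> core (free_config (fan_config C))" by (simp add: hub_def)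
  then obtain u where u: "x = Base u" "u \<in> cells (fan_config C)" using core_free_config by blast
  obtain N where N: "N \<subseteq> core (free_config (fan_config C))" "card N = 4"
    "\<forall>z\<in>N. adj (free_config (fan_config C)) x z" using x unfolding hub_def by blast
  have N_nbr: "\<exists>y. z = Base y \<and> fan_adj C u y" if "z \<in> N" for z
  proof -
    obtain y where "z = Base y" using N(1) \<open>z \<in> N\<close> core_free_config by blast
    then show ?thesis using N(3) \<open>z \<in> N\<close> u(1) adj_free by blast
  qed
  have few: False if J: "finite J" "card J \<le> 3" "N \<subseteq> g ` J" for J :: "nat set" and g
  proof -
    have "card N \<le> card (g ` J)" using J by (intro card_mono) auto
    also have "\<dots> \<le> 3" using card_image_le[OF J(1), of g] J(2) by linarith
    finally show False using N(2) by simp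
  qed
  show "x \<in> (\<lambda>v. Base (Fan v True 0)) ` cells C"
  proof (cases u)
    case (Fan v b i)
    have "b \<and> i = 0"
    proof (rule ccontr)
      assume bi: "\<not> (b \<and> i = 0)"
      have "N \<subseteq> (\<lambda>j. Base (Fan v (\<not> b) j)) ` gadget_nbrs fano_list b i"
      proof
        fix z assume "z \<in> N"
        then obtain y where y: "z = Base y" "fan_adj C (Fan v b i) y" using N_nbr Fan by blast
        show "z \<in> (\<lambda>j. Base (Fan v (\<not> b) j)) ` gadget_nbrs fano_list b i"
          using fan_nbrs_internal[OF y(2) bi] y(1) by blast
      qed
      then show False
        by (rule few[OF gadget_nbrs_bounds(1)[OF pairs_bounded_fano] gadget_nbrs_bounds(3)[OF pairs_bounded_fano]])
    qed
    then show ?thesis using u Fan by auto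
  next
    case (Dg b i)
    have "y \<in> Dg (\<not> b) ` gadget_nbrs desargues_list b i" if "fan_adj C u y" for y
      using that Dg by (cases y) (auto simp: gadget_nbrs_def gadget_adj_def)
    then have "N \<subseteq> (\<lambda>j. Base (Dg (\<not> b) j)) ` gadget_nbrs desargues_list b i"
      using N_nbr by blast
    then have False
      by (rule few[OF gadget_nbrs_bounds(1)[OF pairs_bounded_desargues]
            gadget_nbrs_bounds(3)[OF pairs_bounded_desargues]])
    then show ?thesis ..
  qed
next
  have base_adj: "adj (free_config (fan_config C)) (Base u) (Base v)" if "fan_adj C u v" for u v
    using that config_cells[OF configuration_fan_config[OF C], of u v]
    by (auto simp: fr_adj_def stage_Base)
  have internal: "fan_adj C (Fan v b i) (Fan v (\<not> b) j)" if "v \<in> cells C" "j \<in> gadget_nbrs fano_list b i" for v b i j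
    using that by (simp add: gadget_nbrs_def)
  have core: "Base (Fan v b i) \<in> core (free_config (fan_config C))" if v: "v \<in> cells C" and i: "i < 7" for v b i
  proof -
    \<comment> \<open>The whole Fano plane at \<open>v\<close>, which is confined by itself.\<close>
    define S where "S = (\<lambda>(b, i). Base (Fan v b i)) ` (UNIV \<times> {..<7 :: nat})"
    have "\<exists>N\<subseteq>S. card N = 3 \<and> (\<forall>z\<in>N. adj (free_config (fan_config C)) y z)" if "y \<in> S" for y
    proof -
      obtain b i where y: "y = Base (Fan v b i)" "i < 7" using \<open>y \<in> S\<close> unfolding S_def by auto
      define N where "N = (\<lambda>j. Base (Fan v (\<not> b) j)) ` gadget_nbrs fano_list b i"
      have "card N = card (gadget_nbrs fano_list b i)"
        unfolding N_def by (rule card_image) (simp add: inj_on_def)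
      also have "\<dots> = 3" using gadget_nbrs_bounds(3,4)[OF pairs_bounded_fano] y(2) by (metis le_antisym)
      finally have "card N = 3" .
      moreover have "N \<subseteq> S"
        using gadget_nbrs_bounds(2)[OF pairs_bounded_fano, of b i] unfolding N_def S_def by auto
      moreover have "\<forall>z\<in>N. adj (free_config (fan_config C)) y z"
        unfolding N_def y(1) using base_adj internal[OF v] by blast
      ultimately show ?thesis by blast
    qed
    moreover have "finite S" unfolding S_def by simp
    moreover have "S \<subseteq> cells (free_config (fan_config C))"
      unfolding S_def using v by (auto simp: stage_Base)
    moreover have "Base (Fan v b i) \<in> S" unfolding S_def using i by force
    ultimately show ?thesis unfolding core_def by blast
  qed
  fix x assume "x \<in> (\<lambda>v. Base (Fan v True 0)) ` cells C"
  then obtain v where v: "x = Base (Fan v True 0)" "v \<in> cells C" by blast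
  obtain w where w: "adj C v w" using nbr[OF v(2)] by blast
  have wc: "w \<in> cells C" using config_cells[OF C w] by blast
  define N where "N = insert (Base (Fan w True 0)) ((\<lambda>j. Base (Fan v False j)) ` gadget_nbrs fano_list True 0)"
  have "card ((\<lambda>j. Base (Fan v False j)) ` gadget_nbrs fano_list True 0) = card (gadget_nbrs fano_list True 0)"
    by (rule card_image) (simp add: inj_on_def)
  also have "\<dots> = 3"
    using gadget_nbrs_bounds(3)[OF pairs_bounded_fano, of True 0]
      gadget_nbrs_bounds(4)[OF pairs_bounded_fano, of 0 True] by simp
  finally have "card N = 4"
    unfolding N_def using gadget_nbrs_bounds(1)[OF pairs_bounded_fano, of True 0]
    by (subst card_insert_disjoint) auto
  moreover have "N \<subseteq> core (free_config (fan_config C))"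
    unfolding N_def using core v(2) wc gadget_nbrs_bounds(2)[OF pairs_bounded_fano, of True 0] by auto
  moreover have "\<forall>z\<in>N. adj (free_config (fan_config C)) x z"
  proof
    fix z assume "z \<in> N"
    then consider "z = Base (Fan w True 0)" | j where "z = Base (Fan v False j)" "j \<in> gadget_nbrs fano_list True 0"
      unfolding N_def by blast
    then show "adj (free_config (fan_config C)) x z"
    proof cases
      case 1
      then show ?thesis using base_adj[of "Fan v True 0" "Fan w True 0"] v wc w by simp
    next
      case 2
      show ?thesis
        using base_adj[OF internal[OF v(2) 2(2)]] unfolding 2(1) v(1) by (simp only: not_True_eq_False)
    qed
  qed
  ultimately show "x \<in> hub (free_config (fan_config C))"
    unfolding hub_def using core[OF v(2)] v(1) by auto
qed

text \<open>The hubs carry a copy of \<open>C\<close> with its sides and its adjacency, and an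
  isomorphism and its inverse both map hubs to hubs.\<close>

lemma free_fan_config_iso_iff:
  fixes C C' :: "'v::countable config"
  assumes C: "configuration C" and nbr: "\<And>v. v \<in> cells C \<Longrightarrow> \<exists>w. adj C v w"
    and C': "configuration C'" and nbr': "\<And>v. v \<in> cells C' \<Longrightarrow> \<exists>w. adj C' v w"
  shows "config_iso (free_config (fan_config C)) (free_config (fan_config C')) \<longleftrightarrow> config_iso C C'"
proof
  assume "config_iso C C'"
  then obtain h k where hk: "iso_pair C C' h k" unfolding config_iso_iff_iso_pair by blast
  show "config_iso (free_config (fan_config C)) (free_config (fan_config C'))"
    unfolding config_iso_iff_iso_pair
    using iso_pair_free_config[OF iso_pair_fan_config[OF hk] configuration_fan_config[OF C]
        configuration_fan_config[OF C']] by blast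
next
  assume "config_iso (free_config (fan_config C)) (free_config (fan_config C'))"
  then obtain h k where hk: "iso_pair (free_config (fan_config C)) (free_config (fan_config C')) h k"
    unfolding config_iso_iff_iso_pair by blast
  define e where "e v = Base (Fan v True 0)" for v :: 'v
  have hubs: "hub (free_config (fan_config C)) = e ` cells C" "hub (free_config (fan_config C')) = e ` cells C'"
    unfolding e_def by (rule hub_free_fan_config[OF C nbr], assumption, rule hub_free_fan_config[OF C' nbr'], assumption)
  have "\<forall>v\<in>cells C. \<exists>w\<in>cells C'. h (e v) = e w"
    using iso_pair_hub[OF hk] unfolding hubs by blast
  then obtain s where s: "\<And>v. v \<in> cells C \<Longrightarrow> s v \<in> cells C' \<and> h (e v) = e (s v)" by metis
  have "\<forall>v\<in>cells C'. \<exists>w\<in>cells C. k (e v) = e w"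
    using iso_pair_hub[OF iso_pair_sym[OF hk]] unfolding hubs by blast
  then obtain t where t: "\<And>v. v \<in> cells C' \<Longrightarrow> t v \<in> cells C \<and> k (e v) = e (t v)" by metis
  have e_inj: "e u = e v \<longleftrightarrow> u = v" for u v by (simp add: e_def)
  have e_cells: "e v \<in> cells (free_config (fan_config C))" if "v \<in> cells C" for v and C :: "'v config"
    using that by (simp add: e_def stage_Base)
  have e_adj: "adj (free_config (fan_config C)) (e u) (e v) \<longleftrightarrow> adj C u v"
    if "u \<in> cells C" "v \<in> cells C" for u v and C :: "'v config"
    using that by (auto simp: e_def stage_Base fr_adj_def gadget_adj_def)
  note I = iso_pairD[OF hk]
  have "iso_pair C C' s t"
    unfolding iso_pair_def config_embed_def
  proof (intro conjI ballI)
    fix v assume v: "v \<in> cells C"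
    show "s v \<in> cells C'" using s v by blast
    have "k (h (e v)) = e v" by (rule I(2)[OF e_cells[OF v]])
    then show "t (s v) = v" using s[OF v] t[of "s v"] e_inj by auto
    have "side (free_config (fan_config C')) (e (s v)) \<longleftrightarrow> side (free_config (fan_config C)) (e v)"
      using I(5)[OF e_cells[OF v]] s[OF v] by simp
    then show "side C v \<longleftrightarrow> side C' (s v)" by (simp add: e_def)
    fix u assume u: "u \<in> cells C"
    show "adj C v u \<longleftrightarrow> adj C' (s v) (s u)"
      using I(6)[OF e_cells[OF v] e_cells[OF u]] s[OF v] s[OF u] e_adj[OF v u] e_adj[of "s v" C' "s u"] by simp
  next
    fix w assume w: "w \<in> cells C'"
    show "t w \<in> cells C" using t w by blast
    have "h (k (e w)) = e w" by (rule I(4)[OF e_cells[OF w]])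
    then show "s (t w) = w" using t[OF w] s[of "t w"] e_inj by auto
  qed
  then show "config_iso C C'" unfolding config_iso_iff_iso_pair by blast
qed

lemma list_config_nbr:
  assumes "v \<in> cells (list_config R)"
  shows "\<exists>w. adj (list_config R) v w"
proof (cases v)
  case (Vx w)
  have "3 \<le> num R w" by (cases w) simp_all
  then have "adj (list_config R) (Prv w 0) (Vx w)" by simp
  then show ?thesis using Vx adj_list_config_sym by blast
next
  case (Par a t)
  then have "adj (list_config R) v (Vx (Tup t))" by simp
  then show ?thesis by blast
next
  case (Las a t)
  then have "adj (list_config R) v (Vx (Elt a))" by simp
  then show ?thesis by blast
next
  case (Prv w i)
  then have "adj (list_config R) v (Vx w)" using assms by simp
  then show ?thesis by blast
qed

lemma fan_config_two_points:
  assumes C: "configuration C" and l: "l \<in> cells (fan_config C)"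
  shows "\<exists>p q. p \<noteq> q \<and> adj (fan_config C) p l \<and> adj (fan_config C) q l"
proof -
  have two: "\<exists>j k. j \<noteq> k \<and> j \<in> J \<and> k \<in> J" if "2 \<le> card J" for J :: "nat set"
  proof -
    have "card J \<noteq> 0" "card J \<noteq> 1" using that by simp_all
    then obtain j where "j \<in> J" by (metis card.empty ex_in_conv)
    moreover have "J \<noteq> {j}" using that by auto
    ultimately show ?thesis by blast
  qed
  have "\<exists>p q. p \<noteq> q \<and> adj (fan_config C) l p \<and> adj (fan_config C) l q"
  proof (cases l)
    case (Fan v b i)
    then have i: "v \<in> cells C" "i < 7" using l by simp_all
    have "2 \<le> card (gadget_nbrs fano_list b i)"
      using gadget_nbrs_bounds(4)[OF pairs_bounded_fano i(2), of b] by simp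
    then obtain j k where jk: "j \<noteq> k" "j \<in> gadget_nbrs fano_list b i" "k \<in> gadget_nbrs fano_list b i"
      using two by blast
    then have "Fan v (\<not> b) j \<noteq> Fan v (\<not> b) k \<and> adj (fan_config C) l (Fan v (\<not> b) j) \<and>
        adj (fan_config C) l (Fan v (\<not> b) k)"
      using Fan i by (simp add: gadget_nbrs_def)
    then show ?thesis by blast
  next
    case (Dg b i)
    then have i: "i < 10" using l by simp
    have "2 \<le> card (gadget_nbrs desargues_list b i)"
      using gadget_nbrs_bounds(4)[OF pairs_bounded_desargues i, of b] by simp
    then obtain j k where jk: "j \<noteq> k" "j \<in> gadget_nbrs desargues_list b i" "k \<in> gadget_nbrs desargues_list b i"
      using two by blast
    then have "Dg (\<not> b) j \<noteq> Dg (\<not> b) k \<and> adj (fan_config C) l (Dg (\<not> b) j) \<and>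
        adj (fan_config C) l (Dg (\<not> b) k)"
      using Dg by (simp add: gadget_nbrs_def)
    from exI[of "\<lambda>q. Dg (\<not> b) j \<noteq> q \<and> adj (fan_config C) l (Dg (\<not> b) j) \<and> adj (fan_config C) l q", OF this]
    show ?thesis by (rule exI)
  qed
  then show ?thesis using config_sym[OF configuration_fan_config[OF C]] by blast
qed

lemma infinite_fan_config: "infinite (cells C) \<Longrightarrow> infinite (cells (fan_config C))"
proof
  assume "infinite (cells C)" "finite (cells (fan_config C))"
  moreover have "(\<lambda>v. Fan v True 0) ` cells C \<subseteq> cells (fan_config C)" by auto
  ultimately have "finite ((\<lambda>v. Fan v True 0) ` cells C)" using finite_subset by blast
  then have "finite (cells C)" by (rule finite_imageD) (simp add: inj_on_def)
  with \<open>infinite (cells C)\<close> show False by simp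
qed

lemma nondesarguesian_free_fan_config:
  fixes C :: "'a::countable config"
  assumes C: "configuration C" "infinite (cells C)"
  shows "to_struct (free_config (fan_config C)) \<in> nondesarguesian_planes"
proof -
  let ?F = "free_config (fan_config C)"
  note F = configuration_fan_config[OF C(1)] infinite_fan_config[OF C(2)]
  have proj: "projective (to_struct ?F)"
  proof (rule projective_free_config[OF F fan_config_two_points[OF C(1)],
        where ?p0.0 = "Dg True 7" and ?q0.0 = "Dg True 8" and ?r0.0 = "Dg True 9"])
    fix l
    show "\<not> (adj (fan_config C) (Dg True 7) l \<and> adj (fan_config C) (Dg True 8) l \<and>
        adj (fan_config C) (Dg True 9) l)"
    proof (cases l)
      case (Dg b i)
      show ?thesis
        unfolding Dg fan_config_simps fan_adj.simps gadget_adj_def desargues_list_def by auto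
    qed simp
  qed simp_all
  have e: "bij_betw (enum ?F) UNIV (cells ?F)" by (rule bij_enum[OF infinite_free_config[OF F(2)]])
  define n where "n b i = inv_into UNIV (enum ?F) (Base (Dg b i))" for b i
  have n: "enum ?F (n b i) = Base (Dg b i)" if "i < 10" for b i
  proof -
    have "Base (Dg b i) \<in> range (enum ?F)"
      unfolding bij_betw_imp_surj_on[OF e] using that by (simp add: stage_Base)
    then show ?thesis unfolding n_def by (rule f_inv_into_f)
  qed
  have n_inj: "n b i = n b j \<longleftrightarrow> i = j" if "i < 10" "j < 10" for b i j
  proof
    assume "n b i = n b j"
    then have "Base (Dg b i) = (Base (Dg b j) :: 'a fan fr)"
      by (simp only: n[OF that(1), of b, symmetric] n[OF that(2), of b, symmetric])
    then show "i = j" by simp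
  qed simp
  have inc: "inc (to_struct ?F) (n True i) (n False j) \<longleftrightarrow> (i, j) \<in> set desargues_list"
    if "i < 10" "j < 10" for i j
    unfolding to_struct_simps n[OF that(1)] n[OF that(2)] free_config_simps
    using that by (simp add: stage_Base fr_adj_def gadget_adj_def)
  have "\<not> desarguesian (to_struct ?F)"
  proof (rule not_desarguesianI[where P = "n True" and L = "n False"])
    show "plane (to_struct ?F)" using proj by (simp add: projective_def)
    fix i j assume ij: "(i, j) \<in> set desargues_list"
    then have "gadget_adj desargues_list True i False j" by (simp add: gadget_adj_def)
    then have "i < 10" "j < 10" using gadget_adj_less[OF pairs_bounded_desargues] by blast+
    then show "inc (to_struct ?F) (n True i) (n False j)" using inc ij by blast
  next
    have "(9, 9) \<notin> set desargues_list" by (simp add: desargues_list_def)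
    then show "\<not> inc (to_struct ?F) (n True 9) (n False 9)" using inc[of 9 9] by simp
  qed (use n_inj in auto)
  then show ?thesis using proj by (simp add: nondesarguesian_planes_def)
qed

section \<open>Coding list structures by projective planes\<close>

definition projective_code :: "(nat list \<Rightarrow> bool) \<Rightarrow> struct" where
  "projective_code R = to_struct (free_config (fan_config (list_config R)))"

lemma projective_code_nondesarguesian: "projective_code R \<in> nondesarguesian_planes"
  unfolding projective_code_def
  by (rule nondesarguesian_free_fan_config) (simp_all add: list_config_configuration infinite_list_cells)

lemma projective_code_iso_iff: "struct_iso (projective_code R) (projective_code R') \<longleftrightarrow> list_iso R R'"
proof -
  note F = configuration_free_config[OF configuration_fan_config[OF list_config_configuration]]
  have inf: "infinite (cells (free_config (fan_config (list_config R))))" for R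
    by (intro infinite_free_config infinite_fan_config) (simp add: infinite_list_cells)
  have "struct_iso (projective_code R) (projective_code R') \<longleftrightarrow>
      config_iso (free_config (fan_config (list_config R))) (free_config (fan_config (list_config R')))"
    unfolding projective_code_def by (rule struct_iso_to_struct_iff[OF F inf F inf])
  also have "\<dots> \<longleftrightarrow> config_iso (list_config R) (list_config R')"
    by (rule free_fan_config_iso_iff[OF list_config_configuration list_config_nbr
          list_config_configuration list_config_nbr])
  finally show ?thesis by (simp add: list_config_iso_iff)
qed

text \<open>The terms that name cells do not depend on \<open>x\<close> and form a countable type.
  By induction on the stage, the presence of a fixed term is a countable combination of conditions
  on the configuration.\<close>

lemma free_config_measurable:
  fixes C :: "'a \<Rightarrow> 'u::countable config"
  assumes cells [measurable]: "\<And>v. Measurable.pred M (\<lambda>x. v \<in> cells (C x))"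
    and side [measurable]: "\<And>v. Measurable.pred M (\<lambda>x. side (C x) v)"
    and adj [measurable]: "\<And>u v. Measurable.pred M (\<lambda>x. adj (C x) u v)"
  shows "Measurable.pred M (\<lambda>x. t \<in> cells (free_config (C x)))"
    "Measurable.pred M (\<lambda>x. side (free_config (C x)) t)"
    "Measurable.pred M (\<lambda>x. adj (free_config (C x)) t t')"
proof -
  have fr_side [measurable]: "Measurable.pred M (\<lambda>x. fr_side (C x) t)" for t
    by (induction t) simp_all
  have fr_adj [measurable]: "Measurable.pred M (\<lambda>x. fr_adj (C x) t t')" for t t'
    unfolding fr_adj_def by measurable
  have stage [measurable]: "Measurable.pred M (\<lambda>x. t \<in> stage (C x) n)" for t n
  proof (induction n arbitrary: t)
    case 0
    have eq: "t \<in> stage (C x) 0 \<longleftrightarrow> (\<exists>u. t = Base u \<and> u \<in> cells (C x))" for x by auto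
    show ?case unfolding eq by measurable
  next
    case (Suc n)
    note [measurable] = Suc.IH
    show ?case unfolding stage.simps Un_iff mem_Collect_eq by measurable
  qed
  show "Measurable.pred M (\<lambda>x. t \<in> cells (free_config (C x)))"
    "Measurable.pred M (\<lambda>x. side (free_config (C x)) t)"
    "Measurable.pred M (\<lambda>x. adj (free_config (C x)) t t')"
    unfolding free_config_simps by measurable
qed

lemma projective_code_measurable:
  assumes "\<And>t. Measurable.pred M (\<lambda>x. \<rho> x t)"
  shows "(\<lambda>x. projective_code (\<rho> x)) \<in> borel_measurable M"
  unfolding projective_code_def
proof (rule borel_measurable_to_struct)
  note m [measurable] = list_config_measurable[OF assms]
  have cells: "Measurable.pred M (\<lambda>x. v \<in> cells (fan_config (list_config (\<rho> x))))" for v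
    by (cases v; simp del: list_config_simps; measurable)
  have side: "Measurable.pred M (\<lambda>x. side (fan_config (list_config (\<rho> x))) v)" for v
    by (cases v; simp del: list_config_simps; measurable)
  have adj: "Measurable.pred M (\<lambda>x. adj (fan_config (list_config (\<rho> x))) u v)" for u v
    by (cases u; cases v; simp del: list_config_simps adj_list_config_line; measurable)
  note F = free_config_measurable[OF cells side adj]
  show "Measurable.pred M (\<lambda>x. v \<in> cells (free_config (fan_config (list_config (\<rho> x)))))" for v by (rule F)
  show "Measurable.pred M (\<lambda>x. side (free_config (fan_config (list_config (\<rho> x)))) v)" for v by (rule F)
  show "Measurable.pred M (\<lambda>x. adj (free_config (fan_config (list_config (\<rho> x)))) u v)" for u v by (rule F)
  show "infinite (cells (free_config (fan_config (list_config (\<rho> x)))))" for x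
    by (intro infinite_free_config infinite_fan_config) (simp add: infinite_list_cells)
qed

text \<open>Measurability of \<open>code\<close> is assumed twice because an assumption is not
  polymorphic in the carrier type: once for the space that is acted on, and once for Cantor space
  with \<open>E0\<close>.\<close>

lemma list_iso_reducible_imp:
  fixes code :: "(nat list \<Rightarrow> bool) \<Rightarrow> struct"
  assumes K: "K \<in> sets borel" "\<And>R. code R \<in> K"
    and iso: "\<And>R R'. struct_iso (code R) (code R') \<longleftrightarrow> list_iso R R'"
    and meas: "\<And>(M :: 'x measure) \<rho>. (\<And>t. Measurable.pred M (\<lambda>x. \<rho> x t)) \<Longrightarrow>
      (\<lambda>x. code (\<rho> x)) \<in> borel_measurable M"
    and meas': "\<And>(M :: (nat \<Rightarrow> bool) measure) \<rho>. (\<And>t. Measurable.pred M (\<lambda>x. \<rho> x t)) \<Longrightarrow>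
      (\<lambda>x. code (\<rho> x)) \<in> borel_measurable M"
  shows "borel_complete TYPE('x) K \<and> \<not> admits_Ulm_classification K"
proof
  show "borel_complete TYPE('x) K"
    unfolding borel_complete_def
  proof (intro conjI K(1) allI impI)
    fix X :: "'x measure" and a assume X: "standard_borel X \<and> borel_action X a"
    obtain \<rho> :: "'x \<Rightarrow> nat list \<Rightarrow> bool" where \<rho>: "\<And>t. Measurable.pred X (\<lambda>x. \<rho> x t)"
      "\<And>x y. x \<in> space X \<Longrightarrow> y \<in> space X \<Longrightarrow> orbit_rel a x y \<longleftrightarrow> list_iso (\<rho> x) (\<rho> y)"
      using borel_action_reduces_to_list_iso[of X a] X by blast
    have "(\<lambda>x. code (\<rho> x)) \<in> measurable X (restrict_space borel K)"
      by (rule measurable_restrict_space2) (auto intro: meas \<rho>(1) K(2))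
    then show "borel_reducible X (orbit_rel a) (restrict_space borel K) struct_iso"
      unfolding borel_reducible_def by (rule bexI[rotated]) (simp add: \<rho>(2) iso)
  qed
next
  define \<rho> where "\<rho> = (\<lambda>(x :: nat \<Rightarrow> bool) (t :: nat list). case t of [] \<Rightarrow> False | d # u \<Rightarrow> x (length u) \<noteq> bit d (length u))"
  show "\<not> admits_Ulm_classification K"
  proof (rule E0_reducible_imp_not_Ulm[of "\<lambda>x. code (\<rho> x)"])
    have coord [measurable]: "Measurable.pred borel (\<lambda>x :: nat \<Rightarrow> bool. x i)" for i
      by (rule pred_coordinate) simp
    have "Measurable.pred borel (\<lambda>x. \<rho> x t)" for t
      by (cases t) (simp_all add: \<rho>_def)
    then show "(\<lambda>x. code (\<rho> x)) \<in> borel_measurable borel" by (rule meas')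
    show "struct_iso (code (\<rho> x)) (code (\<rho> y)) \<longleftrightarrow> E0 x y" for x y
      unfolding iso \<rho>_def by (rule E0_reduces_to_list_iso)
  qed (rule K(2))
qed

theorem corollary5:
  fixes K :: "struct set"
  assumes "K = simple_planes \<or> K = nondesarguesian_planes"
  shows "borel_complete TYPE('x) K \<and> \<not> admits_Ulm_classification K"
  using assms
proof
  assume K: "K = simple_planes"
  show ?thesis
    unfolding K
  proof (rule list_iso_reducible_imp[of _ simple_code])
    show "simple_planes \<in> sets borel" by (rule simple_planes_borel)
    show "simple_code R \<in> simple_planes" for R by (rule simple_code_simple)
    show "struct_iso (simple_code R) (simple_code R') \<longleftrightarrow> list_iso R R'" for R R'
      by (rule simple_code_iso_iff)
  qed (rule simple_code_measurable; assumption)+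
next
  assume K: "K = nondesarguesian_planes"
  show ?thesis
    unfolding K
  proof (rule list_iso_reducible_imp[of _ projective_code])
    show "nondesarguesian_planes \<in> sets borel" by (rule nondesarguesian_planes_borel)
    show "projective_code R \<in> nondesarguesian_planes" for R by (rule projective_code_nondesarguesian)
    show "struct_iso (projective_code R) (projective_code R') \<longleftrightarrow> list_iso R R'" for R R'
      by (rule projective_code_iso_iff)
  qed (rule projective_code_measurable; assumption)+
qed

end
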